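(* Let $S(t)$, $t\ge0$, be a (possibly killed) subordinator with Laplace exponent $\phi$ having triplet $(a,b,\nu)$ with $b>0$ or $\nu(0,+\infty)=+\infty$, and let $L(t)=\inf\{s\ge0:S(s)>t\}$, $t\ge0$, be its inverse, with distribution $l_t(ds)$. Let $P_s$, $s\ge0$, be a strongly continuous semigroup of operators on a Banach space $(\mathfrak{B},\|\cdot\|)$ with generator $(G,\mathcal{D}(G))$, such that $\|P_tu\|\le Me^{\lambda_0t}\|u\|$ for all $u\in\mathfrak{B}$, $t\ge0$, where $M>0$ and $\lambda_0\ge0$. Define, as a Bochner integral on $\mathfrak{B}$, $$\mathcal{P}_tu=\int_0^{+\infty}P_su\;l_t(ds).$$ Then, for every $u\in\mathfrak{B}$, the mapping $[0,+\infty)\ni t\mapsto q(t):=\mathcal{P}_tu$ is strongly continuous on $\mathfrak{B}$ and exponentially bounded (bounded by a constant if $\lambda_0=0$). If, in addition, $u\in\mathcal{D}(G)$, then $$\phi(\partial_t)(q(t)-q(0))=Gq(t),\qquad q(0)=u,$$ in the following sense: $q(t)\in\mathcal{D}(G)$ for all $t\ge0$; $t\mapsto q(t)$ is strongly continuous (on $\mathfrak{B}$) and exponentially bounded (bounded by a constant if $\lambda_0=0$); the generalized derivative $\phi(\partial_t)(q(t)-q(0))$ exists for all $t>0$ in the strong sense; and both $t\mapsto Gq(t)$ and $t\mapsto\phi(\partial_t)(q(t)-q(0))$ are strongly continuous and exponentially bounded (bounded if $\lambda_0=0$). Finally, if $\tilde{q}(t)$ is another solution (with the same initial datum $u$) with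 the same properties, then $\tilde{q}(t)=q(t)$ for all $t\ge0$.
   Context: A killed subordinator $S$ with Laplace exponent $\phi$ is a non-decreasing Lévy process started at $0$, sent to $+\infty$ at an independent exponential time of rate $a\ge0$ (no killing if $a=0$), with $\mathbb{E}e^{-\lambda S(t)}=e^{-t\phi(\lambda)}$ and $\phi(\lambda)=a+b\lambda+\int_0^{+\infty}(1-e^{-\lambda s})\nu(ds)$, $a,b\ge0$, $\int_0^{+\infty}(s\wedge1)\nu(ds)<+\infty$. Put $\bar\nu(t)=a+\nu(t,+\infty)$. For $\mathfrak{B}$-valued functions $f$, $$\phi(\partial_t)f(t):=\partial_t\Big(bf(t)+\int_0^tf(s)\,\bar\nu(t-s)\,ds\Big),$$ with Bochner integral and derivative in the norm of $\mathfrak{B}$ (strong sense); $\phi(\partial_t)(q(t)-q(0))$ means $\phi(\partial_t)$ applied to $t\mapsto q(t)-q(0)$. A function $h$ of $t$ is exponentially bounded if $\|h(t)\|\le Ce^{ct}$ for some constants $C,c>0$ and all $t$ in its domain. Here $\tilde{q}$ denotes just another $\mathfrak{B}$-valued function. *)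

theory Defs
  imports "HOL-Probability.Probability"
begin

section \<open>The Bochner integral without separability\<close>

text \<open>The library's integral is restricted to second countable target spaces. The following is its
  defining clause verbatim, without that restriction. Measurability for the Borel sets together with
  the approximation by simple functions yields strong measurability, so this is the usual Bochner
  integral on an arbitrary Banach space.\<close>

definition bochner_has_integral :: "'a measure \<Rightarrow> ('a \<Rightarrow> 'b::real_normed_vector) \<Rightarrow> 'b \<Rightarrow> bool" where
  "bochner_has_integral M f x \<longleftrightarrow> f \<in> borel_measurable M \<and>
     (\<exists>s. (\<forall>i. Bochner_Integration.simple_bochner_integrable M (s i)) \<and>
          (\<lambda>i::nat. \<integral>\<^sup>+y. ennreal (norm (f y - s i y)) \<partial>M) \<longlonglongrightarrow> 0 \<and>
          (\<lambda>i. Bochner_Integration.simple_bochner_integral M (s i)) \<longlonglongrightarrow> x)"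

definition bochner_integrable :: "'a measure \<Rightarrow> ('a \<Rightarrow> 'b::real_normed_vector) \<Rightarrow> bool" where
  "bochner_integrable M f \<longleftrightarrow> (\<exists>x. bochner_has_integral M f x)"

definition bochner_integral :: "'a measure \<Rightarrow> ('a \<Rightarrow> 'b::real_normed_vector) \<Rightarrow> 'b" where
  "bochner_integral M f = (THE x. bochner_has_integral M f x)"

lemma bochner_has_integral_iff_has_bochner_integral:
  fixes f :: "'a \<Rightarrow> 'b::{real_normed_vector, second_countable_topology}"
  shows "bochner_has_integral M f x \<longleftrightarrow> has_bochner_integral M f x"
  unfolding bochner_has_integral_def has_bochner_integral.simps by blast


section \<open>Killed subordinators and their inverses\<close>

text \<open>Only the values at times \<open>t \<ge> 0\<close> are relevant; path properties are required almost surely.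
  Independence of the killing time and the whole process is that of the generated sigma-algebras,
  because \<open>indep_var\<close> needs both random variables to have values in the same type.\<close>

definition levy_process :: "'w measure \<Rightarrow> (real \<Rightarrow> 'w \<Rightarrow> real) \<Rightarrow> bool" where
  "levy_process M X \<longleftrightarrow> prob_space M \<and>
     (\<forall>t\<ge>0. X t \<in> borel_measurable M) \<and>
     (AE \<omega> in M. X 0 \<omega> = 0) \<and>
     (\<forall>n \<tau>. 0 \<le> \<tau> 0 \<and> (\<forall>i<n. \<tau> i \<le> \<tau> (Suc i)) \<longrightarrow>
        prob_space.indep_vars M (\<lambda>_. borel) (\<lambda>i \<omega>. X (\<tau> (Suc i)) \<omega> - X (\<tau> i) \<omega>) {..<n}) \<and>
     (\<forall>s\<ge>0. \<forall>t\<ge>0. distr M borel (\<lambda>\<omega>. X (s + t) \<omega> - X s \<omega>) = distr M borel (X t)) \<and>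
     (AE \<omega> in M. (\<forall>t\<ge>0. ((\<lambda>s. X s \<omega>) \<longlongrightarrow> X t \<omega>) (at_right t)) \<and>
                 (\<forall>t>0. \<exists>l. ((\<lambda>s. X s \<omega>) \<longlongrightarrow> l) (at_left t)))"

definition unkilled_subordinator :: "'w measure \<Rightarrow> (real \<Rightarrow> 'w \<Rightarrow> real) \<Rightarrow> bool" where
  "unkilled_subordinator M X \<longleftrightarrow> levy_process M X \<and>
     (AE \<omega> in M. mono_on {0..} (\<lambda>t. X t \<omega>))"

definition subordinator_triplet :: "real \<Rightarrow> real \<Rightarrow> real measure \<Rightarrow> bool" where
  "subordinator_triplet a b \<nu> \<longleftrightarrow> 0 \<le> a \<and> 0 \<le> b \<and>
     sets \<nu> = sets borel \<and> emeasure \<nu> {..0} = 0 \<and> (\<integral>\<^sup>+s. ennreal (min s 1) \<partial>\<nu>) < \<infinity>"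

definition laplace_exponent :: "real \<Rightarrow> real \<Rightarrow> real measure \<Rightarrow> real \<Rightarrow> real" where
  "laplace_exponent a b \<nu> \<theta> = a + b * \<theta> + (LINT s:{0<..}|\<nu>. 1 - exp (- \<theta> * s))"

text \<open>The Laplace transform uses the convention \<open>exp (- \<theta> * \<infinity>) = 0\<close>, also for \<open>\<theta> = 0\<close>.\<close>

definition killed_subordinator ::
    "'w measure \<Rightarrow> (real \<Rightarrow> 'w \<Rightarrow> ereal) \<Rightarrow> real \<Rightarrow> real \<Rightarrow> real measure \<Rightarrow> bool" where
  "killed_subordinator M S a b \<nu> \<longleftrightarrow>
     prob_space M \<and> subordinator_triplet a b \<nu> \<and>
     (\<forall>t\<ge>0. S t \<in> borel_measurable M) \<and>
     (\<exists>X. unkilled_subordinator M X \<and>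
        (if a = 0 then AE \<omega> in M. \<forall>t\<ge>0. S t \<omega> = ereal (X t \<omega>)
         else \<exists>\<zeta>. distributed M lborel \<zeta> (\<lambda>x. ennreal (exponential_density a x)) \<and>
                prob_space.indep_set M
                  {\<zeta> -` A \<inter> space M | A. A \<in> sets borel}
                  {(\<lambda>\<omega>. \<lambda>t\<in>{0..}. X t \<omega>) -` B \<inter> space M | B. B \<in> sets (Pi\<^sub>M {0..} (\<lambda>_. borel))} \<and>
                (AE \<omega> in M. \<forall>t\<ge>0. S t \<omega> = (if t < \<zeta> \<omega> then ereal (X t \<omega>) else \<infinity>)))) \<and>
     (\<forall>t\<ge>0. \<forall>\<theta>\<ge>0.
        (LINT \<omega>|M. (if S t \<omega> = \<infinity> then 0 else exp (- \<theta> * real_of_ereal (S t \<omega>))))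
          = exp (- t * laplace_exponent a b \<nu> \<theta>))"

definition inverse_process :: "(real \<Rightarrow> 'w \<Rightarrow> ereal) \<Rightarrow> real \<Rightarrow> 'w \<Rightarrow> real" where
  "inverse_process S t \<omega> = Inf {s. 0 \<le> s \<and> ereal t < S s \<omega>}"

text \<open>As the paths of \<open>S\<close> are regular only almost surely, \<open>inverse_process S t\<close> is in general a random
  variable only up to null sets, hence the completion. It is almost surely the infimum of a nonempty
  set if \<open>b > 0\<close> or \<open>\<nu>\<close> is infinite.\<close>

definition inverse_law :: "'w measure \<Rightarrow> (real \<Rightarrow> 'w \<Rightarrow> ereal) \<Rightarrow> real \<Rightarrow> real measure" where
  "inverse_law M S t = distr (completion M) borel (inverse_process S t)"


section \<open>Strongly continuous semigroups\<close>

definition C0_semigroup :: "(real \<Rightarrow> 'b::banach \<Rightarrow>\<^sub>L 'b) \<Rightarrow> bool" where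
  "C0_semigroup P \<longleftrightarrow> P 0 = id_blinfun \<and>
     (\<forall>s\<ge>0. \<forall>t\<ge>0. P (s + t) = P s o\<^sub>L P t) \<and>
     (\<forall>u. continuous_on {0..} (\<lambda>t. blinfun_apply (P t) u))"

definition generator_dom :: "(real \<Rightarrow> 'b::banach \<Rightarrow>\<^sub>L 'b) \<Rightarrow> 'b set" where
  "generator_dom P = {u. \<exists>v. ((\<lambda>h. (blinfun_apply (P h) u - u) /\<^sub>R h) \<longlongrightarrow> v) (at_right 0)}"

definition generator :: "(real \<Rightarrow> 'b::banach \<Rightarrow>\<^sub>L 'b) \<Rightarrow> 'b \<Rightarrow> 'b" where
  "generator P u = Lim (at_right 0) (\<lambda>h. (blinfun_apply (P h) u - u) /\<^sub>R h)"

definition subordinate_integrand :: "(real \<Rightarrow> 'b::banach \<Rightarrow>\<^sub>L 'b) \<Rightarrow> 'b \<Rightarrow> real \<Rightarrow> 'b" where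
  "subordinate_integrand P u s = indicator {0..} s *\<^sub>R blinfun_apply (P s) u"

definition time_changed ::
    "'w measure \<Rightarrow> (real \<Rightarrow> 'w \<Rightarrow> ereal) \<Rightarrow> (real \<Rightarrow> 'b::banach \<Rightarrow>\<^sub>L 'b) \<Rightarrow> real \<Rightarrow> 'b \<Rightarrow> 'b" where
  "time_changed M S P t u = bochner_integral (inverse_law M S t) (subordinate_integrand P u)"


section \<open>The generalized derivative\<close>

definition levy_tail :: "real \<Rightarrow> real measure \<Rightarrow> real \<Rightarrow> real" where
  "levy_tail a \<nu> t = a + measure \<nu> {t<..}"

text \<open>The convolution is taken over the open interval, so that the tail is only evaluated at
  positive arguments, where it is finite.\<close>

definition phi_integrand ::
    "real \<Rightarrow> real measure \<Rightarrow> (real \<Rightarrow> 'b::banach) \<Rightarrow> real \<Rightarrow> real \<Rightarrow> 'b" where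
  "phi_integrand a \<nu> f t s = indicator {0<..<t} s *\<^sub>R (levy_tail a \<nu> (t - s) *\<^sub>R f s)"

definition phi_primitive ::
    "real \<Rightarrow> real \<Rightarrow> real measure \<Rightarrow> (real \<Rightarrow> 'b::banach) \<Rightarrow> real \<Rightarrow> 'b" where
  "phi_primitive a b \<nu> f t = b *\<^sub>R f t + bochner_integral lborel (phi_integrand a \<nu> f t)"

definition phi_differentiable ::
    "real \<Rightarrow> real \<Rightarrow> real measure \<Rightarrow> (real \<Rightarrow> 'b::banach) \<Rightarrow> real \<Rightarrow> bool" where
  "phi_differentiable a b \<nu> f t \<longleftrightarrow>
     (\<forall>\<^sub>F r in nhds t. bochner_integrable lborel (phi_integrand a \<nu> f r)) \<and>
     phi_primitive a b \<nu> f differentiable (at t)"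

definition phi_derivative ::
    "real \<Rightarrow> real \<Rightarrow> real measure \<Rightarrow> (real \<Rightarrow> 'b::banach) \<Rightarrow> real \<Rightarrow> 'b" where
  "phi_derivative a b \<nu> f t = vector_derivative (phi_primitive a b \<nu> f) (at t)"


section \<open>Solutions\<close>

definition exponentially_bounded_on :: "real set \<Rightarrow> (real \<Rightarrow> 'b::real_normed_vector) \<Rightarrow> bool" where
  "exponentially_bounded_on T h \<longleftrightarrow> (\<exists>C>0. \<exists>c>0. \<forall>t\<in>T. norm (h t) \<le> C * exp (c * t))"

text \<open>Strong continuity and exponential boundedness on \<open>T\<close>, with boundedness if the growth bound
  \<open>lam0\<close> of the semigroup is zero.\<close>

definition regular_on :: "real \<Rightarrow> real set \<Rightarrow> (real \<Rightarrow> 'b::real_normed_vector) \<Rightarrow> bool" where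
  "regular_on lam0 T h \<longleftrightarrow> continuous_on T h \<and> exponentially_bounded_on T h \<and>
     (lam0 = 0 \<longrightarrow> bounded (h ` T))"

text \<open>The generalized derivative is considered for \<open>t > 0\<close>, all other requirements are on
  \<open>[0, \<infinity>)\<close>.\<close>

definition phi_solution ::
    "real \<Rightarrow> real \<Rightarrow> real measure \<Rightarrow> (real \<Rightarrow> 'b::banach \<Rightarrow>\<^sub>L 'b) \<Rightarrow> real \<Rightarrow> 'b \<Rightarrow> (real \<Rightarrow> 'b) \<Rightarrow> bool" where
  "phi_solution a b \<nu> P lam0 u q \<longleftrightarrow>
     q 0 = u \<and>
     (\<forall>t\<ge>0. q t \<in> generator_dom P) \<and>
     regular_on lam0 {0..} q \<and>
     (\<forall>t>0. phi_differentiable a b \<nu> (\<lambda>s. q s - q 0) t) \<and>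
     (\<forall>t>0. phi_derivative a b \<nu> (\<lambda>s. q s - q 0) t = generator P (q t)) \<and>
     regular_on lam0 {0..} (\<lambda>t. generator P (q t)) \<and>
     regular_on lam0 {0<..} (phi_derivative a b \<nu> (\<lambda>s. q s - q 0))"

end

theory Submission
  imports Defs "HOL-Real_Asymp.Real_Asymp"
begin

text \<open>
  Hahn-Banach functionals reduce all identities between Banach space valued functions to scalar ones,
  for which the Laplace transform \<open>\<L>\<close> in time is injective on continuous functions of exponential
  order. Two facts drive the proof. Convolution with the tail of \<open>\<nu>\<close>, plus \<open>a\<close> and the drift, has symbol
  \<open>\<phi>(\<lambda>) / \<lambda>\<close>, and the inverse subordinator at an independent exponential time of rate \<open>\<lambda>\<close> is
  exponential of rate \<open>\<phi>(\<lambda>)\<close>, as \<open>L t > r\<close> means \<open>S r < t\<close> up to one value of \<open>t\<close>. Hence, with the resolvent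
  \<open>R\<close> of the generator, \<open>\<L> q (\<lambda>) = \<phi>(\<lambda>) / \<lambda> R(\<phi>(\<lambda>)) u\<close>, which solves the transformed equation. Conversely,
  applying \<open>R(\<phi>(\<lambda>))\<close> to the equation gives this transform for every solution, so solutions are
  unique. Strong continuity of \<open>q\<close> comes from the continuity of the paths of \<open>L\<close>, which holds because
  \<open>b > 0\<close> or \<open>\<nu>(0,\<infinity>) = \<infinity>\<close> makes \<open>S\<close> strictly increasing.
\<close>

section \<open>Norming functionals\<close>

text \<open>The space need not be separable, which shapes the proof: inside it, only the existence
  of Bochner integrals and elementary limits are shown, while Fubini, substitution and dominated
  convergence are applied to scalar integrands. For the same reason the resolvent never appears as
  an operator; composed with a functional \<open>l\<close> it is
  \<open>resolvent_functional\<close>, the transform of a scalar orbit, and in this form it is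
  applied to the equation. A formula for the transform does not by itself provide a derivative.
  Existence therefore goes through the integrated equation: \<open>phi_primitive\<close> of q - q(0)
  and the primitive of t \<mapsto> \<open>Q t (generator P u)\<close> are continuous with the same
  transform, hence equal, and the second is differentiated by the fundamental theorem of calculus.
  The equation follows because the time change commutes with the generator. Exponential bounds rest
  on E exp(lam0 L(t)), which is nondecreasing in t: comparison with its mean at an exponential time
  of rate lam, where lam0 < \<phi>(lam), gives growth at most exp(lam t).\<close>

lemma hahn_banach_extension_value:
  fixes H :: "('b::real_normed_vector \<times> real) set" and z :: 'b
  assumes H: "subspace H" and le: "\<And>y r. (y, r) \<in> H \<Longrightarrow> r \<le> norm y"
  obtains \<xi> where "\<And>y r t. (y, r) \<in> H \<Longrightarrow> r + t * \<xi> \<le> norm (y + t *\<^sub>R z)"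
proof -
  \<comment> \<open>Domination at t = -1 gives lower bounds for \<open>\<xi>\<close>, at t = 1 upper
    bounds. Every lower bound lies below every upper bound, so the supremum of the lower bounds is
    admissible.\<close>
  have cross: "r - norm (y - z) \<le> norm (y' + z) - r'" if "(y, r) \<in> H" "(y', r') \<in> H" for y r y' r'
  proof -
    have "(y + y', r + r') \<in> H"
      using subspace_add[OF H that] by simp
    then have "r + r' \<le> norm ((y - z) + (y' + z))"
      using le by (simp add: algebra_simps)
    then show ?thesis
      using norm_triangle_ineq[of "y - z" "y' + z"] by linarith
  qed
  define \<xi> where "\<xi> = (SUP p\<in>H. snd p - norm (fst p - z))"
  have zero: "(0, 0) \<in> H"
    using subspace_0[OF H] by (simp add: zero_prod_def)
  have bdd: "bdd_above ((\<lambda>p. snd p - norm (fst p - z)) ` H)"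
    using cross[OF _ zero] by (intro bdd_aboveI[of _ "norm z"]) auto
  have lower: "r - norm (y - z) \<le> \<xi>" if "(y, r) \<in> H" for y r
    using cSUP_upper[OF that bdd] by (simp add: \<xi>_def)
  have upper: "\<xi> \<le> norm (y + z) - r" if "(y, r) \<in> H" for y r
    unfolding \<xi>_def using zero cross[OF _ that] by (intro cSUP_least) auto
  \<comment> \<open>Dividing by the modulus of t reduces every nonzero t to these two cases.\<close>
  have scale: "(inverse t *\<^sub>R y, inverse t * r) \<in> H" if "(y, r) \<in> H" for t y r
    using subspace_scale[OF H that, of "inverse t"] by simp
  have "r + t * \<xi> \<le> norm (y + t *\<^sub>R z)" if yr: "(y, r) \<in> H" for y r t
  proof (cases t "0::real" rule: linorder_cases)
    case equal
    then show ?thesis using le[OF yr] by simp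
  next
    case greater
    have "t * \<xi> \<le> t * (norm (inverse t *\<^sub>R y + z) - inverse t * r)"
      using upper[OF scale[OF yr, of t]] greater by (intro mult_left_mono) auto
    also have "\<dots> = norm (t *\<^sub>R (inverse t *\<^sub>R y + z)) - r"
      using greater by (simp only: norm_scaleR right_diff_distrib) simp
    finally show ?thesis
      using greater by (simp add: scaleR_add_right)
  next
    case less
    have "(- t) * (inverse (- t) * r - norm (inverse (- t) *\<^sub>R y - z)) \<le> (- t) * \<xi>"
      using lower[OF scale[OF yr, of "- t"]] less by (intro mult_left_mono) auto
    moreover have "(- t) *\<^sub>R (inverse (- t) *\<^sub>R y - z) = y + t *\<^sub>R z"
      using less by (simp add: scaleR_diff_right)
    then have "(- t) * norm (inverse (- t) *\<^sub>R y - z) = norm (y + t *\<^sub>R z)"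
      using less norm_scaleR[of "- t" "inverse (- t) *\<^sub>R y - z"] by simp
    moreover have "(- t) * (inverse (- t) * r) = r"
      using less by simp
    ultimately show ?thesis
      by (simp only: right_diff_distrib)
  qed
  then show ?thesis by (rule that)
qed

text \<open>Functionals dominated by the norm are handled through their graphs, which are subspaces of
  the product with the real line.\<close>

theorem norming_functional:
  fixes x :: "'b::real_normed_vector"
  obtains l :: "'b \<Rightarrow> real" where "bounded_linear l" "\<And>y. \<bar>l y\<bar> \<le> norm y" "l x = norm x"
proof -
  define A :: "('b \<times> real) set set" where
    "A = {H. subspace H \<and> (x, norm x) \<in> H \<and> (\<forall>y r. (y, r) \<in> H \<longrightarrow> r \<le> norm y)}"
  have "subspace (span {(x, norm x)})" "(x, norm x) \<in> span {(x, norm x)}"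
    by (auto intro: span_base)
  moreover have "r \<le> norm y" if "(y, r) \<in> span {(x, norm x)}" for y r
    using that by (auto simp: span_singleton mult_right_mono)
  ultimately have "span {(x, norm x)} \<in> A"
    by (simp add: A_def)
  then have "A \<noteq> {}" by blast
  moreover have "\<Union>\<C> \<in> A" if "\<C> \<noteq> {}" "subset.chain A \<C>" for \<C>
  proof -
    have sub: "H \<in> A" if "H \<in> \<C>" for H
      using \<open>subset.chain A \<C>\<close> that by (auto simp: subset.chain_def)
    have tot: "H \<subseteq> H' \<or> H' \<subseteq> H" if "H \<in> \<C>" "H' \<in> \<C>" for H H'
      using \<open>subset.chain A \<C>\<close> that by (auto simp: subset.chain_def)
    have "subspace (\<Union>\<C>)"
    proof (rule subspaceI)
      obtain H where "H \<in> \<C>" using \<open>\<C> \<noteq> {}\<close> by blast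
      then show "0 \<in> \<Union>\<C>"
        using sub[of H] subspace_0[of H] by (auto simp: A_def)
      show "p + q \<in> \<Union>\<C>" if "p \<in> \<Union>\<C>" "q \<in> \<Union>\<C>" for p q
      proof -
        obtain H where "H \<in> \<C>" "p \<in> H" "q \<in> H"
          using \<open>p \<in> \<Union>\<C>\<close> \<open>q \<in> \<Union>\<C>\<close> tot by blast
        then show ?thesis
          using sub[of H] subspace_add[of H p q] by (auto simp: A_def)
      qed
      show "c *\<^sub>R p \<in> \<Union>\<C>" if pC: "p \<in> \<Union>\<C>" for c p
      proof -
        obtain H where "H \<in> \<C>" "p \<in> H"
          using pC by blast
        then show ?thesis
          using sub[of H] subspace_scale[of H p c] by (auto simp: A_def)
      qed
    qed
    then show ?thesis
      using \<open>\<C> \<noteq> {}\<close> sub by (auto simp: A_def)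
  qed
  ultimately obtain H where "H \<in> A" and max: "\<And>H'. H' \<in> A \<Longrightarrow> H \<subseteq> H' \<Longrightarrow> H' = H"
    using subset_Zorn_nonempty[of A] by metis
  then have sub: "subspace H" and xH: "(x, norm x) \<in> H" and le: "\<And>y r. (y, r) \<in> H \<Longrightarrow> r \<le> norm y"
    by (auto simp: A_def)
  \<comment> \<open>Maximality makes the functional total: the graph enlarged by the line through
    \<open>(z, \<xi>)\<close> is still dominated by the norm.\<close>
  have "\<exists>r. (z, r) \<in> H" for z
  proof -
    obtain \<xi> where \<xi>: "\<And>y r t. (y, r) \<in> H \<Longrightarrow> r + t * \<xi> \<le> norm (y + t *\<^sub>R z)"
      using hahn_banach_extension_value[OF sub le] by blast
    define H' where "H' = {p + q | p q. p \<in> H \<and> q \<in> span {(z, \<xi>)}}"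
    have sub': "subspace H'"
      unfolding H'_def by (intro subspace_sums sub subspace_span)
    have HH': "H \<subseteq> H'"
    proof
      fix p assume "p \<in> H"
      then have "p + 0 \<in> H'"
        unfolding H'_def using span_zero by blast
      then show "p \<in> H'" by simp
    qed
    have "r \<le> norm y" if "(y, r) \<in> H'" for y r
      using that \<xi> by (auto simp: H'_def span_singleton)
    then have "H' = H"
      using xH sub' HH' by (intro max) (auto simp: A_def)
    moreover have "(z, \<xi>) \<in> H'"
    proof -
      have "0 + (z, \<xi>) \<in> H'"
        unfolding H'_def using subspace_0[OF sub] span_base[of "(z, \<xi>)" "{(z, \<xi>)}"] by blast
      then show ?thesis by simp
    qed
    ultimately show ?thesis by blast
  qed
  then obtain l where l: "\<And>z. (z, l z) \<in> H"
    by metis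
  \<comment> \<open>An element (0, d) of the graph satisfies d \<le> 0, and so does its negative;
    hence the maximal relation is a function.\<close>
  have uniq: "r = l y" if "(y, r) \<in> H" for y r
  proof -
    have "(0, r - l y) \<in> H" "(0, l y - r) \<in> H"
      using subspace_diff[OF sub that l[of y]] subspace_diff[OF sub l[of y] that] by simp_all
    then show ?thesis
      using le[of 0 "r - l y"] le[of 0 "l y - r"] by simp
  qed
  have "l (y + z) = l y + l z" for y z
    using uniq subspace_add[OF sub l[of y] l[of z]] by simp
  moreover have "l (c *\<^sub>R y) = c *\<^sub>R l y" for c y
    using uniq subspace_scale[OF sub l[of y], of c] by simp
  moreover have bound: "\<bar>l y\<bar> \<le> norm y" for y
    using le[OF l[of y]] le[OF subspace_neg[OF sub l[of y], simplified]] by simp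
  ultimately have "bounded_linear l"
    by (intro bounded_linear_intro[where K = 1]) auto
  then show ?thesis
    using bound uniq[OF xH] that by simp
qed

lemma eq_by_functionals:
  fixes x y :: "'b::real_normed_vector"
  assumes "\<And>l :: 'b \<Rightarrow> real. bounded_linear l \<Longrightarrow> l x = l y"
  shows "x = y"
proof -
  obtain l where l: "bounded_linear l" "l (x - y) = norm (x - y)"
    using norming_functional by blast
  then show ?thesis
    using assms[OF l(1)] by (simp add: linear_diff[OF bounded_linear.linear[OF l(1)]])
qed

text \<open>Restricting to functionals of norm at most 1 lets integral estimates pass from scalars
  to the norm without an extra constant.\<close>

lemma norm_le_by_functionals:
  fixes x :: "'b::real_normed_vector"
  assumes "\<And>l :: 'b \<Rightarrow> real. bounded_linear l \<Longrightarrow> (\<And>y. \<bar>l y\<bar> \<le> norm y) \<Longrightarrow> l x \<le> B"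
  shows "norm x \<le> B"
proof -
  obtain l where "bounded_linear l" "\<And>y. \<bar>l y\<bar> \<le> norm y" "l x = norm x"
    using norming_functional by blast
  then show ?thesis
    using assms by metis
qed

section \<open>Existence of Bochner integrals\<close>

text \<open>On a nonseparable space a difference of two Borel functions may fail to be measurable. A
  simple function has finitely many values, and for each of them only a constant is subtracted from
  \<open>f\<close>.\<close>

lemma borel_measurable_norm_diff_simple:
  fixes f s :: "'a \<Rightarrow> 'b::real_normed_vector"
  assumes f: "f \<in> borel_measurable M" and s: "simple_function M s"
  shows "(\<lambda>x. norm (f x - s x)) \<in> borel_measurable M"
proof (rule measurable_compose_countable'[where f = "\<lambda>c x. norm (f x - c)" and g = s and I = "s ` space M"])
  show "(\<lambda>x. norm (f x - c)) \<in> borel_measurable M" for c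
  proof (rule measurable_compose[OF f])
    show "(\<lambda>y. norm (y - c)) \<in> borel_measurable borel"
      by (intro borel_measurable_continuous_onI continuous_intros)
  qed
  show "s \<in> measurable M (count_space (s ` space M))"
    using s by (auto simp: simple_function_def measurable_count_space_eq2)
  show "countable (s ` space M)"
    using s by (auto simp: simple_function_def intro: countable_finite)
qed

text \<open>The images of the approximating simple functions approximate \<open>l (f y)\<close>; the
  error grows at most by the factor \<open>K\<close> bounding \<open>l\<close>.\<close>

lemma has_bochner_integral_functional:
  fixes l :: "'b::real_normed_vector \<Rightarrow> real"
  assumes l: "bounded_linear l" and f: "bochner_has_integral M f x"
  shows "has_bochner_integral M (\<lambda>y. l (f y)) (l x)"
proof -
  interpret l: bounded_linear l by fact
  from f obtain s where fm: "f \<in> borel_measurable M"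
    and s: "\<And>i. Bochner_Integration.simple_bochner_integrable M (s i)"
    and lim: "(\<lambda>i::nat. \<integral>\<^sup>+y. ennreal (norm (f y - s i y)) \<partial>M) \<longlonglongrightarrow> 0"
    and x: "(\<lambda>i. Bochner_Integration.simple_bochner_integral M (s i)) \<longlonglongrightarrow> x"
    unfolding bochner_has_integral_def by blast
  have sf: "simple_function M (s i)" for i
    using s[of i] by (simp add: Bochner_Integration.simple_bochner_integrable.simps)
  obtain K where K: "K > 0" "\<And>y. norm (l y) \<le> norm y * K"
    using l.pos_bounded by blast
  show ?thesis
  proof (rule has_bochner_integral.intros[where s = "\<lambda>i y. l (s i y)"])
    show "(\<lambda>y. l (f y)) \<in> borel_measurable M"
      by (intro measurable_compose[OF fm] borel_measurable_continuous_onI l.continuous_on continuous_on_id)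
    show "Bochner_Integration.simple_bochner_integrable M (\<lambda>y. l (s i y))" for i
      using Bochner_Integration.simple_bochner_integrable_compose2[of "\<lambda>y _. l y", OF _ s[of i] s[of i]]
      by (simp add: l.zero)
    show "(\<lambda>i. Bochner_Integration.simple_bochner_integral M (\<lambda>y. l (s i y))) \<longlonglongrightarrow> l x"
      using l.tendsto[OF x]
      by (simp add: Bochner_Integration.simple_bochner_integral_linear[OF l.linear_axioms s])
    have le: "(\<integral>\<^sup>+y. norm (l (f y) - l (s i y)) \<partial>M) \<le> ennreal K * (\<integral>\<^sup>+y. norm (f y - s i y) \<partial>M)" for i
    proof -
      have "(\<integral>\<^sup>+y. norm (l (f y) - l (s i y)) \<partial>M) \<le> (\<integral>\<^sup>+y. ennreal K * norm (f y - s i y) \<partial>M)"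
        using K by (intro nn_integral_mono)
          (simp add: l.diff[symmetric] ennreal_mult[symmetric] mult.commute)
      also have "\<dots> = ennreal K * (\<integral>\<^sup>+y. norm (f y - s i y) \<partial>M)"
        using borel_measurable_norm_diff_simple[OF fm sf[of i]] by (intro nn_integral_cmult) simp
      finally show ?thesis .
    qed
    have "(\<lambda>i. ennreal K * (\<integral>\<^sup>+y. norm (f y - s i y) \<partial>M)) \<longlonglongrightarrow> ennreal K * 0"
      using lim by (intro ennreal_tendsto_cmult) auto
    then have lim0: "(\<lambda>i. ennreal K * (\<integral>\<^sup>+y. norm (f y - s i y) \<partial>M)) \<longlonglongrightarrow> 0"
      by simp
    have "\<forall>\<^sub>F i in sequentially. 0 \<le> (\<integral>\<^sup>+y. norm (l (f y) - l (s i y)) \<partial>M)"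
      and "\<forall>\<^sub>F i in sequentially. (\<integral>\<^sup>+y. norm (l (f y) - l (s i y)) \<partial>M)
        \<le> ennreal K * (\<integral>\<^sup>+y. norm (f y - s i y) \<partial>M)"
      using le by auto
    from tendsto_sandwich[OF this tendsto_const lim0]
    show "(\<lambda>i. \<integral>\<^sup>+y. norm (l (f y) - l (s i y)) \<partial>M) \<longlonglongrightarrow> 0" .
  qed
qed

text \<open>Pointwise approximation by simple functions replaces separability as the source of
  strong measurability.\<close>

lemma bochner_integrableI_simple_limit:
  fixes f :: "'a \<Rightarrow> 'b::banach"
  assumes sf: "\<And>i. simple_function M (s i)"
    and lim: "\<And>x. x \<in> space M \<Longrightarrow> (\<lambda>i::nat. s i x) \<longlonglongrightarrow> f x"
    and fin: "(\<integral>\<^sup>+x. norm (f x) \<partial>M) < \<infinity>"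
  shows "bochner_integrable M f"
proof -
  have sm: "s i \<in> borel_measurable M" for i
    using sf by (rule borel_measurable_simple_function)
  have fm: "f \<in> borel_measurable M"
    using sm lim by (rule borel_measurable_LIMSEQ_metric)
  have nf [measurable]: "(\<lambda>x. norm (f x)) \<in> borel_measurable M"
    using fm by simp
  have ns [measurable]: "(\<lambda>x. norm (s i x)) \<in> borel_measurable M" for i
    using sm[of i] by simp
  text \<open>The truncation makes the approximation dominated by the limit.\<close>
  define t where "t i x = (if norm (s i x) \<le> 2 * norm (f x) then s i x else 0)" for i x
  have tf: "simple_function M (t i)" for i
    unfolding t_def by (intro simple_function_If sf) measurable
  have tle: "norm (t i x) \<le> 2 * norm (f x)" for i x
    by (auto simp: t_def)
  have tlim: "(\<lambda>i. t i x) \<longlonglongrightarrow> f x" if x: "x \<in> space M" for x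
  proof (cases "f x = 0")
    case True
    then have "t i x = 0" for i
      using tle[of i x] by simp
    then show ?thesis using True by simp
  next
    case False
    then have "\<forall>\<^sub>F i in sequentially. norm (s i x) < 2 * norm (f x)"
      using tendsto_norm[OF lim[OF x]] by (intro order_tendstoD(2)) auto
    then have "\<forall>\<^sub>F i in sequentially. s i x = t i x"
      by eventually_elim (simp add: t_def)
    then show ?thesis
      using lim[OF x] by (rule Lim_transform_eventually[rotated])
  qed
  have nd [measurable]: "(\<lambda>x. norm (f x - t i x)) \<in> borel_measurable M" for i
    by (rule borel_measurable_norm_diff_simple[OF fm tf])
  have conv: "(\<lambda>i. \<integral>\<^sup>+x. norm (f x - t i x) \<partial>M) \<longlonglongrightarrow> 0"
  proof -
    have "(\<lambda>i. \<integral>\<^sup>+x. norm (f x - t i x) \<partial>M) \<longlonglongrightarrow> (\<integral>\<^sup>+x. 0 \<partial>M)"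
    \<comment> \<open>The factor 3 is 1 for \<open>f\<close> plus 2 for the truncated
      approximant.\<close>
    proof (rule nn_integral_dominated_convergence[where w = "\<lambda>x. ennreal (3 * norm (f x))"])
      show "AE x in M. ennreal (norm (f x - t i x)) \<le> ennreal (3 * norm (f x))" for i
      proof (intro always_eventually allI ennreal_leI)
        fix x
        have "norm (f x - t i x) \<le> norm (f x) + norm (t i x)"
          by (rule norm_triangle_ineq4)
        then show "norm (f x - t i x) \<le> 3 * norm (f x)"
          using tle[of i x] by simp
      qed
      have "(\<integral>\<^sup>+x. ennreal (3 * norm (f x)) \<partial>M) = 3 * (\<integral>\<^sup>+x. norm (f x) \<partial>M)"
        by (subst nn_integral_cmult[symmetric]) (auto simp: ennreal_mult)
      then show "(\<integral>\<^sup>+x. ennreal (3 * norm (f x)) \<partial>M) < \<infinity>"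
        using fin by (simp add: ennreal_mult_less_top)
      show "AE x in M. (\<lambda>i. ennreal (norm (f x - t i x))) \<longlonglongrightarrow> 0"
      proof (rule AE_I2)
        fix x assume "x \<in> space M"
        then have "(\<lambda>i. norm (f x - t i x)) \<longlonglongrightarrow> norm (f x - f x)"
          by (intro tendsto_intros tlim)
        then show "(\<lambda>i. ennreal (norm (f x - t i x))) \<longlonglongrightarrow> 0"
          using tendsto_ennrealI by fastforce
      qed
    qed auto
    then show ?thesis by simp
  qed
  have sbi: "Bochner_Integration.simple_bochner_integrable M (t i)" for i
  proof (rule simple_bochner_integrableI_bounded[OF tf])
    have "(\<integral>\<^sup>+x. norm (t i x) \<partial>M) \<le> (\<integral>\<^sup>+x. 2 * norm (f x) \<partial>M)"
      using tle by (intro nn_integral_mono) auto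
    also have "\<dots> = 2 * (\<integral>\<^sup>+x. norm (f x) \<partial>M)"
      by (subst nn_integral_cmult[symmetric]) (auto simp: ennreal_mult)
    also have "\<dots> < \<infinity>"
      using fin by (simp add: ennreal_mult_less_top)
    finally show "(\<integral>\<^sup>+x. norm (t i x) \<partial>M) < \<infinity>" .
  qed
  let ?t = "\<lambda>i. Bochner_Integration.simple_bochner_integral M (t i)"
  \<comment> \<open>Comparing both approximants with \<open>f\<close> makes their integrals a Cauchy
    sequence; completeness then supplies the value of the integral.\<close>
  have bound: "ennreal (dist (?t m) (?t n))
      \<le> (\<integral>\<^sup>+x. norm (f x - t m x) \<partial>M) + (\<integral>\<^sup>+x. norm (f x - t n x) \<partial>M)" for m n
  proof -
    have "ennreal (dist (?t m) (?t n)) = norm (Bochner_Integration.simple_bochner_integral M (\<lambda>x. t m x - t n x))"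
      by (simp add: dist_norm simple_bochner_integral_diff[OF sbi sbi])
    also have "\<dots> \<le> Bochner_Integration.simple_bochner_integral M (\<lambda>x. norm (t m x - t n x))"
      by (intro ennreal_leI simple_bochner_integral_norm_bound
            simple_bochner_integrable_compose2[of "(-)", OF _ sbi sbi]) simp
    also have "\<dots> = (\<integral>\<^sup>+x. norm (t m x - t n x) \<partial>M)"
      by (intro simple_bochner_integral_eq_nn_integral
            simple_bochner_integrable_compose2[of "\<lambda>x y. norm (x - y)", OF _ sbi sbi]) auto
    also have "\<dots> \<le> (\<integral>\<^sup>+x. ennreal (norm (f x - t m x)) + ennreal (norm (f x - t n x)) \<partial>M)"
    proof (intro nn_integral_mono)
      fix x
      have "norm (t m x - t n x) \<le> norm (f x - t m x) + norm (f x - t n x)"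
        using norm_triangle_ineq4[of "f x - t n x" "f x - t m x"] by (simp add: algebra_simps)
      then show "ennreal (norm (t m x - t n x)) \<le> ennreal (norm (f x - t m x)) + ennreal (norm (f x - t n x))"
        by (simp flip: ennreal_plus)
    qed
    also have "\<dots> = (\<integral>\<^sup>+x. norm (f x - t m x) \<partial>M) + (\<integral>\<^sup>+x. norm (f x - t n x) \<partial>M)"
      by (rule nn_integral_add) auto
    finally show ?thesis .
  qed
  have "Cauchy ?t"
  proof (rule metric_CauchyI)
    fix e :: real assume e: "0 < e"
    then have "\<forall>\<^sub>F i in sequentially. (\<integral>\<^sup>+x. norm (f x - t i x) \<partial>M) < ennreal (e / 2)"
      using conv by (intro order_tendstoD(2)) auto
    then obtain N where N: "\<And>i. i \<ge> N \<Longrightarrow> (\<integral>\<^sup>+x. norm (f x - t i x) \<partial>M) < ennreal (e / 2)"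
      by (auto simp: eventually_sequentially)
    have "dist (?t m) (?t n) < e" if "m \<ge> N" "n \<ge> N" for m n
    proof -
      have "ennreal (dist (?t m) (?t n)) < ennreal (e / 2) + ennreal (e / 2)"
        using bound add_strict_mono[OF N[OF that(1)] N[OF that(2)]] by (rule le_less_trans)
      then show ?thesis
        using e by (simp add: ennreal_less_iff flip: ennreal_plus)
    qed
    then show "\<exists>M. \<forall>m\<ge>M. \<forall>n\<ge>M. dist (?t m) (?t n) < e" by blast
  qed
  then obtain x where "?t \<longlonglongrightarrow> x"
    by (meson Cauchy_convergent convergent_def)
  then have "bochner_has_integral M f x"
    unfolding bochner_has_integral_def using fm sbi conv by blast
  then show ?thesis
    unfolding bochner_integrable_def by blast
qed

text \<open>The approximants evaluate \<open>g\<close> at simple approximations of the identity on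
  the line, so continuity of \<open>g\<close> suffices whatever its range. Both Bochner integrals of
  the theorem have this form: \<open>c\<close> is an indicator or a shifted tail, \<open>g\<close>
  an extended orbit or an extended solution.\<close>

lemma bochner_integrable_scaleR_continuous:
  fixes g :: "real \<Rightarrow> 'b::banach"
  assumes M: "sets M = sets borel" and c: "c \<in> borel_measurable borel"
    and g: "continuous_on UNIV g"
    and int: "integrable M (\<lambda>s. c s * norm (g s))"
  shows "bochner_integrable M (\<lambda>s. c s *\<^sub>R g s)"
proof -
  have sp: "space M = UNIV"
    using M by (metis sets_eq_imp_space_eq space_borel)
  have c': "c \<in> borel_measurable M" and id: "(\<lambda>x. x) \<in> borel_measurable M"
    using c by (simp_all add: measurable_cong_sets[OF M refl])
  obtain C where C: "\<And>i. simple_function M (C i)" "\<And>x. (\<lambda>i. C i x) \<longlonglongrightarrow> c x"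
    using borel_measurable_implies_sequence_metric[OF c', of 0] sp by auto
  obtain R where R: "\<And>i. simple_function M (R i)" "\<And>x. (\<lambda>i. R i x) \<longlonglongrightarrow> x"
    using borel_measurable_implies_sequence_metric[OF id, of 0] sp by auto
  show ?thesis
  proof (rule bochner_integrableI_simple_limit)
    show "simple_function M (\<lambda>x. C i x *\<^sub>R g (R i x))" for i
      using C(1) R(1) by (rule simple_function_compose2)
    show "(\<lambda>i. C i x *\<^sub>R g (R i x)) \<longlonglongrightarrow> c x *\<^sub>R g x" for x
      using g R(2) by (intro tendsto_intros C)
        (auto simp: continuous_on_eq_continuous_at isCont_def intro: isCont_tendsto_compose)
    show "(\<integral>\<^sup>+x. norm (c x *\<^sub>R g x) \<partial>M) < \<infinity>"
      using int by (simp add: integrable_iff_bounded abs_mult)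
  qed
qed

lemma bochner_has_integral_unique:
  assumes "bochner_has_integral M f x" "bochner_has_integral M f y"
  shows "x = y"
proof (rule eq_by_functionals)
  fix l :: "'b \<Rightarrow> real" assume "bounded_linear l"
  then show "l x = l y"
    using has_bochner_integral_functional assms has_bochner_integral_eq by metis
qed

lemma
  fixes l :: "'b::real_normed_vector \<Rightarrow> real"
  assumes l: "bounded_linear l" and f: "bochner_integrable M f"
  shows functional_bochner_integral: "l (bochner_integral M f) = (\<integral>x. l (f x) \<partial>M)"
    and integrable_functional: "integrable M (\<lambda>x. l (f x))"
proof -
  obtain x where x: "bochner_has_integral M f x"
    using f by (auto simp: bochner_integrable_def)
  then have "bochner_integral M f = x"
    unfolding bochner_integral_def by (rule the_equality) (metis bochner_has_integral_unique x)
  then show "l (bochner_integral M f) = (\<integral>x. l (f x) \<partial>M)" "integrable M (\<lambda>x. l (f x))"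
    using has_bochner_integral_functional[OF l x] by (auto simp: has_bochner_integral_iff)
qed

section \<open>The Laplace transform on the half-line\<close>

definition laplace :: "(real \<Rightarrow> real) \<Rightarrow> real \<Rightarrow> real" where
  "laplace f lam = (LBINT t:{0<..}. exp (- lam * t) * f t)"

text \<open>Continuity up to 0 is built in, so that equal transforms force equality at every point,
  0 included.\<close>

definition exp_order :: "real \<Rightarrow> (real \<Rightarrow> real) \<Rightarrow> bool" where
  "exp_order c f \<longleftrightarrow> continuous_on {0..} f \<and> (\<exists>C. \<forall>t\<ge>0. \<bar>f t\<bar> \<le> C * exp (c * t))"

lemma exp_orderE:
  assumes "exp_order c f"
  obtains C where "C \<ge> 0" "\<And>t. t \<ge> 0 \<Longrightarrow> \<bar>f t\<bar> \<le> C * exp (c * t)"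
proof -
  obtain C where C: "\<And>t. t \<ge> 0 \<Longrightarrow> \<bar>f t\<bar> \<le> C * exp (c * t)"
    using assms by (auto simp: exp_order_def)
  have "0 \<le> C"
    using order_trans[OF abs_ge_zero C[of 0]] by simp
  then show ?thesis using C that by blast
qed

lemma exp_order_mono:
  assumes f: "exp_order c f" and "c \<le> d"
  shows "exp_order d f"
proof -
  obtain C where C: "C \<ge> 0" "\<And>t. t \<ge> 0 \<Longrightarrow> \<bar>f t\<bar> \<le> C * exp (c * t)"
    using f by (rule exp_orderE) blast
  have "\<bar>f t\<bar> \<le> C * exp (d * t)" if "t \<ge> 0" for t
  proof -
    have "C * exp (c * t) \<le> C * exp (d * t)"
      using C(1) that \<open>c \<le> d\<close> by (intro mult_left_mono) (auto simp: mult_right_mono)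
    then show ?thesis
      using C(2)[OF that] by linarith
  qed
  then show ?thesis
    using f by (auto simp: exp_order_def)
qed

lemma exp_order_add:
  assumes "exp_order c f" "exp_order c g"
  shows "exp_order c (\<lambda>t. f t + g t)"
proof -
  obtain C D where "\<And>t. t \<ge> 0 \<Longrightarrow> \<bar>f t\<bar> \<le> C * exp (c * t)" "\<And>t. t \<ge> 0 \<Longrightarrow> \<bar>g t\<bar> \<le> D * exp (c * t)"
    using exp_orderE[OF assms(1)] exp_orderE[OF assms(2)] by metis
  then have "\<bar>f t + g t\<bar> \<le> (C + D) * exp (c * t)" if "t \<ge> 0" for t
    using abs_triangle_ineq[of "f t" "g t"] that by (fastforce simp: distrib_right)
  then show ?thesis
    using assms by (auto simp: exp_order_def intro!: continuous_intros)
qed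

lemma exp_order_cmult:
  assumes "exp_order c f"
  shows "exp_order c (\<lambda>t. k * f t)"
proof -
  obtain C where "\<And>t. t \<ge> 0 \<Longrightarrow> \<bar>f t\<bar> \<le> C * exp (c * t)"
    using exp_orderE[OF assms] by metis
  then have "\<bar>k * f t\<bar> \<le> (\<bar>k\<bar> * C) * exp (c * t)" if "t \<ge> 0" for t
    using that by (simp add: abs_mult mult_left_mono mult.assoc)
  then show ?thesis
    using assms by (auto simp: exp_order_def intro!: continuous_intros)
qed

lemma exp_order_mult:
  assumes "exp_order c f" "exp_order d g"
  shows "exp_order (c + d) (\<lambda>t. f t * g t)"
proof -
  obtain C where C: "\<And>t. t \<ge> 0 \<Longrightarrow> \<bar>f t\<bar> \<le> C * exp (c * t)"
    using exp_orderE[OF assms(1)] by metis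
  obtain D where D: "\<And>t. t \<ge> 0 \<Longrightarrow> \<bar>g t\<bar> \<le> D * exp (d * t)"
    using exp_orderE[OF assms(2)] by metis
  have "\<bar>f t * g t\<bar> \<le> (C * D) * exp ((c + d) * t)" if "t \<ge> 0" for t
  proof -
    have "\<bar>f t\<bar> * \<bar>g t\<bar> \<le> (C * exp (c * t)) * (D * exp (d * t))"
      using that order_trans[OF abs_ge_zero C[OF that]] by (intro mult_mono C D) auto
    also have "\<dots> = (C * D) * exp ((c + d) * t)"
      by (simp add: distrib_right exp_add)
    finally show ?thesis
      by (simp add: abs_mult)
  qed
  then show ?thesis
    using assms by (auto simp: exp_order_def intro!: continuous_intros)
qed

lemma exp_order_const:
  assumes "c \<ge> 0"
  shows "exp_order c (\<lambda>t. k)"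
proof -
  have "\<bar>k\<bar> \<le> \<bar>k\<bar> * exp (c * t)" if "t \<ge> 0" for t
    using assms that mult_left_mono[of 1 "exp (c * t)" "\<bar>k\<bar>"] by simp
  then show ?thesis
    by (auto simp: exp_order_def)
qed

lemma set_integrable_exp_decay:
  assumes "(0::real) < u"
  shows "set_integrable lborel {0<..} (\<lambda>t. exp (- u * t))"
  using integrable_I0i_exp_mscale[OF assms] by (simp add: mult.commute)

lemma laplace_integrable:
  assumes f: "exp_order c f" and "c < lam"
  shows "set_integrable lborel {0<..} (\<lambda>t. exp (- lam * t) * f t)"
proof -
  obtain C where C: "C \<ge> 0" "\<And>t. t \<ge> 0 \<Longrightarrow> \<bar>f t\<bar> \<le> C * exp (c * t)"
    using f by (rule exp_orderE) blast
  have cont: "continuous_on {0<..} f"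
    using f by (auto simp: exp_order_def intro: continuous_on_subset)
  have "set_integrable lborel {0<..} (\<lambda>t. C * exp (- (lam - c) * t))"
    using set_integrable_exp_decay[of "lam - c"] \<open>c < lam\<close> by (intro set_integrable_mult_right) simp
  then show ?thesis
  proof (rule set_integrable_bound)
    show "set_borel_measurable lborel {0<..} (\<lambda>t. exp (- lam * t) * f t)"
    proof -
      have "continuous_on {0<..} (\<lambda>t. exp (- lam * t) * f t)"
        by (intro continuous_intros cont)
      then show ?thesis
        unfolding set_borel_measurable_def
        using borel_measurable_continuous_on_indicator[of "{0<..}" "\<lambda>t. exp (- lam * t) * f t"] by simp
    qed
    have "norm (exp (- lam * t) * f t) \<le> norm (C * exp (- (lam - c) * t))" if "t \<in> {0<..}" for t
    proof -
      have "exp (- lam * t) * \<bar>f t\<bar> \<le> exp (- lam * t) * (C * exp (c * t))"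
        using that by (intro mult_left_mono C) auto
      then show ?thesis
        using C(1) by (simp add: abs_mult algebra_simps flip: exp_add)
    qed
    then show "AE t in lborel. t \<in> {0<..} \<longrightarrow> norm (exp (- lam * t) * f t) \<le> norm (C * exp (- (lam - c) * t))"
      by simp
  qed
qed

lemma laplace_add:
  assumes "exp_order c f" "exp_order c g" "c < lam"
  shows "laplace (\<lambda>t. f t + g t) lam = laplace f lam + laplace g lam"
  using set_integral_add(2)[OF laplace_integrable[OF assms(1,3)] laplace_integrable[OF assms(2,3)]]
  by (simp add: laplace_def distrib_left)

lemma laplace_cmult: "laplace (\<lambda>t. k * f t) lam = k * laplace f lam"
  unfolding laplace_def by (subst set_integral_mult_right[symmetric]) (simp add: mult.left_commute)

text \<open>Integration by parts: the fundamental theorem for exp(-lam t) F(t), whose limit at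
  infinity is 0 because c < lam. The derivative is assumed for t > 0, as in the equation to be
  solved; continuity supplies the boundary value at 0.\<close>

lemma laplace_derivative:
  assumes F: "exp_order c F" and g: "exp_order c g" and "c < lam"
    and deriv: "\<And>t. t > 0 \<Longrightarrow> (F has_real_derivative g t) (at t)"
  shows "laplace g lam = lam * laplace F lam - F 0"
proof -
  define G where "G t = exp (- lam * t) * F t" for t
  define G' where "G' t = exp (- lam * t) * g t - lam * (exp (- lam * t) * F t)" for t
  have ei: "einterval 0 \<infinity> = {0::real<..}"
    by (auto simp: einterval_def)
  have intF: "set_integrable lborel {0<..} (\<lambda>t. lam * (exp (- lam * t) * F t))"
    and intg: "set_integrable lborel {0<..} (\<lambda>t. exp (- lam * t) * g t)"
    using laplace_integrable[OF F \<open>c < lam\<close>] laplace_integrable[OF g \<open>c < lam\<close>] by simp_all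
  have cF: "continuous (at_right 0) F"
    using F by (auto simp: exp_order_def continuous_on_eq_continuous_within
        intro: continuous_within_subset)
  have isC: "isCont h t" if "exp_order c h" "t > 0" for h t
  proof -
    have "continuous_on {0<..} h"
      using that(1) by (auto simp: exp_order_def intro: continuous_on_subset)
    then show ?thesis
      using that(2) by (simp add: continuous_on_eq_continuous_at)
  qed
  have "(LBINT t=0..\<infinity>. G' t) = 0 - F 0"
  proof (rule interval_integral_FTC_integrable)
    show "(G has_vector_derivative G' t) (at t)" if "0 < ereal t" for t
      unfolding G_def G'_def has_real_derivative_iff_has_vector_derivative[symmetric]
      using that by (auto intro!: derivative_eq_intros deriv simp: algebra_simps)
    show "isCont G' t" if "0 < ereal t" for t
      unfolding G'_def using isC[OF F] isC[OF g] that by (auto intro!: continuous_intros)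
    show "set_integrable lborel (einterval 0 \<infinity>) G'"
      unfolding G'_def ei by (rule set_integral_diff(1)[OF intg intF])
    have "(G \<longlongrightarrow> exp (- lam * 0) * F 0) (at_right 0)"
      unfolding G_def using cF by (intro tendsto_intros) (simp add: continuous_within)
    then show "((G \<circ> real_of_ereal) \<longlongrightarrow> F 0) (at_right 0)"
      by (simp add: ereal_tendsto_simps zero_ereal_def)
    obtain C where C: "C \<ge> 0" "\<And>t. t \<ge> 0 \<Longrightarrow> \<bar>F t\<bar> \<le> C * exp (c * t)"
      using F by (rule exp_orderE) blast
    have "(G \<longlongrightarrow> 0) at_top"
    proof (rule Lim_null_comparison)
      show "\<forall>\<^sub>F t in at_top. norm (G t) \<le> C * exp (- (lam - c) * t)"
        using eventually_ge_at_top[of 0]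
      proof eventually_elim
        case (elim t)
        have "exp (- lam * t) * \<bar>F t\<bar> \<le> exp (- lam * t) * (C * exp (c * t))"
          using elim by (intro mult_left_mono C) auto
        then show ?case
          by (simp add: G_def abs_mult algebra_simps flip: exp_add)
      qed
      have "((\<lambda>t. exp (- (lam - c) * t)) \<longlongrightarrow> 0) at_top"
        using \<open>c < lam\<close> by (intro filterlim_compose[OF exp_at_bot] filterlim_tendsto_neg_mult_at_bot[OF tendsto_const]
            filterlim_ident) auto
      from tendsto_mult_left[OF this, of C]
      show "((\<lambda>t. C * exp (- (lam - c) * t)) \<longlongrightarrow> 0) at_top" by simp
    qed
    then show "((G \<circ> real_of_ereal) \<longlongrightarrow> 0) (at_left \<infinity>)"
      by (simp add: ereal_tendsto_simps)
  qed simp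
  then have "(LBINT t:{0<..}. G' t) = - F 0"
    by (simp add: interval_lebesgue_integral_def ei)
  moreover have "(LBINT t:{0<..}. G' t) = laplace g lam - lam * laplace F lam"
    unfolding G'_def laplace_def set_integral_diff(2)[OF intg intF] set_integral_mult_right ..
  ultimately show ?thesis by simp
qed

text \<open>A constant has derivative 0, so the rule for derivatives reads 0 = lam times the
  transform, minus k.\<close>

lemma laplace_const:
  assumes "0 < lam"
  shows "laplace (\<lambda>t. k) lam = k / lam"
proof -
  have "laplace (\<lambda>t. 0) lam = lam * laplace (\<lambda>t. k) lam - k"
    using assms by (intro laplace_derivative[of 0] exp_order_const) auto
  then show ?thesis
    using assms by (simp add: laplace_def field_simps)
qed

lemma integral_has_vector_derivative_at:
  fixes g :: "real \<Rightarrow> 'b::banach"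
  assumes "continuous_on {0..} g" "0 < t"
  shows "((\<lambda>t. integral {0..t} g) has_vector_derivative g t) (at t)"
proof -
  have "((\<lambda>t. integral {0..t} g) has_vector_derivative g t) (at t within {0..t + 1})"
    using assms by (intro integral_has_vector_derivative) (auto intro: continuous_on_subset)
  then show ?thesis
    using assms by (simp add: at_within_Icc_at)
qed

text \<open>Integration costs a factor t, absorbed by exp t; this is why the rate rises by
  1.\<close>

lemma exp_order_primitive:
  assumes g: "exp_order c g" and "0 \<le> c"
  shows "exp_order (c + 1) (\<lambda>t. integral {0..t} g)"
proof -
  obtain C where C: "C \<ge> 0" "\<And>t. t \<ge> 0 \<Longrightarrow> \<bar>g t\<bar> \<le> C * exp (c * t)"
    using g by (rule exp_orderE) blast
  have cont: "continuous_on {0..T} g" for T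
    using g by (auto simp: exp_order_def intro: continuous_on_subset)
  have "\<bar>integral {0..t} g\<bar> \<le> C * exp ((c + 1) * t)" if t: "t \<ge> 0" for t
  proof -
    have "norm (integral {0..t} g) \<le> (C * exp (c * t)) * (t - 0)"
    proof (rule integral_bound[OF t cont])
      show "norm (g s) \<le> C * exp (c * t)" if "s \<in> {0..t}" for s
      proof -
        have "C * exp (c * s) \<le> C * exp (c * t)"
          using C(1) \<open>0 \<le> c\<close> that by (intro mult_left_mono) (auto intro: mult_left_mono)
        then show ?thesis
          using C(2)[of s] that by simp
      qed
    qed
    also have "\<dots> \<le> (C * exp (c * t)) * exp t"
      using C(1) exp_ge_add_one_self[of t] by (intro mult_left_mono) (linarith, simp)
    finally show ?thesis
      by (simp add: distrib_right exp_add)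
  qed
  moreover have "continuous_on {0..} (\<lambda>t. integral {0..t} g)"
    unfolding continuous_on_eq_continuous_within
  proof
    fix x :: real assume x: "x \<in> {0..}"
    have "continuous_on {0..x + 1} (\<lambda>t. integral {0..t} g)"
      by (intro indefinite_integral_continuous_1 integrable_continuous_interval cont)
    then have "continuous (at x within {0..x + 1}) (\<lambda>t. integral {0..t} g)"
      using x by (auto simp: continuous_on_eq_continuous_within)
    moreover have "at x within {0..x + 1} = at x within {0..}"
      using x by (intro at_within_nhd[of _ "{..<x + 1}"]) auto
    ultimately show "continuous (at x within {0..}) (\<lambda>t. integral {0..t} g)"
      by (simp add: continuous_within)
  qed
  ultimately show ?thesis
    by (auto simp: exp_order_def)
qed

lemma laplace_primitive:
  assumes g: "exp_order c g" and "0 \<le> c" "c + 1 < lam"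
  shows "laplace g lam = lam * laplace (\<lambda>t. integral {0..t} g) lam"
proof -
  have "laplace g lam = lam * laplace (\<lambda>t. integral {0..t} g) lam - integral {0..0} g"
  proof (rule laplace_derivative)
    show "exp_order (c + 1) (\<lambda>t. integral {0..t} g)"
      using assms(1,2) by (rule exp_order_primitive)
    show "exp_order (c + 1) g"
      using g by (rule exp_order_mono) simp
    show "((\<lambda>t. integral {0..t} g) has_real_derivative g t) (at t)" if "t > 0" for t
      using integral_has_vector_derivative_at[of g t] g that
      by (simp add: exp_order_def has_real_derivative_iff_has_vector_derivative)
  qed (use assms in simp)
  then show ?thesis by simp
qed

text \<open>In the variable \<open>x = exp (- t)\<close>, the transforms at \<open>N, N + 1, \<dots>\<close> are the moments of a
  function on the unit interval, and the Weierstrass theorem applies.\<close>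

theorem laplace_eq_0_imp_eq_0:
  assumes f: "exp_order c f" and zero: "\<And>lam. lam \<ge> l0 \<Longrightarrow> laplace f lam = 0" and t: "t \<ge> 0"
  shows "f t = 0"
proof -
  obtain C where C: "C \<ge> 0" "\<And>t. t \<ge> 0 \<Longrightarrow> \<bar>f t\<bar> \<le> C * exp (c * t)"
    using f by (rule exp_orderE) blast
  \<comment> \<open>m > c makes \<open>w\<close> integrable and \<psi> continuous at 0; m \<ge> l0
    makes all transforms at m + n vanish.\<close>
  obtain m :: nat where m: "m > c" "m \<ge> l0" "m > 0"
  proof -
    obtain m :: nat where "max (max c l0) 0 < m"
      using reals_Archimedean2 by blast
    then show ?thesis by (intro that[of m]) auto
  qed
  define w where "w t = exp (- real m * t) * f t" for t
  \<comment> \<open>In the variable x = exp(-t), \<psi> is \<open>w\<close> itself, so integrating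
    their product gives the weighted integral of the square of \<open>f\<close>. The maximum keeps
    the argument of \<open>f\<close> nonnegative for x > 1.\<close>
  define \<psi> where "\<psi> x = (if x \<le> 0 then 0 else x ^ m * f (max 0 (- ln x)))" for x :: real
  have w: "set_integrable lborel {0<..} w"
    unfolding w_def using laplace_integrable[OF f m(1)] by simp
  have w_eq: "a * exp (- t) ^ n * w t = a * (exp (- (real m + real n) * t) * f t)" for a n t
    by (simp add: w_def exp_of_nat_mult[symmetric] exp_add[symmetric] algebra_simps flip: exp_minus)
  have wn: "set_integrable lborel {0<..} (\<lambda>t. a * exp (- t) ^ n * w t)" for a n
    unfolding w_eq using laplace_integrable[OF f, of "real m + real n"] m
    by (intro set_integrable_mult_right) simp
  have wz: "(LBINT t:{0<..}. a * exp (- t) ^ n * w t) = 0" for a n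
    unfolding w_eq using zero[of "real m + real n"] m by (simp add: laplace_def)
  have "continuous_on {0..1} \<psi>"
    unfolding continuous_on_eq_continuous_within
  proof
    fix x :: real assume x: "x \<in> {0..1}"
    show "continuous (at x within {0..1}) \<psi>"
    proof (cases "x = 0")
      case True
      have "(\<psi> \<longlongrightarrow> 0) (at_right 0)"
      proof (rule Lim_null_comparison)
        have "\<forall>\<^sub>F y in at_right (0::real). y \<in> {0<..<1}"
          by (rule eventually_at_right_real) simp
        then show "\<forall>\<^sub>F y in at_right 0. norm (\<psi> y) \<le> C * exp ((real m - c) * ln y)"
        proof eventually_elim
          case (elim y)
          then have "y ^ m * \<bar>f (- ln y)\<bar> \<le> exp (real m * ln y) * (C * exp (c * (- ln y)))"
            using C(2)[of "- ln y"] by (intro mult_mono) (auto simp: exp_of_nat_mult)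
          then show ?case
            using elim by (simp add: \<psi>_def abs_mult algebra_simps flip: exp_add)
        qed
        have "((\<lambda>y. exp ((real m - c) * ln y)) \<longlongrightarrow> 0) (at_right 0)"
          using m(1) by (intro filterlim_compose[OF exp_at_bot]
              filterlim_tendsto_pos_mult_at_bot[OF tendsto_const _ ln_at_0]) simp
        from tendsto_mult_left[OF this, of C]
        show "((\<lambda>y. C * exp ((real m - c) * ln y)) \<longlongrightarrow> 0) (at_right 0)" by simp
      qed
      then show ?thesis
        using True by (simp add: continuous_within at_within_Icc_at_right \<psi>_def)
    next
      case False
      have "continuous_on {0<..} (\<lambda>x. x ^ m * f (max 0 (- ln x)))"
        using f by (auto simp: exp_order_def intro!: continuous_intros continuous_on_compose2[where f = "\<lambda>x. max 0 (- ln x)" and g = f])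
      then have "continuous_on {0<..} \<psi>"
        by (subst continuous_on_cong[OF refl, of _ _ "\<lambda>x. x ^ m * f (max 0 (- ln x))"]) (auto simp: \<psi>_def)
      then show ?thesis
        using False x by (auto simp: continuous_on_eq_continuous_at intro: continuous_at_imp_continuous_at_within)
    qed
  qed
  have psi: "\<psi> (exp (- t)) = exp (- real m * t) * f t" if "t > 0" for t
    using that by (simp add: \<psi>_def exp_of_nat_mult[symmetric])
  have eq: "\<psi> (exp (- t)) * w t = exp (- (2 * real m) * t) * (f t * f t)" if "t > 0" for t
    using psi[OF that] by (simp add: w_def flip: exp_add)
  have "set_integrable lborel {0<..} (\<lambda>t. exp (- (2 * real m) * t) * (f t * f t))"
    using m(1) by (intro laplace_integrable[OF exp_order_mult[OF f f]]) simp
  then have ww: "set_integrable lborel {0<..} (\<lambda>t. \<psi> (exp (- t)) * w t)"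
    by (subst set_integrable_cong[OF refl refl]) (use eq in auto)
  \<comment> \<open>A polynomial in exp(-t) is orthogonal to \<open>w\<close>, as its monomials
    produce the transforms at m + n. Subtracting one that is within e of \<psi> leaves at most e
    times the L1 norm of \<open>w\<close>.\<close>
  have small: "\<bar>LBINT t:{0<..}. \<psi> (exp (- t)) * w t\<bar> \<le> e * (LBINT t:{0<..}. \<bar>w t\<bar>)" if "e > 0" for e
  proof -
    obtain p where p: "real_polynomial_function p" "\<And>x. x \<in> {0..1} \<Longrightarrow> \<bar>\<psi> x - p x\<bar> < e"
      using Stone_Weierstrass_real_polynomial_function[OF compact_Icc \<open>continuous_on {0..1} \<psi>\<close> \<open>e > 0\<close>]
      by blast
    then obtain a n where pa: "p = (\<lambda>x. \<Sum>i\<le>n. a i * x ^ i)"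
      by (auto simp: real_polynomial_function_iff_sum)
    have pw: "p (exp (- t)) * w t = (\<Sum>i\<le>n. a i * exp (- t) ^ i * w t)" for t
      by (simp add: pa sum_distrib_right)
    have pi: "set_integrable lborel {0<..} (\<lambda>t. p (exp (- t)) * w t)"
      using wn unfolding pw set_integrable_def scaleR_sum_right by (intro Bochner_Integration.integrable_sum) auto
    have "(LBINT t:{0<..}. p (exp (- t)) * w t) = 0"
      using wn wz unfolding pw set_integrable_def set_lebesgue_integral_def scaleR_sum_right
      by (subst Bochner_Integration.integral_sum) auto
    then have "\<bar>LBINT t:{0<..}. \<psi> (exp (- t)) * w t\<bar>
        = \<bar>LBINT t:{0<..}. \<psi> (exp (- t)) * w t - p (exp (- t)) * w t\<bar>"
      by (simp add: set_integral_diff(2)[OF ww pi])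
    also have "\<dots> \<le> (LBINT t:{0<..}. \<bar>\<psi> (exp (- t)) * w t - p (exp (- t)) * w t\<bar>)"
      using set_integral_norm_bound[OF set_integral_diff(1)[OF ww pi]] by simp
    also have "\<dots> \<le> (LBINT t:{0<..}. e * \<bar>w t\<bar>)"
    proof (rule set_integral_mono)
      show "\<bar>\<psi> (exp (- t)) * w t - p (exp (- t)) * w t\<bar> \<le> e * \<bar>w t\<bar>" if "t \<in> {0<..}" for t
        using p(2)[of "exp (- t)"] that
        by (simp add: abs_mult mult_right_mono less_imp_le flip: left_diff_distrib)
    qed (use w ww pi in \<open>auto intro: set_integrable_abs\<close>)
    finally show ?thesis by simp
  qed
  have "(LBINT t:{0<..}. \<psi> (exp (- t)) * w t) = 0"
  proof (rule ccontr)
    define B where "B = (LBINT t:{0<..}. \<bar>w t\<bar>)"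
    assume nz: "(LBINT t:{0<..}. \<psi> (exp (- t)) * w t) \<noteq> 0" (is "?I \<noteq> 0")
    have B: "\<bar>?I\<bar> \<le> e * B" if "e > 0" for e
      using small[OF that] by (simp add: B_def)
    have "B > 0"
      using B[of 1] nz by simp
    then show False
      \<comment> \<open>This choice of e would give \<bar>?I\<bar> \<le> \<bar>?I\<bar> / 2.\<close>
      using B[of "\<bar>?I\<bar> / (2 * B)"] nz by simp
  qed
  moreover have "(LBINT t:{0<..}. \<psi> (exp (- t)) * w t) = (LBINT t:{0<..}. exp (- (2 * real m) * t) * (f t * f t))"
    using eq by (intro set_lebesgue_integral_cong) auto
  ultimately have "(\<integral>t. indicator {0<..} t *\<^sub>R (exp (- (2 * real m) * t) * (f t * f t)) \<partial>lborel) = 0"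
    by (simp add: set_lebesgue_integral_def)
  then have "AE t in lborel. indicator {0<..} t *\<^sub>R (exp (- (2 * real m) * t) * (f t * f t)) = 0"
    using \<open>set_integrable lborel {0<..} (\<lambda>t. exp (- (2 * real m) * t) * (f t * f t))\<close>
    by (subst (asm) integral_nonneg_eq_0_iff_AE) (auto simp: set_integrable_def)
  then have ae: "AE t in lborel. t \<notin> {0<..} \<inter> f -` (- {0})"
    by eventually_elim (auto simp: indicator_def split: if_splits)
  have cont: "continuous_on {0<..} f"
    using f by (auto simp: exp_order_def intro: continuous_on_subset)
  \<comment> \<open>The points of the open half-line with f \<noteq> 0 form an open null set, which
    must be empty; continuity then covers t = 0.\<close>
  have op: "open ({0<..} \<inter> f -` (- {0}))"
    using cont by (intro continuous_open_preimage) auto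
  have "{0<..} \<inter> f -` (- {0}) \<in> null_sets lborel"
    using ae op by (subst AE_iff_null_sets) auto
  then have "negligible ({0<..} \<inter> f -` (- {0}))"
    by (auto simp: negligible_iff_null_sets intro: null_sets_completionI)
  then have "{0<..} \<inter> f -` (- {0}) = {}"
    using open_not_negligible[OF op] by blast
  then have "f t = 0" if "t \<in> {0<..}" for t
    using that by auto
  then show ?thesis
    using f t continuous_constant_on_closure[of "{0<..}" f 0 t] by (simp add: exp_order_def)
qed

text \<open>On the whole line, translation and Fubini apply without moving endpoints.\<close>

lemma laplace_line:
  assumes "\<And>t. t \<le> 0 \<Longrightarrow> g t = 0"
  shows "laplace g lam = (\<integral>t. exp (- lam * t) * g t \<partial>lborel)"
  unfolding laplace_def set_lebesgue_integral_def
  using assms by (intro Bochner_Integration.integral_cong) (auto simp: indicator_def)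

section \<open>Convolutions of a nonnegative kernel with a continuous function\<close>

context
  fixes k h :: "real \<Rightarrow> real" and C c :: real
  assumes k_meas [measurable]: "k \<in> borel_measurable borel"
    and k_nonneg: "\<And>s. 0 \<le> k s" and k_zero: "\<And>s. s \<le> 0 \<Longrightarrow> k s = 0"
    and k_int: "integrable lborel (\<lambda>s. exp (- c * s) * k s)"
    and h_cont: "continuous_on UNIV h" and h_zero: "\<And>t. t \<le> 0 \<Longrightarrow> h t = 0"
    and h_bound: "\<And>t. \<bar>h t\<bar> \<le> C * exp (c * t)"
begin

private lemma h_meas: "h \<in> borel_measurable borel"
  using h_cont by (rule borel_measurable_continuous_onI)

text \<open>The majorant depends on T instead of t. It serves pointwise bounds with T = t and
  dominated convergence along a bounded sequence of times.\<close>

private lemma convolution_dominated: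
  "t \<le> T \<Longrightarrow> 0 \<le> c \<Longrightarrow> \<bar>k s * h (t - s)\<bar> \<le> C * exp (c * T) * (exp (- c * s) * k s)"
proof -
  assume "t \<le> T" "0 \<le> c"
  have "0 \<le> C"
    using order_trans[OF abs_ge_zero h_bound[of 0]] by simp
  have "k s * \<bar>h (t - s)\<bar> \<le> k s * (C * exp (c * (t - s)))"
    by (intro mult_left_mono h_bound k_nonneg)
  also have "\<dots> \<le> k s * (C * exp (c * (T - s)))"
    using \<open>t \<le> T\<close> \<open>0 \<le> c\<close> \<open>0 \<le> C\<close> by (intro mult_left_mono k_nonneg) (auto intro: mult_left_mono)
  also have "exp (c * (T - s)) = exp (c * T) * exp (- c * s)"
    by (simp add: right_diff_distrib exp_add[symmetric])
  finally show ?thesis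
    using k_nonneg[of s] by (simp add: abs_mult mult_ac)
qed

text \<open>Declared outside this inner context, the rule would be exported with \<open>k\<close> and \<open>h\<close> generalized, and
  the measurability prover would loop on it.\<close>

context
  notes h_meas [measurable]
begin

text \<open>Moves the dependence on t from the merely measurable kernel to the continuous factor
  \<open>h\<close>, where limits in t can be taken.\<close>

lemma convolution_swap: "(\<integral>s. k (t - s) * h s \<partial>lborel) = (\<integral>s. k s * h (t - s) \<partial>lborel)"
  using lborel_integral_real_affine[of "-1" "\<lambda>s. k (t - s) * h s" t] by simp

lemma convolution_integrable:
  assumes "0 \<le> c"
  shows "integrable lborel (\<lambda>s. k s * h (t - s))" and "integrable lborel (\<lambda>s. k (t - s) * h s)"
proof -
  show *: "integrable lborel (\<lambda>s. k s * h (t - s))"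
  proof (rule Bochner_Integration.integrable_bound)
    show "integrable lborel (\<lambda>s. C * exp (c * t) * (exp (- c * s) * k s))"
      using k_int by simp
    show "AE s in lborel. norm (k s * h (t - s)) \<le> norm (C * exp (c * t) * (exp (- c * s) * k s))"
      using convolution_dominated[of t t] \<open>0 \<le> c\<close> by (auto intro: order_trans[OF _ abs_ge_self])
  qed measurable
  show "integrable lborel (\<lambda>s. k (t - s) * h s)"
    using lborel_integrable_real_affine[OF *, of "-1" t] by simp
qed

lemma convolution_zero: "t \<le> 0 \<Longrightarrow> (\<integral>s. k (t - s) * h s \<partial>lborel) = 0"
proof -
  assume "t \<le> 0"
  then have "(\<lambda>s. k (t - s) * h s) = (\<lambda>s. 0)"
    using k_zero h_zero by (intro ext) (metis diff_le_0_iff_le dual_order.trans linorder_linear mult_eq_0_iff)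
  then show ?thesis by (simp only: integral_zero)
qed

text \<open>The bound on \<open>h\<close> splits as exp(c t) exp(-c s), so the growth constant is C
  times the transform of \<open>k\<close> at c. Continuity is dominated convergence in the swapped
  form.\<close>

lemma convolution_exp_order:
  assumes "0 \<le> c"
  shows "exp_order c (\<lambda>t. \<integral>s. k (t - s) * h s \<partial>lborel)"
proof -
  define A where "A = (\<integral>s. exp (- c * s) * k s \<partial>lborel)"
  have "\<bar>\<integral>s. k s * h (t - s) \<partial>lborel\<bar> \<le> (C * A) * exp (c * t)" for t
  proof -
    have "\<bar>\<integral>s. k s * h (t - s) \<partial>lborel\<bar> \<le> (\<integral>s. \<bar>k s * h (t - s)\<bar> \<partial>lborel)"
      by (rule integral_abs_bound)
    also have "\<dots> \<le> (\<integral>s. C * exp (c * t) * (exp (- c * s) * k s) \<partial>lborel)"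
      using convolution_dominated[of t t] assms k_int convolution_integrable(1)
      by (intro integral_mono) auto
    also have "\<dots> = C * exp (c * t) * A"
      by (simp only: A_def integral_mult_right_zero)
    finally show ?thesis
      by (simp only: mult_ac)
  qed
  moreover have "continuous_on {0..} (\<lambda>t. \<integral>s. k s * h (t - s) \<partial>lborel)"
    unfolding continuous_on_sequentially comp_def
  proof (intro allI ballI impI)
    fix x :: "nat \<Rightarrow> real" and a assume x: "(\<forall>n. x n \<in> {0..}) \<and> x \<longlonglongrightarrow> a"
    then obtain T where T: "\<And>n. x n \<le> T"
      using convergent_imp_bounded[of x a] by (auto simp: bounded_real abs_le_iff)
    show "(\<lambda>n. \<integral>s. k s * h (x n - s) \<partial>lborel) \<longlonglongrightarrow> (\<integral>s. k s * h (a - s) \<partial>lborel)"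
    proof (rule integral_dominated_convergence)
      show "integrable lborel (\<lambda>s. C * exp (c * T) * (exp (- c * s) * k s))"
        using k_int by simp
      show "AE s in lborel. norm (k s * h (x n - s)) \<le> C * exp (c * T) * (exp (- c * s) * k s)" for n
        using convolution_dominated[OF T] assms by auto
      have "isCont h (a - s)" for s
        using h_cont by (simp add: continuous_on_eq_continuous_at)
      then show "AE s in lborel. (\<lambda>n. k s * h (x n - s)) \<longlonglongrightarrow> k s * h (a - s)"
        using x by (intro always_eventually allI tendsto_intros isCont_tendsto_compose[of _ h]) auto
    qed measurable
  qed
  ultimately show ?thesis
    unfolding exp_order_def convolution_swap by blast
qed

lemma laplace_convolution:
  assumes "0 \<le> c" "c < lam"
  shows "laplace (\<lambda>t. \<integral>s. k (t - s) * h s \<partial>lborel) lam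
    = (\<integral>s. exp (- lam * s) * k s \<partial>lborel) * laplace h lam"
proof -
  define F where "F s t = exp (- lam * t) * (k s * h (t - s))" for s t
  \<comment> \<open>With exp(-lam t) split this way, the integral over t is a translate of the
    transform of \<open>h\<close> and factors out.\<close>
  have F_eq: "F s t = (exp (- lam * s) * k s) * (exp (- lam * (t - s)) * h (t - s))" for s t
  proof -
    have "exp (- lam * t) = exp (- lam * s) * exp (- lam * (t - s))"
      by (simp add: right_diff_distrib flip: exp_add)
    then show ?thesis
      by (simp only: F_def mult_ac)
  qed
  have hi: "integrable lborel (\<lambda>t. exp (- lam * t) * h t)"
  proof -
    have "exp_order c h"
      using h_cont h_bound by (auto simp: exp_order_def intro: continuous_on_subset)
    from laplace_integrable[OF this \<open>c < lam\<close>]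
    have "integrable lborel (\<lambda>t. indicator {0<..} t *\<^sub>R (exp (- lam * t) * h t))"
      by (simp add: set_integrable_def)
    moreover have "(\<lambda>t. indicator {0<..} t *\<^sub>R (exp (- lam * t) * h t)) = (\<lambda>t. exp (- lam * t) * h t)"
      using h_zero by (intro ext) (auto simp: indicator_def)
    ultimately show ?thesis by (simp only:)
  qed
  have ki: "integrable lborel (\<lambda>s. exp (- lam * s) * k s)"
  proof (rule Bochner_Integration.integrable_bound[OF k_int])
    have "exp (- lam * s) * k s \<le> exp (- c * s) * k s" for s
      using assms k_nonneg[of s] k_zero[of s]
      by (cases "s \<le> 0") (auto intro!: mult_right_mono)
    then show "AE s in lborel. norm (exp (- lam * s) * k s) \<le> norm (exp (- c * s) * k s)"
      using k_nonneg by (simp add: abs_mult)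
  qed measurable
  have shift_i: "integrable lborel (\<lambda>t. exp (- lam * (t - s)) * h (t - s))" for s
    using lborel_integrable_real_affine[OF hi, of 1 "- s"] by (simp add: algebra_simps)
  have shift: "(\<integral>t. exp (- lam * (t - s)) * h (t - s) \<partial>lborel) = laplace h lam" for s
    using lborel_integral_real_affine[of 1 "\<lambda>t. exp (- lam * t) * h t" "- s"] laplace_line[OF h_zero]
    by (simp add: algebra_simps)
  have shift_n: "(\<integral>t. \<bar>exp (- lam * (t - s)) * h (t - s)\<bar> \<partial>lborel) = (\<integral>t. \<bar>exp (- lam * t) * h t\<bar> \<partial>lborel)" for s
    using lborel_integral_real_affine[of 1 "\<lambda>t. \<bar>exp (- lam * t) * h t\<bar>" "- s"]
    by (simp add: algebra_simps)
  interpret lborel_pair: pair_sigma_finite "lborel :: real measure" "lborel :: real measure" ..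
  have "integrable (lborel \<Otimes>\<^sub>M lborel) (case_prod F)"
  proof (rule lborel_pair.Fubini_integrable)
    show "case_prod F \<in> borel_measurable (lborel \<Otimes>\<^sub>M lborel)"
      unfolding F_def by measurable
    show "AE s in lborel. integrable lborel (\<lambda>t. case_prod F (s, t))"
      unfolding F_eq using shift_i by simp
    have "(\<integral>t. norm (case_prod F (s, t)) \<partial>lborel)
        = (exp (- lam * s) * k s) * (\<integral>t. \<bar>exp (- lam * t) * h t\<bar> \<partial>lborel)" for s
    proof -
      have "norm (case_prod F (s, t)) = (exp (- lam * s) * k s) * \<bar>exp (- lam * (t - s)) * h (t - s)\<bar>" for t
        using k_nonneg[of s] by (simp add: F_eq abs_mult)
      then show ?thesis
        using shift_n[of s] by simp
    qed
    then show "integrable lborel (\<lambda>s. \<integral>t. norm (case_prod F (s, t)) \<partial>lborel)"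
      using ki by simp
  qed
  from lborel_pair.Fubini_integral[OF this]
  have "(\<integral>t. \<integral>s. F s t \<partial>lborel \<partial>lborel) = (\<integral>s. \<integral>t. F s t \<partial>lborel \<partial>lborel)" .
  moreover have "(\<integral>t. F s t \<partial>lborel) = (exp (- lam * s) * k s) * laplace h lam" for s
    unfolding F_eq using shift[of s] by simp
  moreover have "(\<integral>s. F s t \<partial>lborel) = exp (- lam * t) * (\<integral>s. k (t - s) * h s \<partial>lborel)" for t
    unfolding F_def by (simp add: convolution_swap)
  ultimately show ?thesis
    using laplace_line[of "\<lambda>t. \<integral>s. k (t - s) * h s \<partial>lborel", OF convolution_zero] by simp
qed

end

end

section \<open>The tail of the Levy measure\<close>

text \<open>Extension by zero turns the integral over (0, t) into a convolution on the line and
  keeps the tail away from arguments where it may be infinite.\<close>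

definition tail_kernel :: "real \<Rightarrow> real measure \<Rightarrow> real \<Rightarrow> real" where
  "tail_kernel a \<nu> s = indicator {0<..} s * levy_tail a \<nu> s"

context
  fixes a b :: real and \<nu> :: "real measure"
  assumes triplet: "subordinator_triplet a b \<nu>"
begin

private lemma a: "0 \<le> a" and b: "0 \<le> b" and sets_nu: "sets \<nu> = sets borel"
  and nu_nonpos: "emeasure \<nu> {..0} = 0" and nu_min: "(\<integral>\<^sup>+s. ennreal (min s 1) \<partial>\<nu>) < \<infinity>"
  using triplet by (auto simp: subordinator_triplet_def)

private lemma space_nu: "space \<nu> = UNIV"
  using sets_eq_imp_space_eq[OF sets_nu] by simp

context
  notes sets_nu [measurable_cong, simp] and space_nu [simp]
begin

text \<open>Markov's inequality for min s 1.\<close>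

lemma levy_tail_finite:
  assumes "0 < e"
  shows "emeasure \<nu> {e<..} < \<infinity>"
proof -
  have "ennreal (min e 1) * emeasure \<nu> {e<..} = (\<integral>\<^sup>+s. ennreal (min e 1) * indicator {e<..} s \<partial>\<nu>)"
    by (simp add: nn_integral_cmult_indicator)
  also have "\<dots> \<le> (\<integral>\<^sup>+s. ennreal (min s 1) \<partial>\<nu>)"
    by (intro nn_integral_mono) (auto simp: indicator_def intro!: ennreal_leI)
  finally have "ennreal (min e 1) * emeasure \<nu> {e<..} < \<infinity>"
    using nu_min by (rule le_less_trans)
  then show ?thesis
    using assms by (auto simp: ennreal_mult_less_top)
qed

text \<open>Required for Fubini between \<nu> and Lebesgue measure. The null half-line together with
  the tails beyond 1 / (n + 1), all of finite measure, covers the line.\<close>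

lemma sigma_finite_levy: "sigma_finite_measure \<nu>"
proof
  define A where "A n = {..0} \<union> {1 / real (Suc n)<..}" for n
  have "emeasure \<nu> (A n) \<noteq> \<infinity>" for n
  proof -
    have "emeasure \<nu> (A n) \<le> emeasure \<nu> {..0} + emeasure \<nu> {1 / real (Suc n)<..}"
      unfolding A_def by (intro emeasure_subadditive) auto
    also have "\<dots> < \<infinity>"
      using levy_tail_finite[of "1 / real (Suc n)"] nu_nonpos by simp
    finally show ?thesis by simp
  qed
  moreover have "(\<Union>n. A n) = space \<nu>"
  proof -
    have "x \<in> (\<Union>n. A n)" for x
    proof (cases "x \<le> 0")
      case False
      then obtain n where "1 / real (Suc n) < x"
        using nat_approx_posE[of x] by auto
      then show ?thesis by (auto simp: A_def)
    qed (auto simp: A_def)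
    then show ?thesis by auto
  qed
  ultimately show "\<exists>B. countable B \<and> B \<subseteq> sets \<nu> \<and> \<Union>B = space \<nu> \<and> (\<forall>a\<in>B. emeasure \<nu> a \<noteq> \<infinity>)"
    by (intro exI[of _ "range A"]) (auto simp: A_def)
qed

text \<open>The tail at t is the measure of a section of the set of pairs with t < s.\<close>

lemma levy_tail_measurable [measurable]: "levy_tail a \<nu> \<in> borel_measurable borel"
proof -
  interpret sigma_finite_measure \<nu> by (rule sigma_finite_levy)
  have "{p \<in> space ((borel :: real measure) \<Otimes>\<^sub>M \<nu>). fst p < snd p} \<in> sets (borel \<Otimes>\<^sub>M \<nu>)"
    by measurable
  from measurable_emeasure_Pair[OF this]
  have "(\<lambda>t. emeasure \<nu> {t<..}) \<in> borel_measurable borel"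
    by (simp add: vimage_def greaterThan_def space_pair_measure)
  then have "(\<lambda>t. enn2real (emeasure \<nu> {t<..})) \<in> borel_measurable borel"
    by (rule borel_measurable_enn2real)
  then show ?thesis
    unfolding levy_tail_def[abs_def] measure_def by (rule borel_measurable_add[OF borel_measurable_const])
qed

lemma tail_kernel_measurable [measurable]: "tail_kernel a \<nu> \<in> borel_measurable borel"
  unfolding tail_kernel_def by measurable

lemma tail_kernel_nonneg: "0 \<le> tail_kernel a \<nu> s"
  using a by (simp add: tail_kernel_def levy_tail_def)

lemma tail_kernel_zero: "s \<le> 0 \<Longrightarrow> tail_kernel a \<nu> s = 0"
  by (simp add: tail_kernel_def)

text \<open>1 - exp(-lam s) is at most lam s and at most 1, hence at most max 1 lam times min s
  1.\<close>

lemma one_minus_exp_integrable: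
  assumes "0 \<le> lam"
  shows "set_integrable \<nu> {0<..} (\<lambda>s. 1 - exp (- lam * s))"
proof -
  have min: "integrable \<nu> (\<lambda>s. indicator {0<..} s * min s 1)"
  proof (rule integrableI_bounded)
    have "(\<integral>\<^sup>+s. norm (indicator {0<..} s * min s 1) \<partial>\<nu>) \<le> (\<integral>\<^sup>+s. ennreal (min s 1) \<partial>\<nu>)"
      by (intro nn_integral_mono) (auto simp: indicator_def)
    then show "(\<integral>\<^sup>+s. norm (indicator {0<..} s * min s 1) \<partial>\<nu>) < \<infinity>"
      using nu_min by (rule le_less_trans)
  qed measurable
  have "integrable \<nu> (\<lambda>s. indicator {0<..} s *\<^sub>R (1 - exp (- lam * s)))"
  proof (rule Bochner_Integration.integrable_bound)
    show "integrable \<nu> (\<lambda>s. max 1 lam * (indicator {0<..} s * min s 1))"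
      using min by simp
    have "1 - exp (- lam * s) \<le> max 1 lam * min s 1" "exp (- lam * s) \<le> 1" if "s > 0" for s
    proof -
      have "lam * s \<le> max 1 lam * s"
        using that by (intro mult_right_mono) auto
      then have "1 - exp (- lam * s) \<le> max 1 lam * s"
        using exp_ge_add_one_self[of "- lam * s"] by simp
      moreover have "1 - exp (- lam * s) \<le> max 1 lam"
        by (rule order_trans[of _ 1]) simp_all
      ultimately show "1 - exp (- lam * s) \<le> max 1 lam * min s 1"
        by (cases "s \<le> 1") (simp_all only: min_def if_True if_False mult_1_right)
      show "exp (- lam * s) \<le> 1"
        using assms that by simp
    qed
    then have "norm (indicator {0<..} s *\<^sub>R (1 - exp (- lam * s))) \<le> norm (max 1 lam * (indicator {0<..} s * min s 1))" for s
      by (cases "s > 0") (auto simp: abs_mult intro: order_trans)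
    then show "AE s in \<nu>. norm (indicator {0<..} s *\<^sub>R (1 - exp (- lam * s))) \<le> norm (max 1 lam * (indicator {0<..} s * min s 1))"
      by simp
  qed measurable
  then show ?thesis
    by (simp add: set_integrable_def)
qed

private lemma exp_integral_Ioo:
  assumes "0 < lam" "0 < s"
  shows "(\<integral>\<^sup>+t. ennreal (exp (- lam * t)) * indicator {0<..<s} t \<partial>lborel) = ennreal ((1 - exp (- lam * s)) / lam)"
proof -
  have "(\<integral>\<^sup>+t. ennreal (exp (- lam * t)) * indicator {0<..<s} t \<partial>lborel)
      = (\<integral>\<^sup>+t. ennreal (exp (- lam * t)) * indicator {0..s} t \<partial>lborel)"
  proof (rule nn_integral_cong_AE)
    show "AE t in lborel. ennreal (exp (- lam * t)) * indicator {0<..<s} t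
        = ennreal (exp (- lam * t)) * indicator {0..s} t"
      using AE_lborel_singleton[of 0] AE_lborel_singleton[of s]
      by eventually_elim (auto simp: indicator_def)
  qed
  also have "\<dots> = ennreal (- exp (- lam * s) / lam - (- exp (- lam * 0) / lam))"
    using assms by (intro nn_integral_FTC_Icc) (auto intro!: derivative_eq_intros)
  finally show ?thesis
    by (simp add: diff_divide_distrib)
qed

text \<open>The tail at t is the \<nu>-integral of the indicator of t < s. Exchanging the integrals
  gives the \<nu>-integral of (1 - exp(-lam s)) / lam; the killing rate adds a / lam. Working with
  nonnegative integrals yields value and integrability at once.\<close>

lemma
  assumes lam: "0 < lam"
  shows tail_kernel_integrable: "integrable lborel (\<lambda>s. exp (- lam * s) * tail_kernel a \<nu> s)"
    and tail_kernel_laplace: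
      "b + (\<integral>s. exp (- lam * s) * tail_kernel a \<nu> s \<partial>lborel) = laplace_exponent a b \<nu> lam / lam"
proof -
  interpret sigma_finite_measure \<nu> by (rule sigma_finite_levy)
  interpret pair_sigma_finite lborel \<nu> ..
  define I where "I = (LINT s:{0<..}|\<nu>. 1 - exp (- lam * s))"
  have I0: "0 \<le> I"
    using lam unfolding I_def set_lebesgue_integral_def
    by (intro Bochner_Integration.integral_nonneg) (auto simp: indicator_def)
  have tail: "ennreal (exp (- lam * t) * tail_kernel a \<nu> t)
      = ennreal a * (ennreal (exp (- lam * t)) * indicator {0<..} t)
        + (\<integral>\<^sup>+s. ennreal (exp (- lam * t)) * indicator {0<..<s} t \<partial>\<nu>)" for t
  proof (cases "t > 0")
    case True
    have "(\<integral>\<^sup>+s. ennreal (exp (- lam * t)) * indicator {0<..<s} t \<partial>\<nu>)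
        = (\<integral>\<^sup>+s. ennreal (exp (- lam * t)) * indicator {t<..} s \<partial>\<nu>)"
      using True by (intro nn_integral_cong) (auto simp: indicator_def)
    also have "\<dots> = ennreal (exp (- lam * t)) * emeasure \<nu> {t<..}"
      by (simp add: nn_integral_cmult_indicator)
    also have "\<dots> = ennreal (exp (- lam * t) * measure \<nu> {t<..})"
      using levy_tail_finite[OF True] by (simp add: ennreal_mult emeasure_eq_ennreal_measure less_top)
    finally show ?thesis
      using True a by (simp add: tail_kernel_def levy_tail_def distrib_left ennreal_plus ennreal_mult[symmetric] mult.commute flip: ennreal_plus)
  next
    case False
    then have "indicator {0<..<s} t = (0::ennreal)" for s
      by (auto simp: indicator_def)
    then show ?thesis
      using False by (simp add: tail_kernel_def)
  qed
  have "(\<integral>\<^sup>+t. ennreal (exp (- lam * t) * tail_kernel a \<nu> t) \<partial>lborel)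
      = ennreal a * (\<integral>\<^sup>+t. ennreal (exp (- lam * t)) * indicator {0<..} t \<partial>lborel)
        + (\<integral>\<^sup>+t. \<integral>\<^sup>+s. ennreal (exp (- lam * t)) * indicator {0<..<s} t \<partial>\<nu> \<partial>lborel)"
    unfolding tail by (simp add: nn_integral_add nn_integral_cmult indicator_def)
  also have "(\<integral>\<^sup>+t. ennreal (exp (- lam * t)) * indicator {0<..} t \<partial>lborel) = ennreal (1 / lam)"
  proof -
    have "(\<integral>\<^sup>+t. ennreal (exp (- lam * t)) * indicator {0<..} t \<partial>lborel)
        = (\<integral>\<^sup>+t. ennreal (exp (- lam * t)) * indicator {0..} t \<partial>lborel)"
    proof (rule nn_integral_cong_AE)
      show "AE t in lborel. ennreal (exp (- lam * t)) * indicator {0<..} t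
          = ennreal (exp (- lam * t)) * indicator {0..} t"
        using AE_lborel_singleton[of 0] by eventually_elim (auto simp: indicator_def)
    qed
    also have "\<dots> = ennreal (0 - (- exp (- lam * 0) / lam))"
    proof (rule nn_integral_FTC_atLeast)
      show "((\<lambda>t. - exp (- lam * t) / lam) \<longlongrightarrow> 0) at_top"
        using lam by real_asymp
    qed (use lam in \<open>auto intro!: derivative_eq_intros\<close>)
    finally show ?thesis by simp
  qed
  also have "(\<integral>\<^sup>+t. \<integral>\<^sup>+s. ennreal (exp (- lam * t)) * indicator {0<..<s} t \<partial>\<nu> \<partial>lborel)
      = (\<integral>\<^sup>+s. \<integral>\<^sup>+t. ennreal (exp (- lam * t)) * indicator {0<..<s} t \<partial>lborel \<partial>\<nu>)"
    by (rule Fubini'[symmetric]) (simp add: indicator_def)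
  also have "\<dots> = (\<integral>\<^sup>+s. ennreal (1 / lam * (indicator {0<..} s *\<^sub>R (1 - exp (- lam * s)))) \<partial>\<nu>)"
  proof (rule nn_integral_cong)
    fix s
    show "(\<integral>\<^sup>+t. ennreal (exp (- lam * t)) * indicator {0<..<s} t \<partial>lborel)
        = ennreal (1 / lam * (indicator {0<..} s *\<^sub>R (1 - exp (- lam * s))))"
      using exp_integral_Ioo[OF lam, of s] by (cases "s > 0") (auto simp: indicator_def)
  qed
  also have "\<dots> = ennreal (1 / lam * I)"
    using one_minus_exp_integrable[of lam] lam unfolding set_integrable_def I_def set_lebesgue_integral_def
    by (subst nn_integral_eq_integral) (auto simp: indicator_def)
  also have "ennreal a * ennreal (1 / lam) + ennreal (1 / lam * I) = ennreal (a / lam + I / lam)"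
    using a I0 lam by (simp add: ennreal_mult[symmetric] flip: ennreal_plus)
  finally have *: "has_bochner_integral lborel (\<lambda>s. exp (- lam * s) * tail_kernel a \<nu> s) (a / lam + I / lam)"
    using a I0 lam tail_kernel_nonneg by (intro has_bochner_integral_nn_integral) auto
  then show "integrable lborel (\<lambda>s. exp (- lam * s) * tail_kernel a \<nu> s)"
    by (auto simp: has_bochner_integral_iff)
  show "b + (\<integral>s. exp (- lam * s) * tail_kernel a \<nu> s \<partial>lborel) = laplace_exponent a b \<nu> lam / lam"
    using * lam by (simp add: has_bochner_integral_iff laplace_exponent_def I_def field_simps)
qed

lemma laplace_exponent_ge_drift:
  assumes "0 \<le> lam"
  shows "a + b * lam \<le> laplace_exponent a b \<nu> lam"
proof -
  have "0 \<le> (LINT s:{0<..}|\<nu>. 1 - exp (- lam * s))"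
    using assms unfolding set_lebesgue_integral_def
    by (intro Bochner_Integration.integral_nonneg) (auto simp: indicator_def)
  then show ?thesis
    by (simp add: laplace_exponent_def)
qed

text \<open>A jump s > e has lam s \<ge> 1, so it contributes at least 1 - exp(-1).\<close>

lemma laplace_exponent_ge_tail:
  assumes "0 < e" "1 / e \<le> lam"
  shows "(1 - exp (- 1)) * measure \<nu> {e<..} \<le> laplace_exponent a b \<nu> lam"
proof -
  have lam: "0 < lam"
    using assms by (meson less_le_trans zero_less_divide_1_iff)
  have fin: "emeasure \<nu> {e<..} < \<infinity>"
    using assms(1) by (rule levy_tail_finite)
  have "(1 - exp (- 1)) * measure \<nu> {e<..} = (\<integral>s. (1 - exp (- 1)) * indicator {e<..} s \<partial>\<nu>)"
    using fin by simp
  also have "\<dots> \<le> (\<integral>s. indicator {0<..} s *\<^sub>R (1 - exp (- lam * s)) \<partial>\<nu>)"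
  proof (rule integral_mono)
    show "integrable \<nu> (\<lambda>s. (1 - exp (- 1)) * indicator {e<..} s :: real)"
      using fin by (auto simp: integrable_indicator_iff)
    show "integrable \<nu> (\<lambda>s. indicator {0<..} s *\<^sub>R (1 - exp (- lam * s)))"
      using one_minus_exp_integrable[of lam] lam by (simp add: set_integrable_def)
    fix s
    have "1 \<le> lam * s" if "e < s"
    proof -
      have "1 = 1 / e * e" using assms by simp
      also have "\<dots> \<le> lam * s" using assms lam that by (intro mult_mono) auto
      finally show ?thesis .
    qed
    then show "(1 - exp (- 1)) * indicator {e<..} s \<le> indicator {0<..} s *\<^sub>R (1 - exp (- lam * s))"
      using assms lam by (auto simp: indicator_def)
  qed
  also have "\<dots> \<le> laplace_exponent a b \<nu> lam"
    using a b lam by (simp add: laplace_exponent_def set_lebesgue_integral_def)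
  finally show ?thesis .
qed

text \<open>A positive drift gives linear growth. Otherwise the tails beyond 1 / (n + 1) increase to
  the infinite mass of \<nu>, and each bounds the exponent from below, up to the factor 1 - exp(-1),
  once lam \<ge> n + 1.\<close>

lemma laplace_exponent_at_top:
  assumes "b > 0 \<or> emeasure \<nu> {0<..} = \<infinity>"
  shows "filterlim (laplace_exponent a b \<nu>) at_top at_top"
  unfolding filterlim_at_top
proof
  fix Z
  show "\<forall>\<^sub>F lam in at_top. Z \<le> laplace_exponent a b \<nu> lam"
  proof (cases "b > 0")
    case True
    show ?thesis
      using eventually_ge_at_top[of "max 0 (Z / b)"]
    proof eventually_elim
      case (elim lam)
      then have "Z \<le> b * lam"
        using True by (simp add: field_simps)
      then show ?case
        using laplace_exponent_ge_drift[of lam] a elim by simp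
    qed
  next
    case False
    define A where "A n = {1 / real (Suc n)<..}" for n
    have "(\<Union>n. A n) = {0<..}"
    proof (intro subset_antisym subsetI)
      fix x assume "x \<in> {0::real<..}"
      then obtain n where "1 / real (Suc n) < x"
        using nat_approx_posE[of x] by auto
      then show "x \<in> (\<Union>n. A n)" by (auto simp: A_def)
    next
      fix x assume "x \<in> (\<Union>n. A n)"
      then obtain n where "1 / real (Suc n) < x" by (auto simp: A_def)
      moreover have "0 < 1 / real (Suc n)" by simp
      ultimately show "x \<in> {0<..}" by (metis greaterThan_iff less_trans)
    qed
    moreover have "incseq A"
      unfolding A_def incseq_def by (auto intro: le_less_trans[rotated] simp: frac_le)
    moreover have "range A \<subseteq> sets \<nu>"
      by (auto simp: A_def)
    ultimately have "(\<lambda>n. emeasure \<nu> (A n)) \<longlonglongrightarrow> \<infinity>"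
      using Lim_emeasure_incseq[of A \<nu>] False assms by simp
    then have "\<forall>\<^sub>F n in sequentially. ennreal (max 0 (Z / (1 - exp (- 1)))) < emeasure \<nu> (A n)"
      by (rule order_tendstoD(1)) simp
    then obtain n where n: "ennreal (max 0 (Z / (1 - exp (- 1)))) < emeasure \<nu> (A n)"
      by (auto simp: eventually_sequentially)
    have "emeasure \<nu> (A n) = ennreal (measure \<nu> (A n))"
      using levy_tail_finite[of "1 / real (Suc n)"] by (simp add: A_def emeasure_eq_ennreal_measure less_top)
    with n have "ennreal (max 0 (Z / (1 - exp (- 1)))) < ennreal (measure \<nu> (A n))"
      by (simp only:)
    then have "max 0 (Z / (1 - exp (- 1))) < measure \<nu> (A n)"
      by (subst (asm) ennreal_less_iff) auto
    then have Z: "Z \<le> (1 - exp (- 1)) * measure \<nu> (A n)"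
      by (simp add: field_simps)
    show ?thesis
      using eventually_ge_at_top[of "real (Suc n)"]
    proof eventually_elim
      case (elim lam)
      then show ?case
        using Z laplace_exponent_ge_tail[of "1 / real (Suc n)" lam] by (simp add: A_def)
    qed
  qed
qed

end

end

section \<open>Functionals of semigroup orbits\<close>

text \<open>Linearity of the bound in C is what later makes \<open>resolvent_functional\<close>
  bounded: there C is proportional to the norm of the vector.\<close>

lemma laplace_bound:
  assumes f: "continuous_on {0..} f" and C: "\<And>t. t \<ge> 0 \<Longrightarrow> \<bar>f t\<bar> \<le> C * exp (c * t)" and "c < lam"
  shows "\<bar>laplace f lam\<bar> \<le> C / (lam - c)"
proof -
  have fo: "exp_order c f"
    using f C by (auto simp: exp_order_def)
  note int = laplace_integrable[OF fo \<open>c < lam\<close>]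
  have ei: "einterval 0 \<infinity> = {0::real<..}"
    by (auto simp: einterval_def)
  have "\<bar>laplace f lam\<bar> \<le> (LBINT t:{0<..}. \<bar>exp (- lam * t) * f t\<bar>)"
    unfolding laplace_def using set_integral_norm_bound[OF int] by simp
  also have "\<dots> \<le> (LBINT t:{0<..}. C * exp (- (t * (lam - c))))"
  proof (rule set_integral_mono)
    show "set_integrable lborel {0<..} (\<lambda>t. \<bar>exp (- lam * t) * f t\<bar>)"
      using int by (rule set_integrable_abs)
    show "set_integrable lborel {0<..} (\<lambda>t. C * exp (- (t * (lam - c))))"
      using integrable_I0i_exp_mscale[of "lam - c"] \<open>c < lam\<close> by (intro set_integrable_mult_right) simp
    fix t :: real assume "t \<in> {0<..}"
    then have "exp (- lam * t) * \<bar>f t\<bar> \<le> exp (- lam * t) * (C * exp (c * t))"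
      by (intro mult_left_mono C) auto
    also have "\<dots> = C * exp (- (t * (lam - c)))"
      by (simp add: algebra_simps flip: exp_add)
    finally show "\<bar>exp (- lam * t) * f t\<bar> \<le> C * exp (- (t * (lam - c)))"
      by (simp add: abs_mult)
  qed
  also have "\<dots> = C / (lam - c)"
    using LBINT_I0i_exp_mscale[of "lam - c"] \<open>c < lam\<close>
    by (simp add: interval_lebesgue_integral_def ei)
  finally show ?thesis .
qed

text \<open>For mu above the growth bound this is \<open>l\<close> composed with the resolvent of
  the generator at mu, written without integrating the orbit in the Banach space.\<close>

definition resolvent_functional ::
    "(real \<Rightarrow> 'b::banach \<Rightarrow>\<^sub>L 'b) \<Rightarrow> real \<Rightarrow> ('b \<Rightarrow> real) \<Rightarrow> 'b \<Rightarrow> real" where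
  "resolvent_functional P mu l v = laplace (\<lambda>s. l (blinfun_apply (P s) v)) mu"

lemma generator_tendsto:
  assumes "u \<in> generator_dom P"
  shows "((\<lambda>h. (blinfun_apply (P h) u - u) /\<^sub>R h) \<longlongrightarrow> generator P u) (at_right 0)"
  using assms tendsto_Lim[of "at_right (0::real)" "\<lambda>h. (blinfun_apply (P h) u - u) /\<^sub>R h"]
  by (auto simp: generator_dom_def generator_def)

lemma generatorI:
  assumes "((\<lambda>h. (blinfun_apply (P h) u - u) /\<^sub>R h) \<longlongrightarrow> v) (at_right 0)"
  shows "u \<in> generator_dom P" "generator P u = v"
  using assms by (auto simp: generator_dom_def generator_def intro!: tendsto_Lim)

context
  fixes P :: "real \<Rightarrow> 'b::banach \<Rightarrow>\<^sub>L 'b" and K lam0 :: real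
  assumes semigroup: "C0_semigroup P" and K: "K > 0" and lam0: "lam0 \<ge> 0"
    and growth: "\<And>t u. t \<ge> 0 \<Longrightarrow> norm (blinfun_apply (P t) u) \<le> K * exp (lam0 * t) * norm u"
begin

lemma orbit_continuous: "continuous_on {0..} (\<lambda>s. blinfun_apply (P s) v)"
  using semigroup by (auto simp: C0_semigroup_def)

lemma semigroup_add:
  assumes "s \<ge> 0" "t \<ge> 0"
  shows "blinfun_apply (P (s + t)) v = blinfun_apply (P s) (blinfun_apply (P t) v)"
  using semigroup assms by (auto simp: C0_semigroup_def)

lemma semigroup_zero: "blinfun_apply (P 0) v = v"
  using semigroup by (simp add: C0_semigroup_def)

context
  fixes l :: "'b \<Rightarrow> real"
  assumes l: "bounded_linear l"
begin

text \<open>One constant B serves all vectors v, which is needed for boundedness of the transform in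
  v.\<close>

lemma orbit_functional_bound:
  obtains B where "B \<ge> 0" "\<And>v s. s \<ge> 0 \<Longrightarrow> \<bar>l (blinfun_apply (P s) v)\<bar> \<le> (B * norm v) * exp (lam0 * s)"
proof -
  obtain B where B: "B \<ge> 0" "\<And>v. norm (l v) \<le> norm v * B"
    using bounded_linear.nonneg_bounded[OF l] by blast
  have "\<bar>l (blinfun_apply (P s) v)\<bar> \<le> (K * B * norm v) * exp (lam0 * s)" if "s \<ge> 0" for v s
  proof -
    have "\<bar>l (blinfun_apply (P s) v)\<bar> \<le> norm (blinfun_apply (P s) v) * B"
      using B(2) by simp
    also have "\<dots> \<le> (K * exp (lam0 * s) * norm v) * B"
      using growth[OF that] B(1) by (rule mult_right_mono)
    finally show ?thesis by (simp only: mult_ac)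
  qed
  then show ?thesis
    using B(1) K by (intro that[of "K * B"]) auto
qed

lemma orbit_functional_exp_order: "exp_order lam0 (\<lambda>s. l (blinfun_apply (P s) v))"
proof -
  obtain B where "B \<ge> 0" "\<And>v s. s \<ge> 0 \<Longrightarrow> \<bar>l (blinfun_apply (P s) v)\<bar> \<le> (B * norm v) * exp (lam0 * s)"
    using orbit_functional_bound by blast
  then show ?thesis
    using bounded_linear.continuous_on[OF l orbit_continuous] by (auto simp: exp_order_def)
qed

text \<open>The generator is a right derivative at 0. To the right of t the semigroup law and the
  continuity of \<open>P t\<close> suffice; to the left the operator \<open>P (t - h)\<close> varies
  with h as well.\<close>

lemma orbit_functional_derivative:
  assumes u: "u \<in> generator_dom P" and t: "t > 0"
  shows "((\<lambda>s. l (blinfun_apply (P s) u)) has_real_derivative l (blinfun_apply (P t) (generator P u))) (at t)"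
proof -
  interpret l: bounded_linear l by (rule l)
  let ?G = "generator P u"
  define x where "x h = (blinfun_apply (P h) u - u) /\<^sub>R h" for h
  have x: "(x \<longlongrightarrow> ?G) (at_right 0)"
    unfolding x_def by (rule generator_tendsto[OF u])
  have right: "((\<lambda>h. (l (blinfun_apply (P (t + h)) u) - l (blinfun_apply (P t) u)) / h)
      \<longlongrightarrow> l (blinfun_apply (P t) ?G)) (at_right 0)"
  proof (rule Lim_transform_eventually)
    show "((\<lambda>h. l (blinfun_apply (P t) (x h))) \<longlongrightarrow> l (blinfun_apply (P t) ?G)) (at_right 0)"
      by (intro l.tendsto tendsto_intros x)
    show "\<forall>\<^sub>F h in at_right 0. l (blinfun_apply (P t) (x h))
        = (l (blinfun_apply (P (t + h)) u) - l (blinfun_apply (P t) u)) / h"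
      using eventually_at_right_less[of 0]
    proof eventually_elim
      case (elim h)
      then show ?case
        using t by (simp add: x_def semigroup_add blinfun.scaleR_right blinfun.diff_right l.scaleR l.diff divide_inverse_commute)
    qed
  qed
  \<comment> \<open>Split off the limit \<open>?G\<close> of \<open>x h\<close>: on the remainder
    the operators are uniformly bounded by K exp(lam0 t), and on the fixed vector \<open>?G\<close>
    strong continuity applies.\<close>
  have "((\<lambda>h. blinfun_apply (P (t - h)) (x h)) \<longlongrightarrow> blinfun_apply (P t) ?G) (at_right 0)"
  proof -
    have ev: "\<forall>\<^sub>F h in at_right 0. 0 < h \<and> h < t"
      using eventually_at_right_real[OF t] by eventually_elim auto
    have "((\<lambda>h. blinfun_apply (P (t - h)) (x h - ?G)) \<longlongrightarrow> 0) (at_right 0)"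
    proof (rule Lim_null_comparison)
      show "\<forall>\<^sub>F h in at_right 0. norm (blinfun_apply (P (t - h)) (x h - ?G)) \<le> K * exp (lam0 * t) * norm (x h - ?G)"
        using ev
      proof eventually_elim
        case (elim h)
        have "norm (blinfun_apply (P (t - h)) (x h - ?G)) \<le> K * exp (lam0 * (t - h)) * norm (x h - ?G)"
          using elim by (intro growth) simp
        also have "\<dots> \<le> K * exp (lam0 * t) * norm (x h - ?G)"
          using K lam0 elim by (intro mult_right_mono mult_left_mono) (auto intro: mult_left_mono)
        finally show ?case .
      qed
      show "((\<lambda>h. K * exp (lam0 * t) * norm (x h - ?G)) \<longlongrightarrow> 0) (at_right 0)"
        using x by (intro tendsto_mult_right_zero tendsto_norm_zero) (simp add: LIM_zero_iff)
    qed
    moreover have "((\<lambda>h. blinfun_apply (P (t - h)) ?G) \<longlongrightarrow> blinfun_apply (P t) ?G) (at_right 0)"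
    proof -
      have "continuous_on {0<..} (\<lambda>s. blinfun_apply (P s) ?G)"
        by (rule continuous_on_subset[OF orbit_continuous]) auto
      then have "isCont (\<lambda>s. blinfun_apply (P s) ?G) t"
        using t by (simp add: continuous_on_eq_continuous_at)
      moreover have "((\<lambda>h. t - h) \<longlongrightarrow> t) (at_right 0)"
        by (auto intro!: tendsto_eq_intros)
      ultimately show ?thesis
        by (rule isCont_tendsto_compose)
    qed
    ultimately have "((\<lambda>h. blinfun_apply (P (t - h)) (x h - ?G) + blinfun_apply (P (t - h)) ?G)
        \<longlongrightarrow> 0 + blinfun_apply (P t) ?G) (at_right 0)"
      by (rule tendsto_add)
    then show ?thesis
      by (simp add: blinfun.diff_right)
  qed
  then have left': "((\<lambda>h. l (blinfun_apply (P (t - h)) (x h))) \<longlongrightarrow> l (blinfun_apply (P t) ?G)) (at_right 0)"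
    by (rule l.tendsto)
  have left: "((\<lambda>h. (l (blinfun_apply (P (t + h)) u) - l (blinfun_apply (P t) u)) / h)
      \<longlongrightarrow> l (blinfun_apply (P t) ?G)) (at_left 0)"
    unfolding filterlim_at_left_to_right[of _ _ "0::real"] minus_zero
  proof (rule Lim_transform_eventually[OF left'])
    show "\<forall>\<^sub>F h in at_right 0. l (blinfun_apply (P (t - h)) (x h))
        = (l (blinfun_apply (P (t + - h)) u) - l (blinfun_apply (P t) u)) / - h"
      using eventually_at_right_real[OF t]
    proof eventually_elim
      case (elim h)
      then have "blinfun_apply (P t) u = blinfun_apply (P (t - h)) (blinfun_apply (P h) u)"
        using semigroup_add[of "t - h" h u] by simp
      then show ?case
        using elim by (simp add: x_def blinfun.scaleR_right blinfun.diff_right l.scaleR l.diff field_simps)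
    qed
  qed
  show ?thesis
    unfolding DERIV_def using left right by (simp add: filterlim_at_split)
qed

lemma resolvent_functional_bounded_linear:
  assumes "lam0 < mu"
  shows "bounded_linear (resolvent_functional P mu l)"
proof -
  interpret l: bounded_linear l by (rule l)
  obtain B where B: "B \<ge> 0" "\<And>v s. s \<ge> 0 \<Longrightarrow> \<bar>l (blinfun_apply (P s) v)\<bar> \<le> (B * norm v) * exp (lam0 * s)"
    using orbit_functional_bound by blast
  show ?thesis
  proof (rule bounded_linear_intro)
    show "resolvent_functional P mu l (v + w) = resolvent_functional P mu l v + resolvent_functional P mu l w" for v w
      unfolding resolvent_functional_def blinfun.add_right l.add
      using orbit_functional_exp_order orbit_functional_exp_order assms by (rule laplace_add)
    show "resolvent_functional P mu l (r *\<^sub>R v) = r *\<^sub>R resolvent_functional P mu l v" for r v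
      by (simp add: resolvent_functional_def blinfun.scaleR_right l.scaleR laplace_cmult)
    show "norm (resolvent_functional P mu l v) \<le> norm v * (B / (mu - lam0))" for v
      using laplace_bound[OF bounded_linear.continuous_on[OF l orbit_continuous] B(2) assms, of v]
      by (simp add: resolvent_functional_def mult.commute)
  qed
qed

text \<open>On the domain R(mu) G = mu R(mu) - 1, read off from the transform of the derivative of
  an orbit.\<close>

lemma resolvent_functional_generator:
  assumes "lam0 < mu" "u \<in> generator_dom P"
  shows "resolvent_functional P mu l (generator P u) = mu * resolvent_functional P mu l u - l u"
  unfolding resolvent_functional_def
  using laplace_derivative[OF orbit_functional_exp_order orbit_functional_exp_order assms(1)
      orbit_functional_derivative[OF assms(2)]]
  by (simp add: semigroup_zero)

end

end

section \<open>The inverse of a subordinator\<close>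

text \<open>The third clause, strict monotonicity before killing, makes the inverse continuous.\<close>

definition good_path :: "(real \<Rightarrow> ereal) \<Rightarrow> bool" where
  "good_path z \<longleftrightarrow> (\<forall>s\<ge>0. 0 \<le> z s) \<and>
     (\<forall>s r. 0 \<le> s \<and> s \<le> r \<longrightarrow> z s \<le> z r) \<and>
     (\<forall>s r. 0 \<le> s \<and> s < r \<and> z s < \<infinity> \<longrightarrow> z s < z r) \<and>
     (\<forall>s\<ge>0. \<forall>t. z s < ereal t \<longrightarrow> (\<exists>d>0. z (s + d) < ereal t)) \<and>
     (\<forall>t. \<exists>s\<ge>0. ereal t < z s)"

definition path_inverse :: "(real \<Rightarrow> ereal) \<Rightarrow> real \<Rightarrow> real" where
  "path_inverse z t = Inf {s. 0 \<le> s \<and> ereal t < z s}"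

context
  fixes z assumes good: "good_path z"
begin

private lemma nonneg: "0 \<le> s \<Longrightarrow> 0 \<le> z s"
  and mono: "0 \<le> s \<Longrightarrow> s \<le> r \<Longrightarrow> z s \<le> z r"
  and strict: "0 \<le> s \<Longrightarrow> s < r \<Longrightarrow> z s < \<infinity> \<Longrightarrow> z s < z r"
  and rcont: "0 \<le> s \<Longrightarrow> z s < ereal t \<Longrightarrow> \<exists>d>0. z (s + d) < ereal t"
  and unbounded: "\<exists>s\<ge>0. ereal t < z s"
  using good by (auto simp: good_path_def)

private lemma bdd: "bdd_below {s. 0 \<le> s \<and> ereal t < z s}"
  by (intro bdd_belowI[of _ 0]) auto

lemma path_inverse_le: "0 \<le> s \<Longrightarrow> ereal t < z s \<Longrightarrow> path_inverse z t \<le> s"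
  unfolding path_inverse_def by (intro cInf_lower bdd) auto

lemma path_inverse_ge: "(\<And>s. 0 \<le> s \<Longrightarrow> ereal t < z s \<Longrightarrow> x \<le> s) \<Longrightarrow> x \<le> path_inverse z t"
  unfolding path_inverse_def using unbounded[of t] by (intro cInf_greatest) auto

lemma path_inverse_nonneg: "0 \<le> path_inverse z t"
  by (intro path_inverse_ge)

lemma path_inverse_mono: "t \<le> t' \<Longrightarrow> path_inverse z t \<le> path_inverse z t'"
  by (intro path_inverse_ge path_inverse_le) (auto intro: le_less_trans[of "ereal t" "ereal t'"])

text \<open>A countable description, from which joint measurability in time and sample point
  follows.\<close>

lemma path_inverse_less_iff: "path_inverse z t < r \<longleftrightarrow> (\<exists>q\<in>\<rat>. 0 \<le> q \<and> q < r \<and> ereal t < z q)"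
proof
  assume "path_inverse z t < r"
  then obtain s where s: "0 \<le> s" "ereal t < z s" "s < r"
    using path_inverse_ge[of t r] by (metis not_le)
  obtain q where "q \<in> \<rat>" "s < q" "q < r"
    using Rats_dense_in_real[OF s(3)] by blast
  then show "\<exists>q\<in>\<rat>. 0 \<le> q \<and> q < r \<and> ereal t < z q"
    using s mono[of s q] by (intro bexI[of _ q]) (auto intro: less_le_trans)
next
  assume "\<exists>q\<in>\<rat>. 0 \<le> q \<and> q < r \<and> ereal t < z q"
  then show "path_inverse z t < r"
    using path_inverse_le by (meson le_less_trans)
qed

text \<open>By right continuity z is still below t at some r + d, hence on [0, r + d], so the
  infimum is at least r + d.\<close>

lemma less_path_inverse:
  assumes "0 \<le> r" "z r < ereal t"
  shows "r < path_inverse z t"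
proof -
  obtain d where d: "d > 0" "z (r + d) < ereal t"
    using rcont[OF assms] by blast
  have "r + d \<le> path_inverse z t"
  proof (rule path_inverse_ge)
    fix s assume "0 \<le> s" "ereal t < z s"
    then show "r + d \<le> s"
      using d(2) mono[of s "r + d"] by (meson le_less_trans less_imp_le less_asym not_le less_le_trans)
  qed
  then show ?thesis using d(1) by simp
qed

lemma le_of_less_path_inverse:
  assumes "0 \<le> r" "r < path_inverse z t"
  shows "z r \<le> ereal t"
  using path_inverse_le[OF assms(1), of t] assms(2) by (meson not_le)

text \<open>Strict increase gives 0 < z s for every s > 0, also when z 0 = \<infinity>.\<close>

lemma path_inverse_zero: "path_inverse z 0 = 0"
proof (rule antisym[OF _ path_inverse_nonneg])
  show "path_inverse z 0 \<le> 0"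
  proof (rule dense_ge)
    fix s :: real assume "0 < s"
    have "0 < z s"
    proof (cases "z 0 < \<infinity>")
      case True
      then show ?thesis
        using strict[of 0 s] nonneg[of 0] \<open>0 < s\<close> by (auto intro: le_less_trans)
    next
      case False
      then show ?thesis
        using mono[of 0 s] \<open>0 < s\<close> by (auto intro: less_le_trans)
    qed
    then show "path_inverse z 0 \<le> s"
      using \<open>0 < s\<close> by (intro path_inverse_le) (auto simp: zero_ereal_def)
  qed
qed

text \<open>A jump of the inverse would be an interval on which z is constant, which strict increase
  excludes.\<close>

lemma path_inverse_isCont: "continuous_on UNIV (path_inverse z)"
  unfolding continuous_on_eq_continuous_at[OF open_UNIV] isCont_def
proof (intro ballI order_tendstoI)
  fix t a assume a: "a < path_inverse z t"
  show "\<forall>\<^sub>F x in at t. a < path_inverse z x"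
  proof (cases "a < 0")
    case True
    then show ?thesis
      using path_inverse_nonneg by (auto intro: always_eventually less_le_trans)
  next
    case False
    obtain r where r: "a < r" "r < path_inverse z t"
      using dense[OF a] by blast
    have "z r \<le> ereal t"
      using False r by (intro le_of_less_path_inverse) auto
    moreover have "z a \<le> z r"
      using False r by (intro mono) auto
    ultimately have fin: "z a < \<infinity>"
      by (cases "z a") auto
    \<comment> \<open>The intermediate r turns z r \<le> t into the strict z a < t, which persists
      for arguments x near t.\<close>
    have "z a < z r"
      using strict[of a r] fin False r by simp
    then have "z a < ereal t"
      using \<open>z r \<le> ereal t\<close> by simp
    moreover have "z a \<noteq> - \<infinity>"
      using nonneg[of a] False by auto
    ultimately obtain x0 where x0: "z a = ereal x0" "x0 < t"
      by (cases "z a") auto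
    have "\<forall>\<^sub>F x in at t. x0 < x"
      using x0(2) tendsto_ident_at by (rule order_tendstoD(1)[rotated])
    then show ?thesis
      by eventually_elim (use x0 False in \<open>auto intro!: less_path_inverse\<close>)
  qed
next
  fix t a assume "path_inverse z t < a"
  then obtain q where q: "0 \<le> q" "q < a" "ereal t < z q"
    by (auto simp: path_inverse_less_iff)
  obtain x0 where x0: "t < x0" "ereal x0 < z q"
    using ereal_dense2[OF q(3)] by auto
  have "\<forall>\<^sub>F x in at t. x < x0"
    using x0(1) tendsto_ident_at by (rule order_tendstoD(2)[rotated])
  then show "\<forall>\<^sub>F x in at t. path_inverse z x < a"
  proof eventually_elim
    case (elim x)
    then have "ereal x < z q"
      using x0(2) by (meson ereal_less_eq(3) less_imp_le le_less_trans)
    then show ?case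
      using path_inverse_le[OF q(1)] q(2) by (meson le_less_trans)
  qed
qed

text \<open>Up to the single point \<open>t = z r\<close>, the inverse at \<open>t\<close> exceeds \<open>r\<close> if and only if \<open>z r < t\<close>.\<close>

lemma path_inverse_laplace:
  assumes "0 \<le> r" "0 < lam"
  shows "(\<integral>\<^sup>+t. ennreal (exponential_density lam t) * indicator {r<..} (path_inverse z t) \<partial>lborel)
    = ennreal (if z r = \<infinity> then 0 else exp (- lam * real_of_ereal (z r)))"
proof (cases "z r")
  case (real x)
  then have "0 \<le> x"
    using nonneg[OF assms(1)] by simp
  have "(\<integral>\<^sup>+t. ennreal (exponential_density lam t) * indicator {r<..} (path_inverse z t) \<partial>lborel)
      = (\<integral>\<^sup>+t. ennreal (lam * exp (- lam * t)) * indicator {x..} t \<partial>lborel)"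
  proof (rule nn_integral_cong_AE)
    show "AE t in lborel. ennreal (exponential_density lam t) * indicator {r<..} (path_inverse z t)
        = ennreal (lam * exp (- lam * t)) * indicator {x..} t"
      using AE_lborel_singleton[of x]
    proof eventually_elim
      case (elim t)
      consider "x < t" | "t < x" using elim by linarith
      then show ?case
      proof cases
        case 1
        then have "r < path_inverse z t"
          using assms real by (intro less_path_inverse) auto
        then show ?thesis
          using 1 \<open>0 \<le> x\<close> by (simp add: exponential_density_def mult.commute)
      next
        case 2
        then have "\<not> r < path_inverse z t"
          using le_of_less_path_inverse[OF assms(1), of t] real by auto
        then show ?thesis
          using 2 by simp
      qed
    qed
  qed
  also have "\<dots> = ennreal (0 - (- exp (- lam * x)))"
  proof (rule nn_integral_FTC_atLeast)
    have "((\<lambda>t. exp (- lam * t)) \<longlongrightarrow> 0) at_top"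
      using \<open>0 < lam\<close> by (intro filterlim_compose[OF exp_at_bot]
          filterlim_tendsto_neg_mult_at_bot[OF tendsto_const] filterlim_ident) auto
    from tendsto_minus[OF this] show "((\<lambda>t. - exp (- lam * t)) \<longlongrightarrow> 0) at_top" by simp
  qed (use assms in \<open>auto intro!: derivative_eq_intros\<close>)
  finally show ?thesis
    using real by simp
next
  case PInf
  then have "\<not> r < path_inverse z t" for t
    using le_of_less_path_inverse[OF assms(1), of t] by auto
  then show ?thesis
    using PInf by simp
next
  case MInf
  then show ?thesis
    using nonneg[OF assms(1)] by simp
qed

end

text \<open>Strictness is assumed at rational times, where countably many almost sure events
  suffice; two rationals between s and r extend it to all times. The extended threshold \<zeta>
  treats killing and its absence together.\<close>

lemma good_path_killed:
  fixes x :: "real \<Rightarrow> real" and z :: "real \<Rightarrow> ereal"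
  assumes mono: "mono_on {0..} x" and zero: "x 0 = 0"
    and strict: "\<And>p q. p \<in> \<rat> \<Longrightarrow> q \<in> \<rat> \<Longrightarrow> 0 \<le> p \<Longrightarrow> p < q \<Longrightarrow> x p \<noteq> x q"
    and right: "\<And>t. t \<ge> 0 \<Longrightarrow> (x \<longlongrightarrow> x t) (at_right t)"
    and z: "\<And>t. t \<ge> 0 \<Longrightarrow> z t = (if ereal t < \<zeta> then ereal (x t) else \<infinity>)"
    and unbounded: "\<And>n :: nat. \<exists>k :: nat. ereal (real n) < z (real k)"
  shows "good_path z"
proof -
  have xmono: "x s \<le> x r" if "0 \<le> s" "s \<le> r" for s r
    using mono that by (auto simp: mono_on_def)
  have xstrict: "x s < x r" if s: "0 \<le> s" and sr: "s < r" for s r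
  proof -
    obtain p where p: "p \<in> \<rat>" "s < p" "p < r"
      using Rats_dense_in_real[OF sr] by blast
    obtain q where q: "q \<in> \<rat>" "p < q" "q < r"
      using Rats_dense_in_real[OF p(3)] by blast
    have "x s \<le> x p" "x p \<le> x q" "x q \<le> x r"
      using s p q by (auto intro!: xmono)
    moreover have "x p \<noteq> x q"
      using s p q by (intro strict) auto
    ultimately show ?thesis by simp
  qed
  have killed: "ereal s < \<zeta>" if "ereal r < \<zeta>" "s \<le> r" for r s
    using that by (meson ereal_less_eq(3) le_less_trans)
  have "0 \<le> z s" if "0 \<le> s" for s
    using that xmono[of 0 s] zero by (simp add: z)
  moreover have "z s \<le> z r" if "0 \<le> s" "s \<le> r" for s r
    using that killed[of r s] xmono[of s r] by (simp add: z)
  moreover have "z s < z r" if "0 \<le> s" "s < r" "z s < \<infinity>" for s r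
    using that xstrict[of s r] by (simp add: z split: if_splits)
  moreover have "\<exists>d>0. z (s + d) < ereal t" if "0 \<le> s" "z s < ereal t" for s t
  proof -
    have s: "ereal s < \<zeta>" "x s < t"
      using that by (auto simp: z split: if_splits)
    obtain c where c: "s < c" "ereal c < \<zeta>"
      using ereal_dense2[OF s(1)] by auto
    have "\<forall>\<^sub>F y in at_right s. x y < t"
      using right[OF that(1)] s(2) by (rule order_tendstoD(2))
    moreover have "\<forall>\<^sub>F y in at_right s. y \<in> {s<..<c}"
      using c(1) by (rule eventually_at_right_real)
    ultimately have "\<forall>\<^sub>F y in at_right s. x y < t \<and> y \<in> {s<..<c}"
      by (rule eventually_conj)
    then obtain y where y: "x y < t" "s < y" "y < c"
      using eventually_happens[of _ "at_right s"] by auto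
    moreover have "ereal y < \<zeta>"
      using killed[OF c(2), of y] y(3) by simp
    ultimately have "z (s + (y - s)) < ereal t"
      using that(1) by (simp add: z)
    then show ?thesis
      using y(2) by (intro exI[of _ "y - s"]) simp
  qed
  moreover have "\<exists>s\<ge>0. ereal t < z s" for t
  proof -
    obtain n :: nat where "t < real n"
      using reals_Archimedean2 by blast
    then show ?thesis
      using unbounded[of n] by (meson ereal_less_eq(3) le_less_trans less_imp_le of_nat_0_le_iff)
  qed
  ultimately show ?thesis
    unfolding good_path_def by blast
qed

text \<open>The identity will replace the paths on the exceptional null set.\<close>

lemma good_path_ereal: "good_path ereal"
proof -
  have "\<exists>d>0. s + d < t" if "s < t" for s t :: real
    using that by (intro exI[of _ "(t - s) / 2"]) (auto simp: field_simps)
  moreover have "\<exists>s\<ge>0. t < s" for t :: real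
    by (intro exI[of _ "max 0 t + 1"]) auto
  ultimately show ?thesis
    by (simp add: good_path_def)
qed

section \<open>Almost sure regularity of the paths and a regular version of the inverse\<close>

context
  fixes M :: "'w measure" and S :: "real \<Rightarrow> 'w \<Rightarrow> ereal"
    and a b :: real and \<nu> :: "real measure"
  assumes sub: "killed_subordinator M S a b \<nu>"
    and inf: "b > 0 \<or> emeasure \<nu> {0<..} = \<infinity>"
begin

private lemma prob: "prob_space M" and triplet: "subordinator_triplet a b \<nu>"
  and S_meas: "t \<ge> 0 \<Longrightarrow> S t \<in> borel_measurable M"
  using sub by (auto simp: killed_subordinator_def)

interpretation prob_space M by (rule prob)

private lemma laplace_S:
  assumes "t \<ge> 0" "\<theta> \<ge> 0"
  shows "(\<integral>\<omega>. (if S t \<omega> = \<infinity> then 0 else exp (- \<theta> * real_of_ereal (S t \<omega>))) \<partial>M)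
    = exp (- t * laplace_exponent a b \<nu> \<theta>)"
  using sub assms by (auto simp: killed_subordinator_def)

private lemma exponent_pos: "\<exists>\<theta>>0. laplace_exponent a b \<nu> \<theta> > 0"
proof -
  have "\<forall>\<^sub>F \<theta> in at_top. 0 < laplace_exponent a b \<nu> \<theta>"
    using laplace_exponent_at_top[OF triplet inf] by (simp add: filterlim_at_top_dense)
  then have "\<forall>\<^sub>F \<theta> in at_top. 0 < \<theta> \<and> 0 < laplace_exponent a b \<nu> \<theta>"
    using eventually_gt_at_top[of 0] by eventually_elim auto
  then show ?thesis
    using eventually_happens[of _ "at_top :: real filter"] by auto
qed

text \<open>Chernoff's inequality. With x = 0 and \<theta> \<rightarrow> \<infinity> it excludes an
  atom at 0; with \<theta> fixed and s \<rightarrow> \<infinity> it shows that paths are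
  unbounded.\<close>

private lemma prob_le:
  assumes "s \<ge> 0" "\<theta> > 0" "A \<in> events"
    and A: "AE \<omega> in M. \<omega> \<in> A \<longrightarrow> S s \<omega> \<noteq> \<infinity> \<and> real_of_ereal (S s \<omega>) \<le> x"
    and nonneg: "AE \<omega> in M. 0 \<le> S s \<omega>"
  shows "prob A \<le> exp (\<theta> * x) * exp (- s * laplace_exponent a b \<nu> \<theta>)"
proof -
  let ?h = "\<lambda>\<omega>. if S s \<omega> = \<infinity> then 0 else exp (- \<theta> * real_of_ereal (S s \<omega>))"
  have [measurable]: "S s \<in> borel_measurable M"
    using S_meas[OF assms(1)] .
  have int: "integrable M ?h"
  proof (rule integrable_const_bound[where B = 1])
    show "AE \<omega> in M. norm (?h \<omega>) \<le> 1"
      using nonneg by eventually_elim (use \<open>\<theta> > 0\<close> in \<open>auto simp: real_of_ereal_pos\<close>)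
  qed measurable
  have "prob A = (\<integral>\<omega>. indicator A \<omega> \<partial>M)"
    using assms(3) by simp
  also have "\<dots> \<le> (\<integral>\<omega>. exp (\<theta> * x) * ?h \<omega> \<partial>M)"
  proof (rule integral_mono_AE)
    show "integrable M (indicator A :: _ \<Rightarrow> real)"
      using assms(3) by (simp add: less_top[symmetric])
    show "integrable M (\<lambda>\<omega>. exp (\<theta> * x) * ?h \<omega>)"
      using int by simp
    show "AE \<omega> in M. indicator A \<omega> \<le> exp (\<theta> * x) * ?h \<omega>"
      using A
    proof eventually_elim
      case (elim \<omega>)
      show ?case
      proof (cases "\<omega> \<in> A")
        case True
        then have "0 \<le> \<theta> * x + - \<theta> * real_of_ereal (S s \<omega>)"
          using elim \<open>\<theta> > 0\<close> by (simp add: mult_left_mono)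
        then have "1 \<le> exp (\<theta> * x) * exp (- \<theta> * real_of_ereal (S s \<omega>))"
          unfolding exp_add[symmetric] by simp
        then show ?thesis
          using True elim by simp
      qed simp
    qed
  qed
  also have "\<dots> = exp (\<theta> * x) * exp (- s * laplace_exponent a b \<nu> \<theta>)"
    using laplace_S[OF assms(1), of \<theta>] \<open>\<theta> > 0\<close> by simp
  finally show ?thesis .
qed

text \<open>The Laplace exponent tends to infinity, so \<open>S s\<close> has no atom at \<open>0\<close>. If \<open>a > 0\<close>, this transfers to the
  unkilled process by independence of the killing time.\<close>

private lemma prob_zero:
  assumes "s > 0" "A \<in> events"
    and A: "AE \<omega> in M. \<omega> \<in> A \<longrightarrow> S s \<omega> = 0"
    and nonneg: "AE \<omega> in M. 0 \<le> S s \<omega>"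
  shows "prob A = 0"
proof (rule antisym[OF _ measure_nonneg])
  have le: "prob A \<le> exp (- s * laplace_exponent a b \<nu> \<theta>)" if "\<theta> > 0" for \<theta>
  proof -
    have "AE \<omega> in M. \<omega> \<in> A \<longrightarrow> S s \<omega> \<noteq> \<infinity> \<and> real_of_ereal (S s \<omega>) \<le> 0"
      using A by eventually_elim auto
    then show ?thesis
      using prob_le[of s \<theta> A 0] assms that by simp
  qed
  have "((\<lambda>\<theta>. exp (- s * laplace_exponent a b \<nu> \<theta>)) \<longlongrightarrow> 0) at_top"
    using \<open>s > 0\<close> by (intro filterlim_compose[OF exp_at_bot]
        filterlim_tendsto_neg_mult_at_bot[OF tendsto_const] laplace_exponent_at_top[OF triplet inf]) auto
  moreover have "\<forall>\<^sub>F \<theta> in at_top. prob A \<le> exp (- s * laplace_exponent a b \<nu> \<theta>)"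
    using eventually_gt_at_top[of 0] by eventually_elim (rule le)
  ultimately show "prob A \<le> 0"
    by (intro tendsto_lowerbound[of _ 0 at_top]) auto
qed

text \<open>Monotonicity and right continuity come from the unkilled process. Strictness is obtained
  for pairs of rational times and unboundedness at integer levels, so that the exceptional events
  remain countable in number.\<close>

lemma subordinator_good_paths: "AE \<omega> in M. good_path (\<lambda>s. S s \<omega>)"
proof -
  obtain X where X: "unkilled_subordinator M X"
    and killing: "if a = 0 then AE \<omega> in M. \<forall>t\<ge>0. S t \<omega> = ereal (X t \<omega>)
         else \<exists>\<zeta>. distributed M lborel \<zeta> (\<lambda>x. ennreal (exponential_density a x)) \<and>
                indep_set {\<zeta> -` A \<inter> space M | A. A \<in> sets borel}
                  {(\<lambda>\<omega>. \<lambda>t\<in>{0..}. X t \<omega>) -` B \<inter> space M | B. B \<in> sets (Pi\<^sub>M {0..} (\<lambda>_. borel))} \<and>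
                (AE \<omega> in M. \<forall>t\<ge>0. S t \<omega> = (if t < \<zeta> \<omega> then ereal (X t \<omega>) else \<infinity>))"
    using sub unfolding killed_subordinator_def by blast
  have X_meas: "\<And>t. t \<ge> 0 \<Longrightarrow> X t \<in> borel_measurable M"
    and X_zero: "AE \<omega> in M. X 0 \<omega> = 0"
    and X_stat: "\<And>s t. s \<ge> 0 \<Longrightarrow> t \<ge> 0 \<Longrightarrow> distr M borel (\<lambda>\<omega>. X (s + t) \<omega> - X s \<omega>) = distr M borel (X t)"
    and X_right: "AE \<omega> in M. \<forall>t\<ge>0. ((\<lambda>s. X s \<omega>) \<longlongrightarrow> X t \<omega>) (at_right t)"
    and X_mono: "AE \<omega> in M. mono_on {0..} (\<lambda>t. X t \<omega>)"
    using X by (auto simp: unkilled_subordinator_def levy_process_def)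
  have X_nonneg: "AE \<omega> in M. \<forall>t\<ge>0. 0 \<le> X t \<omega>"
    using X_zero X_mono by eventually_elim (auto simp: mono_on_def, metis order_refl)
  define Z0 where "Z0 h = {\<omega> \<in> space M. X h \<omega> = 0}" for h
  have Z0 [measurable]: "Z0 h \<in> events" if "h \<ge> 0" for h
    using X_meas[OF that] unfolding Z0_def by measurable
  \<comment> \<open>The value \<infinity> represents a = 0, so that both forms of the killing
    hypothesis end in the same facts.\<close>
  obtain \<zeta> :: "'w \<Rightarrow> ereal"
    where S_eq: "AE \<omega> in M. \<forall>t\<ge>0. S t \<omega> = (if ereal t < \<zeta> \<omega> then ereal (X t \<omega>) else \<infinity>)"
      and X_pos: "\<And>h. h > 0 \<Longrightarrow> prob (Z0 h) = 0"
  proof (cases "a = 0")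
    case True
    then have eq: "AE \<omega> in M. \<forall>t\<ge>0. S t \<omega> = ereal (X t \<omega>)"
      using killing by simp
    have "prob (Z0 h) = 0" if "h > 0" for h
    proof (rule prob_zero[OF that])
      show "AE \<omega> in M. \<omega> \<in> Z0 h \<longrightarrow> S h \<omega> = 0"
        using eq by eventually_elim (use that in \<open>auto simp: Z0_def zero_ereal_def\<close>)
      show "AE \<omega> in M. 0 \<le> S h \<omega>"
        using eq X_nonneg by eventually_elim (use that in auto)
    qed (use that Z0 in simp)
    with eq show ?thesis
      by (intro that[of "\<lambda>_. \<infinity>"]) auto
  next
    case False
    have "a \<ge> 0"
      using triplet unfolding subordinator_triplet_def by blast
    then have a: "a > 0"
      using False by linarith
    obtain \<zeta> where \<zeta>: "distributed M lborel \<zeta> (\<lambda>x. ennreal (exponential_density a x))"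
      and indep: "indep_set {\<zeta> -` A \<inter> space M | A. A \<in> sets borel}
                  {(\<lambda>\<omega>. \<lambda>t\<in>{0..}. X t \<omega>) -` B \<inter> space M | B. B \<in> sets (Pi\<^sub>M {0..} (\<lambda>_. borel))}"
      and eq: "AE \<omega> in M. \<forall>t\<ge>0. S t \<omega> = (if t < \<zeta> \<omega> then ereal (X t \<omega>) else \<infinity>)"
      using killing False by auto
    have [measurable]: "\<zeta> \<in> borel_measurable M"
      using distributed_measurable[OF \<zeta>] by simp
    have "prob (Z0 h) = 0" if "h > 0" for h
    proof -
      \<comment> \<open>On survival beyond h, S and X agree at h. Independence gives 0 = P(A) P(X h
        = 0), and P(A) = exp(-h a) is positive.\<close>
      define A where "A = \<zeta> -` {h<..} \<inter> space M"
      have "prob A = exp (- h * a)"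
        using exponential_distributedD_gt[OF \<zeta> _ a, of h] that
        by (simp add: A_def vimage_def Int_def conj_commute)
      moreover have "prob (A \<inter> Z0 h) = prob A * prob (Z0 h)"
      proof (rule indep_setD[OF indep])
        show "A \<in> {\<zeta> -` A \<inter> space M | A. A \<in> sets borel}"
          by (auto simp: A_def intro!: exI[of _ "{h<..}"])
        have [measurable]: "(\<lambda>f. f h) \<in> borel_measurable (Pi\<^sub>M {0..} (\<lambda>_. borel :: real measure))"
          using that by (intro measurable_component_singleton) auto
        have "{f \<in> space (Pi\<^sub>M {0..} (\<lambda>_. borel)). f h = (0::real)} \<in> sets (Pi\<^sub>M {0..} (\<lambda>_. borel))"
          by measurable
        moreover have "Z0 h = (\<lambda>\<omega>. \<lambda>t\<in>{0..}. X t \<omega>) -` {f \<in> space (Pi\<^sub>M {0..} (\<lambda>_. borel)). f h = (0::real)} \<inter> space M"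
          using that by (auto simp: Z0_def space_PiM)
        ultimately show "Z0 h \<in> {(\<lambda>\<omega>. \<lambda>t\<in>{0..}. X t \<omega>) -` B \<inter> space M | B. B \<in> sets (Pi\<^sub>M {0..} (\<lambda>_. borel))}"
          by blast
      qed
      moreover have "prob (A \<inter> Z0 h) = 0"
      proof (rule prob_zero[OF that])
        show "AE \<omega> in M. \<omega> \<in> A \<inter> Z0 h \<longrightarrow> S h \<omega> = 0"
          using eq by eventually_elim (use that in \<open>auto simp: A_def Z0_def zero_ereal_def\<close>)
        show "AE \<omega> in M. 0 \<le> S h \<omega>"
          using eq X_nonneg by eventually_elim (use that in auto)
        show "A \<inter> Z0 h \<in> events"
          using Z0[of h] that measurable_sets[OF \<open>\<zeta> \<in> borel_measurable M\<close>, of "{h<..}"]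
          by (auto simp: A_def)
      qed
      ultimately show ?thesis by simp
    qed
    with eq show ?thesis
      by (intro that[of "\<lambda>\<omega>. ereal (\<zeta> \<omega>)"]) auto
  qed
  have S_nonneg: "AE \<omega> in M. 0 \<le> S t \<omega>" if "t \<ge> 0" for t
    using S_eq X_nonneg by eventually_elim (use that in auto)
  \<comment> \<open>By stationarity the increment over [p, q] has the law of
    \<open>X (q - p)\<close>, which has no atom at 0.\<close>
  have increment: "AE \<omega> in M. X p \<omega> \<noteq> X q \<omega>" if "0 \<le> p" "p < q" for p q
  proof -
    have [measurable]: "X p \<in> borel_measurable M" "X q \<in> borel_measurable M" "X (q - p) \<in> borel_measurable M"
      using that by (auto intro: X_meas)
    have "prob {\<omega> \<in> space M. X q \<omega> - X p \<omega> = 0} = measure (distr M borel (\<lambda>\<omega>. X (p + (q - p)) \<omega> - X p \<omega>)) {0}"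
      using that by (subst measure_distr) (auto intro!: arg_cong[where f = prob])
    also have "\<dots> = measure (distr M borel (X (q - p))) {0}"
      using that by (subst X_stat) auto
    also have "\<dots> = prob (Z0 (q - p))"
      unfolding Z0_def by (subst measure_distr) (auto intro!: arg_cong[where f = prob])
    also have "\<dots> = 0"
      using that by (intro X_pos) simp
    finally have "prob {\<omega> \<in> space M. X q \<omega> - X p \<omega> = 0} = 0" .
    moreover have "{\<omega> \<in> space M. X q \<omega> - X p \<omega> = 0} \<in> events"
      by measurable
    ultimately have "AE \<omega> in M. \<omega> \<notin> {\<omega> \<in> space M. X q \<omega> - X p \<omega> = 0}"
      using prob_eq_0 by blast
    then show ?thesis
      using AE_space by eventually_elim auto
  qed
  have X_strict: "AE \<omega> in M. \<forall>p\<in>\<rat>. \<forall>q\<in>\<rat>. 0 \<le> p \<and> p < q \<longrightarrow> X p \<omega> \<noteq> X q \<omega>"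
    unfolding AE_ball_countable[OF countable_rat]
  proof (intro ballI)
    fix p q :: real
    show "AE \<omega> in M. 0 \<le> p \<and> p < q \<longrightarrow> X p \<omega> \<noteq> X q \<omega>"
      using increment[of p q] by (cases "0 \<le> p \<and> p < q") (auto elim: eventually_mono)
  qed
  have S_unbounded: "AE \<omega> in M. \<exists>k :: nat. ereal (real n) < S (real k) \<omega>" for n :: nat
  proof -
    obtain \<theta> where \<theta>: "\<theta> > 0" "laplace_exponent a b \<nu> \<theta> > 0"
      using exponent_pos by blast
    define A where "A k = {\<omega> \<in> space M. S (real k) \<omega> \<le> ereal (real n)}" for k :: nat
    have A: "A k \<in> events" for k
      using S_meas[of "real k"] unfolding A_def by measurable
    \<comment> \<open>A path that stays below n lies in every \<open>A k\<close>, and a positive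
      exponent makes the bound tend to 0 in k.\<close>
    have "prob (\<Inter>k. A k) \<le> exp (\<theta> * real n) * exp (- real k * laplace_exponent a b \<nu> \<theta>)" for k
    proof -
      have "prob (\<Inter>k. A k) \<le> prob (A k)"
        using A by (intro finite_measure_mono) auto
      also have "\<dots> \<le> exp (\<theta> * real n) * exp (- real k * laplace_exponent a b \<nu> \<theta>)"
      proof (rule prob_le[OF _ \<theta>(1) A _ S_nonneg])
        have "s \<noteq> \<infinity> \<and> real_of_ereal s \<le> real n" if "s \<le> ereal (real n)" for s
          using that by (cases s) auto
        then show "AE \<omega> in M. \<omega> \<in> A k \<longrightarrow> S (real k) \<omega> \<noteq> \<infinity> \<and> real_of_ereal (S (real k) \<omega>) \<le> real n"
          by (auto simp: A_def)
      qed auto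
      finally show ?thesis .
    qed
    moreover have "(\<lambda>k. exp (\<theta> * real n) * exp (- real k * laplace_exponent a b \<nu> \<theta>)) \<longlonglongrightarrow> 0"
    proof -
      have "filterlim (\<lambda>k. - real k * laplace_exponent a b \<nu> \<theta>) at_bot sequentially"
        using \<theta>(2) by real_asymp
      from tendsto_mult_left[OF filterlim_compose[OF exp_at_bot this], of "exp (\<theta> * real n)"]
      show ?thesis by simp
    qed
    ultimately have "prob (\<Inter>k. A k) \<le> 0"
      by (meson LIMSEQ_le_const)
    then have "prob (\<Inter>k. A k) = 0"
      by (simp add: antisym)
    moreover have "(\<Inter>k. A k) \<in> events"
      using A by blast
    ultimately have "AE \<omega> in M. \<omega> \<notin> (\<Inter>k. A k)"
      using prob_eq_0 by blast
    then show ?thesis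
      using AE_space by eventually_elim (auto simp: A_def not_le)
  qed
  then have "AE \<omega> in M. \<forall>n :: nat. \<exists>k :: nat. ereal (real n) < S (real k) \<omega>"
    by (simp add: AE_all_countable)
  with S_eq X_zero X_right X_mono X_strict show ?thesis
  proof eventually_elim
    case (elim \<omega>)
    then show ?case
      by (intro good_path_killed[of "\<lambda>t. X t \<omega>" _ "\<zeta> \<omega>"]) auto
  qed
qed

text \<open>Altering the paths on a null set leaves the laws unchanged and gives regularity at every
  sample point, so the later arguments run path by path.\<close>

theorem subordinator_inverse:
  obtains L :: "real \<Rightarrow> 'w \<Rightarrow> real" where
    "\<And>\<omega>. continuous_on UNIV (\<lambda>t. L t \<omega>)"
    "\<And>t t' \<omega>. t \<le> t' \<Longrightarrow> L t \<omega> \<le> L t' \<omega>"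
    "\<And>t \<omega>. 0 \<le> L t \<omega>"
    "\<And>\<omega>. L 0 \<omega> = 0"
    "(\<lambda>(t, \<omega>). L t \<omega>) \<in> borel_measurable (borel \<Otimes>\<^sub>M M)"
    "\<And>t. t \<ge> 0 \<Longrightarrow> inverse_law M S t = distr M borel (L t)"
    "\<And>r lam. 0 \<le> r \<Longrightarrow> 0 < lam \<Longrightarrow>
      (\<integral>\<^sup>+\<omega>. \<integral>\<^sup>+t. ennreal (exponential_density lam t) * indicator {r<..} (L t \<omega>) \<partial>lborel \<partial>M)
        = ennreal (exp (- r * laplace_exponent a b \<nu> lam))"
proof -
  obtain N where N: "N \<in> null_sets M" "\<And>\<omega>. \<omega> \<in> space M - N \<Longrightarrow> good_path (\<lambda>s. S s \<omega>)"
    using subordinator_good_paths by (auto elim!: AE_E3)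
  \<comment> \<open>On N the path is the identity, a good path whose inverse is continuous as
    well.\<close>
  define Z where "Z s \<omega> = (if \<omega> \<in> space M - N then S s \<omega> else ereal s)" for s \<omega>
  define L where "L t \<omega> = path_inverse (\<lambda>s. Z s \<omega>) t" for t \<omega>
  have good: "good_path (\<lambda>s. Z s \<omega>)" for \<omega>
  proof (cases "\<omega> \<in> space M - N")
    case True
    then have "(\<lambda>s. Z s \<omega>) = (\<lambda>s. S s \<omega>)"
      by (simp add: Z_def)
    then show ?thesis
      using N(2)[OF True] by simp
  next
    case False
    then have "(\<lambda>s. Z s \<omega>) = ereal"
      by (auto simp: Z_def)
    then show ?thesis
      using good_path_ereal by simp
  qed
  have Z_meas: "Z s \<in> borel_measurable M" if "s \<ge> 0" for s
    unfolding Z_def using S_meas[OF that] null_setsD2[OF N(1)] by measurable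
  have Z_AE: "AE \<omega> in M. \<forall>s. Z s \<omega> = S s \<omega>"
    using AE_not_in[OF N(1)] AE_space by eventually_elim (simp add: Z_def)
  have "(\<lambda>(t, \<omega>). L t \<omega>) \<in> borel_measurable (borel \<Otimes>\<^sub>M M)"
  proof (rule borel_measurableI_less)
    fix r
    have "{p \<in> space (borel \<Otimes>\<^sub>M M). (case p of (t, \<omega>) \<Rightarrow> L t \<omega>) < r}
        = (\<Union>q\<in>\<rat> \<inter> {0..<r}. {p \<in> space (borel \<Otimes>\<^sub>M M). ereal (fst p) < Z q (snd p)})"
    proof -
      have "L t \<omega> < r \<longleftrightarrow> (\<exists>q\<in>\<rat> \<inter> {0..<r}. ereal t < Z q \<omega>)" for t \<omega>
        unfolding L_def path_inverse_less_iff[OF good] by auto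
      then show ?thesis by (auto split: prod.splits)
    qed
    also have "\<dots> \<in> sets (borel \<Otimes>\<^sub>M M)"
    proof (rule sets.countable_UN'')
      show "countable (\<rat> \<inter> {0..<r})"
        using countable_rat by (rule countable_Int1)
      fix q assume "q \<in> \<rat> \<inter> {0..<r}"
      then have [measurable]: "Z q \<in> borel_measurable M"
        by (intro Z_meas) auto
      show "{p \<in> space (borel \<Otimes>\<^sub>M M). ereal (fst p) < Z q (snd p)} \<in> sets (borel \<Otimes>\<^sub>M M)"
        by measurable
    qed
    finally show "{p \<in> space (borel \<Otimes>\<^sub>M M). (case p of (t, \<omega>) \<Rightarrow> L t \<omega>) < r} \<in> sets (borel \<Otimes>\<^sub>M M)" .
  qed
  note L_joint = this
  have L_meas: "L t \<in> borel_measurable M" for t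
  proof -
    have "(\<lambda>\<omega>. case (t, \<omega>) of (t, \<omega>) \<Rightarrow> L t \<omega>) \<in> borel_measurable M"
      by (rule measurable_compose[OF measurable_Pair1' L_joint]) simp
    then show ?thesis by simp
  qed
  have inv_eq: "inverse_process S t \<omega> = L t \<omega>" if "\<omega> \<in> space M - N" for t \<omega>
    using that by (simp add: inverse_process_def L_def path_inverse_def Z_def)
  have law: "inverse_law M S t = distr M borel (L t)" for t
  proof -
    \<comment> \<open>Off N the process agrees with the measurable \<open>L t\<close>, and every
      subset of N is measurable for the completion.\<close>
    have meas: "inverse_process S t \<in> borel_measurable (completion M)"
    proof (rule measurableI)
      fix A :: "real set" assume "A \<in> sets borel"
      have "inverse_process S t -` A \<inter> space (completion M)
          = ((L t -` A \<inter> space M) - N) \<union> (inverse_process S t -` A \<inter> space M \<inter> N)"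
        using inv_eq by auto
      moreover have "(L t -` A \<inter> space M) - N \<in> sets (completion M)"
        using measurable_sets[OF L_meas \<open>A \<in> sets borel\<close>] null_setsD2[OF N(1)]
        by (intro sets_completionI_sets) auto
      moreover have "inverse_process S t -` A \<inter> space M \<inter> N \<in> sets (completion M)"
        using N(1) by (rule sets_completionI_sub) auto
      ultimately show "inverse_process S t -` A \<inter> space (completion M) \<in> sets (completion M)"
        by (metis sets.Un)
    qed simp
    have "inverse_law M S t = distr (completion M) borel (L t)"
      unfolding inverse_law_def
    proof (rule distr_cong_AE[OF refl refl _ meas])
      show "L t \<in> borel_measurable (completion M)"
        using L_meas by (rule measurable_completion)
      have "AE \<omega> in M. inverse_process S t \<omega> = L t \<omega>"
        using AE_not_in[OF N(1)] AE_space by eventually_elim (simp add: inv_eq)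
      then show "AE \<omega> in completion M. inverse_process S t \<omega> = L t \<omega>"
        by (rule AE_completion)
    qed
    also have "\<dots> = distr M borel (L t)"
      by (rule measure_eqI)
        (auto simp: emeasure_distr L_meas measurable_completion measurable_sets[OF L_meas])
    finally show ?thesis .
  qed
  have "(\<integral>\<^sup>+\<omega>. \<integral>\<^sup>+t. ennreal (exponential_density lam t) * indicator {r<..} (L t \<omega>) \<partial>lborel \<partial>M)
        = ennreal (exp (- r * laplace_exponent a b \<nu> lam))" if r: "0 \<le> r" and lam: "0 < lam" for r lam
  proof -
    \<comment> \<open>For a fixed path the inner integral is the probability that the exponential
      time exceeds S r, namely \<open>?h\<close>; its mean is the Laplace transform of S r.\<close>
    let ?h = "\<lambda>\<omega>. if S r \<omega> = \<infinity> then 0 else exp (- lam * real_of_ereal (S r \<omega>))"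
    have [measurable]: "S r \<in> borel_measurable M"
      using S_meas[OF r] .
    have nonneg: "AE \<omega> in M. 0 \<le> S r \<omega>"
      using subordinator_good_paths by eventually_elim (use r in \<open>auto simp: good_path_def\<close>)
    have int: "integrable M ?h"
    proof (rule integrable_const_bound[where B = 1])
      show "AE \<omega> in M. norm (?h \<omega>) \<le> 1"
        using nonneg by eventually_elim (use lam in \<open>auto simp: real_of_ereal_pos\<close>)
    qed measurable
    have "(\<integral>\<^sup>+\<omega>. \<integral>\<^sup>+t. ennreal (exponential_density lam t) * indicator {r<..} (L t \<omega>) \<partial>lborel \<partial>M)
        = (\<integral>\<^sup>+\<omega>. ennreal (if Z r \<omega> = \<infinity> then 0 else exp (- lam * real_of_ereal (Z r \<omega>))) \<partial>M)"
      unfolding L_def using path_inverse_laplace[OF good r lam] by simp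
    also have "\<dots> = (\<integral>\<^sup>+\<omega>. ennreal (?h \<omega>) \<partial>M)"
      using Z_AE by (intro nn_integral_cong_AE) (auto elim: eventually_mono)
    also have "\<dots> = ennreal (\<integral>\<omega>. ?h \<omega> \<partial>M)"
      using int by (intro nn_integral_eq_integral) auto
    finally show ?thesis
      using laplace_S[OF r, of lam] lam by simp
  qed
  then show ?thesis
    using path_inverse_isCont[OF good] path_inverse_mono[OF good] path_inverse_nonneg[OF good]
      path_inverse_zero[OF good] L_joint law
    by (intro that[of L]) (auto simp: L_def)
qed

end

section \<open>The inverse at an exponential time\<close>

text \<open>The exponential density lives on x \<ge> 0 and \<open>laplace\<close> integrates over x
  > 0; the point 0 between them is null.\<close>

lemma
  fixes h :: "real \<Rightarrow> real"
  assumes h [measurable]: "h \<in> borel_measurable borel" and m: "0 < m"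
  shows integral_exponential_density:
      "(\<integral>x. h x \<partial>density lborel (exponential_density m)) = m * laplace h m" (is ?int)
    and integrable_exponential_density:
      "exp_order c h \<Longrightarrow> c < m \<Longrightarrow> integrable (density lborel (exponential_density m)) h" (is "_ \<Longrightarrow> _ \<Longrightarrow> ?integrable")
proof -
  have ae: "AE x in lborel. exponential_density m x *\<^sub>R h x
      = m * (indicator {0<..} x *\<^sub>R (exp (- m * x) * h x))"
    using AE_lborel_singleton[of 0]
    by eventually_elim (auto simp: exponential_density_def indicator_def mult.commute)
  have nn: "AE x in lborel. 0 \<le> exponential_density m x"
    using m by (auto intro!: always_eventually exponential_density_nonneg)
  show ?int
  proof -
    have "(\<integral>x. h x \<partial>density lborel (exponential_density m)) = (\<integral>x. exponential_density m x *\<^sub>R h x \<partial>lborel)"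
      using h nn by (intro integral_density) auto
    also have "\<dots> = (\<integral>x. m * (indicator {0<..} x *\<^sub>R (exp (- m * x) * h x)) \<partial>lborel)"
      using h ae by (intro integral_cong_AE) measurable
    finally show ?thesis
      by (simp only: laplace_def set_lebesgue_integral_def integral_mult_right_zero)
  qed
  show ?integrable if "exp_order c h" "c < m"
  proof -
    have "integrable lborel (\<lambda>x. m * (indicator {0<..} x *\<^sub>R (exp (- m * x) * h x)))"
      using laplace_integrable[OF that] unfolding set_integrable_def by (rule integrable_mult_right)
    then have "integrable lborel (\<lambda>x. exponential_density m x *\<^sub>R h x)"
    proof (rule integrable_cong_AE_imp)
      show "AE x in lborel. m * (indicator {0<..} x *\<^sub>R (exp (- m * x) * h x)) = exponential_density m x *\<^sub>R h x"
        using ae by eventually_elim (rule sym)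
    qed measurable
    then show ?thesis
      using h nn by (subst integrable_density) auto
  qed
qed

context
  fixes M :: "'w measure" and L :: "real \<Rightarrow> 'w \<Rightarrow> real" and lam phi :: real
  assumes prob: "prob_space M"
    and L_joint: "(\<lambda>(t, \<omega>). L t \<omega>) \<in> borel_measurable (borel \<Otimes>\<^sub>M M)"
    and L_nonneg: "\<And>t \<omega>. 0 \<le> L t \<omega>"
    and L_mono: "\<And>t t' \<omega>. t \<le> t' \<Longrightarrow> L t \<omega> \<le> L t' \<omega>"
    and lam: "0 < lam" and phi: "0 < phi"
    and L_tail: "\<And>r. 0 \<le> r \<Longrightarrow>
      (\<integral>\<^sup>+\<omega>. \<integral>\<^sup>+t. ennreal (exponential_density lam t) * indicator {r<..} (L t \<omega>) \<partial>lborel \<partial>M)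
        = ennreal (exp (- r * phi))"
begin

interpretation prob_space M by (rule prob)

interpretation T: prob_space "density lborel (exponential_density lam)"
  using lam by (rule prob_space_exponential_density)

interpretation TM: pair_prob_space "density lborel (exponential_density lam)" M ..

private lemma L_pair:
  "(\<lambda>p. L (fst p) (snd p)) \<in> borel_measurable (borel \<Otimes>\<^sub>M M)"
  using L_joint by (simp add: case_prod_beta)

private lemma L_pair_density:
  "(\<lambda>p. L (fst p) (snd p)) \<in> borel_measurable (density lborel (exponential_density lam) \<Otimes>\<^sub>M M)"
  using L_pair by (simp cong: measurable_cong_sets sets_pair_measure_cong)

private lemma L_meas: "L t \<in> borel_measurable M"
  using measurable_compose[OF measurable_Pair1'[of t borel M] L_pair] by simp

private lemma L_meas_fst: "(\<lambda>t. L t \<omega>) \<in> borel_measurable borel" if "\<omega> \<in> space M" for \<omega>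
  using measurable_compose[OF measurable_Pair2'[OF that, of borel] L_pair] by simp

context
  notes L_pair [measurable] L_pair_density [measurable] L_meas [measurable]
begin

text \<open>The two laws are compared on the half-lines \<open>{r<..}\<close>: for r \<ge> 0 Fubini
  reduces the tail to \<open>L_tail\<close>, and for r < 0 both carry full mass there.\<close>

theorem law_at_exponential_time:
  "distr (density lborel (exponential_density lam) \<Otimes>\<^sub>M M) borel (\<lambda>p. L (fst p) (snd p))
    = density lborel (exponential_density phi)" (is "?D = ?E")
proof (rule measure_eqI_lessThan)
  interpret E: prob_space ?E
    using phi by (rule prob_space_exponential_density)
  interpret D: prob_space ?D
    by (rule TM.prob_space_distr) measurable
  show "sets ?D = sets borel" "sets ?E = sets borel" by simp_all
  show "emeasure ?D {r<..} < \<infinity>" for r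
    by (simp add: D.emeasure_eq_measure)
  fix r
  show "emeasure ?D {r<..} = emeasure ?E {r<..}"
  proof (cases "0 \<le> r")
    case True
    have "emeasure ?D {r<..} = (\<integral>\<^sup>+p. indicator {r<..} (L (fst p) (snd p)) \<partial>(density lborel (exponential_density lam) \<Otimes>\<^sub>M M))"
    proof -
      have "emeasure ?D {r<..} = (\<integral>\<^sup>+x. indicator {r<..} x \<partial>?D)"
        by simp
      also have "\<dots> = (\<integral>\<^sup>+p. indicator {r<..} (L (fst p) (snd p)) \<partial>(density lborel (exponential_density lam) \<Otimes>\<^sub>M M))"
        by (rule nn_integral_distr) measurable
      finally show ?thesis .
    qed
    also have "\<dots> = (\<integral>\<^sup>+\<omega>. \<integral>\<^sup>+t. indicator {r<..} (L t \<omega>) \<partial>density lborel (exponential_density lam) \<partial>M)"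
      by (subst TM.nn_integral_snd[symmetric]) simp_all
    also have "\<dots> = (\<integral>\<^sup>+\<omega>. \<integral>\<^sup>+t. ennreal (exponential_density lam t) * indicator {r<..} (L t \<omega>) \<partial>lborel \<partial>M)"
    proof (rule nn_integral_cong)
      fix \<omega> assume "\<omega> \<in> space M"
      from L_meas_fst[OF this] have [measurable]: "(\<lambda>t. L t \<omega>) \<in> borel_measurable borel" .
      show "(\<integral>\<^sup>+t. indicator {r<..} (L t \<omega>) \<partial>density lborel (exponential_density lam))
          = (\<integral>\<^sup>+t. ennreal (exponential_density lam t) * indicator {r<..} (L t \<omega>) \<partial>lborel)"
        by (subst nn_integral_density) auto
    qed
    also have "\<dots> = ennreal (exp (- r * phi))"
      using True by (rule L_tail)
    finally have 1: "emeasure ?D {r<..} = ennreal (exp (- r * phi))" .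
    have "distributed ?E lborel (\<lambda>x. x) (exponential_density phi)"
      by (auto simp: distributed_def distr_id2)
    from E.exponential_distributedD_gt[OF this True phi]
    have "measure ?E {r<..} = exp (- r * phi)"
      by (simp add: greaterThan_def)
    then show ?thesis
      using 1 by (simp add: E.emeasure_eq_measure)
  next
    case False
    have "AE x in ?E. x \<in> {r<..}"
      using False by (subst AE_density) (auto simp: exponential_density_def)
    then have "measure ?E {r<..} = 1"
      by (subst E.prob_eq_1) auto
    moreover have "AE x in ?D. x \<in> {r<..}"
      using False L_nonneg by (subst AE_distr_iff) (auto intro!: always_eventually intro: less_le_trans[of r 0])
    then have "measure ?D {r<..} = 1"
      by (subst D.prob_eq_1) auto
    ultimately show ?thesis
      by (simp add: E.emeasure_eq_measure D.emeasure_eq_measure)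
  qed
qed

text \<open>The mean of g(L) at the exponential time is computed twice: through its exponential law
  of rate \<open>phi\<close>, and by integrating first over the sample space and then over time. The
  normalizing rates of the two densities give the factor.\<close>

lemma laplace_time_change:
  assumes g: "exp_order c g" and c: "c < phi"
  shows "laplace (\<lambda>t. \<integral>\<omega>. g (L t \<omega>) \<partial>M) lam = phi / lam * laplace g phi"
proof -
  \<comment> \<open>Extends \<open>g\<close> to a function measurable on the line without changing
    it at the values of L.\<close>
  define h where "h x = g (max 0 x)" for x
  have h_cont: "continuous_on UNIV h"
    using g unfolding h_def exp_order_def
    by (auto intro!: continuous_on_compose2[where g = g and t = "{0..}"] continuous_intros)
  then have [measurable]: "h \<in> borel_measurable borel"
    by (rule borel_measurable_continuous_onI)
  have hL: "h (L t \<omega>) = g (L t \<omega>)" for t \<omega>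
    using L_nonneg[of t \<omega>] by (simp add: h_def)
  have ho: "exp_order c h"
  proof -
    have "continuous_on {0..} h"
      using h_cont by (rule continuous_on_subset) simp
    then show ?thesis
      using g by (simp add: exp_order_def h_def)
  qed
  have "laplace h phi = laplace g phi"
    unfolding laplace_def by (rule set_lebesgue_integral_cong) (auto simp: h_def)
  then have "phi * laplace g phi = (\<integral>x. h x \<partial>density lborel (exponential_density phi))"
    using phi by (simp add: integral_exponential_density)
  also have "\<dots> = (\<integral>p. h (L (fst p) (snd p)) \<partial>(density lborel (exponential_density lam) \<Otimes>\<^sub>M M))"
    unfolding law_at_exponential_time[symmetric] by (rule integral_distr) measurable
  also have "\<dots> = (\<integral>t. \<integral>\<omega>. h (L t \<omega>) \<partial>M \<partial>density lborel (exponential_density lam))"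
  proof -
    have "integrable (density lborel (exponential_density phi)) h"
      using ho c phi by (intro integrable_exponential_density) auto
    from integrable_distr[OF L_pair_density this[folded law_at_exponential_time]]
    have "integrable (density lborel (exponential_density lam) \<Otimes>\<^sub>M M) (\<lambda>p. h (L (fst p) (snd p)))" .
    from TM.integral_fst'[OF this] show ?thesis by simp
  qed
  also have "\<dots> = lam * laplace (\<lambda>t. \<integral>\<omega>. g (L t \<omega>) \<partial>M) lam"
    unfolding hL[symmetric] by (rule integral_exponential_density[OF _ lam]) measurable
  finally show ?thesis
    using lam by (simp add: field_simps)
qed

text \<open>The moment is nondecreasing in t, so its value at t times the probability exp(-lam t) of
  a later exponential time is at most the mean at that time, which is finite because c <
  phi.\<close>

lemma exp_moment_bound:
  assumes "0 \<le> c" "c < phi" "0 \<le> t"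
  shows "(\<integral>\<^sup>+\<omega>. ennreal (exp (c * L t \<omega>)) \<partial>M) \<le> ennreal (exp (lam * t) * (phi * laplace (\<lambda>x. exp (c * x)) phi))"
proof -
  let ?E = "\<integral>\<^sup>+\<omega>. ennreal (exp (c * L t \<omega>)) \<partial>M"
  interpret E: prob_space "density lborel (exponential_density phi)"
    using phi by (rule prob_space_exponential_density)
  have eo: "exp_order c (\<lambda>x. exp (c * x))"
    by (auto simp: exp_order_def intro!: continuous_intros exI[of _ 1])
  have "distributed (density lborel (exponential_density lam)) lborel (\<lambda>x. x) (exponential_density lam)"
    by (auto simp: distributed_def distr_id2)
  from T.exponential_distributedD_gt[OF this assms(3) lam]
  have tail: "emeasure (density lborel (exponential_density lam)) {t<..} = ennreal (exp (- t * lam))"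
    by (simp add: greaterThan_def T.emeasure_eq_measure)
  have "?E * ennreal (exp (- t * lam))
      = (\<integral>\<^sup>+s. ?E * indicator {t<..} s \<partial>density lborel (exponential_density lam))"
    by (simp add: nn_integral_cmult_indicator tail)
  also have "\<dots> \<le> (\<integral>\<^sup>+s. \<integral>\<^sup>+\<omega>. ennreal (exp (c * L s \<omega>)) \<partial>M \<partial>density lborel (exponential_density lam))"
  proof (rule nn_integral_mono)
    fix s
    have "?E \<le> (\<integral>\<^sup>+\<omega>. ennreal (exp (c * L s \<omega>)) \<partial>M)" if "t < s"
      using L_mono[of t s] that \<open>0 \<le> c\<close> by (intro nn_integral_mono ennreal_leI) (auto intro: mult_left_mono)
    then show "?E * indicator {t<..} s \<le> (\<integral>\<^sup>+\<omega>. ennreal (exp (c * L s \<omega>)) \<partial>M)"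
      by (auto simp: indicator_def)
  qed
  also have "\<dots> = (\<integral>\<^sup>+p. ennreal (exp (c * L (fst p) (snd p))) \<partial>(density lborel (exponential_density lam) \<Otimes>\<^sub>M M))"
    by (subst nn_integral_fst[symmetric]) simp_all
  also have "\<dots> = (\<integral>\<^sup>+x. ennreal (exp (c * x)) \<partial>density lborel (exponential_density phi))"
    unfolding law_at_exponential_time[symmetric] by (subst nn_integral_distr) simp_all
  also have "\<dots> = ennreal (phi * laplace (\<lambda>x. exp (c * x)) phi)"
  proof (subst nn_integral_eq_integral)
    show "integrable (density lborel (exponential_density phi)) (\<lambda>x. exp (c * x))"
      using eo phi \<open>c < phi\<close> by (intro integrable_exponential_density) measurable
    show "ennreal (\<integral>x. exp (c * x) \<partial>density lborel (exponential_density phi))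
        = ennreal (phi * laplace (\<lambda>x. exp (c * x)) phi)"
      using phi by (subst integral_exponential_density) simp_all
  qed simp
  finally have "?E * ennreal (exp (- t * lam)) \<le> ennreal (phi * laplace (\<lambda>x. exp (c * x)) phi)" .
  then have "ennreal (exp (lam * t)) * (?E * ennreal (exp (- t * lam)))
      \<le> ennreal (exp (lam * t)) * ennreal (phi * laplace (\<lambda>x. exp (c * x)) phi)"
    by (rule mult_left_mono) simp
  moreover have "ennreal (exp (lam * t)) * (?E * ennreal (exp (- t * lam))) = ?E"
  proof -
    have "ennreal (exp (lam * t)) * ennreal (exp (- t * lam)) = 1"
      by (simp add: ennreal_mult[symmetric] exp_add[symmetric] mult.commute)
    then show ?thesis
      by (metis mult.commute mult.left_commute mult.right_neutral)
  qed
  ultimately show ?thesis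
    by (simp add: ennreal_mult')
qed

end

end

section \<open>The time-changed semigroup\<close>

lemma exp_order_functional:
  fixes f :: "real \<Rightarrow> 'b::real_normed_vector"
  assumes l: "bounded_linear l" and f: "continuous_on {0..} f"
    and bound: "\<And>t. t \<ge> 0 \<Longrightarrow> norm (f t) \<le> C * exp (c * t)"
  shows "exp_order c (\<lambda>t. l (f t))"
proof -
  obtain B where B: "B \<ge> 0" "\<And>v. norm (l v) \<le> norm v * B"
    using bounded_linear.nonneg_bounded[OF l] by blast
  have "\<bar>l (f t)\<bar> \<le> (B * C) * exp (c * t)" if "t \<ge> 0" for t
  proof -
    have "\<bar>l (f t)\<bar> \<le> norm (f t) * B"
      using B(2) by simp
    also have "\<dots> \<le> (C * exp (c * t)) * B"
      using bound[OF that] B(1) by (rule mult_right_mono)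
    finally show ?thesis by (simp only: mult_ac)
  qed
  then show ?thesis
    using bounded_linear.continuous_on[OF l f] by (auto simp: exp_order_def)
qed

lemma norm_diff_initial_le:
  fixes q :: "real \<Rightarrow> 'b::real_normed_vector"
  assumes C: "C > 0" and c: "c > 0" and q: "\<And>t. t \<ge> 0 \<Longrightarrow> norm (q t) \<le> C * exp (c * t)" and t: "t \<ge> 0"
  shows "norm (q t - q 0) \<le> (2 * C) * exp (c * t)"
proof -
  have "norm (q t - q 0) \<le> norm (q t) + norm (q 0)"
    by (rule norm_triangle_ineq4)
  moreover have "C * 1 \<le> C * exp (c * t)"
    using C c t by (intro mult_left_mono) auto
  ultimately show ?thesis
    using q[OF t] q[of 0] by simp
qed

lemma regular_on_cong_subset:
  assumes "regular_on lam0 T h" "T' \<subseteq> T" "\<And>t. t \<in> T' \<Longrightarrow> h' t = h t"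
  shows "regular_on lam0 T' h'"
proof -
  have "continuous_on T' h'"
    using assms by (subst continuous_on_cong[OF refl assms(3)]) (auto simp: regular_on_def intro: continuous_on_subset)
  moreover have "exponentially_bounded_on T' h'"
    using assms unfolding regular_on_def exponentially_bounded_on_def by (metis subsetD)
  moreover have "bounded (h' ` T')" if "lam0 = 0"
  proof (rule bounded_subset)
    show "bounded (h ` T)"
      using assms(1) that by (simp add: regular_on_def)
    show "h' ` T' \<subseteq> h ` T"
      using assms(2,3) by auto
  qed
  ultimately show ?thesis
    by (simp add: regular_on_def)
qed

section \<open>The integral operator behind the generalized derivative\<close>

context
  fixes a b :: real and \<nu> :: "real measure" and f :: "real \<Rightarrow> 'b::banach" and C c :: real
  assumes triplet: "subordinator_triplet a b \<nu>"
    and f_cont: "continuous_on {0..} f" and f_zero: "f 0 = 0"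
    and c: "c > 0" and f_bound: "\<And>t. t \<ge> 0 \<Longrightarrow> norm (f t) \<le> C * exp (c * t)"
begin

private lemma extension_continuous: "continuous_on UNIV (\<lambda>s. f (max 0 s))"
  by (rule continuous_on_compose2[OF f_cont]) (auto intro!: continuous_intros)

private lemma extension_zero: "s \<le> 0 \<Longrightarrow> f (max 0 s) = 0"
  using f_zero by (simp add: max_def)

text \<open>As f 0 = 0, the continuous extension s \<mapsto> f (max 0 s) vanishes on the negative
  half-line, and the results on convolutions over the line apply.\<close>

private lemma phi_integrand_kernel:
  "phi_integrand a \<nu> f t = (\<lambda>s. tail_kernel a \<nu> (t - s) *\<^sub>R f (max 0 s))"
proof
  fix s
  show "phi_integrand a \<nu> f t s = tail_kernel a \<nu> (t - s) *\<^sub>R f (max 0 s)"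
    using extension_zero[of s] by (cases "s \<le> 0") (simp_all add: phi_integrand_def tail_kernel_def indicator_def)
qed

private lemma extension_bound: "norm (f (max 0 s)) \<le> C * exp (c * s)"
proof (cases "s \<le> 0")
  case True
  have "0 \<le> C"
    using order_trans[OF norm_ge_zero f_bound[of 0]] by simp
  then show ?thesis
    using extension_zero[OF True] by simp
next
  case False
  then show ?thesis
    using f_bound[of s] by simp
qed

private lemmas kernel = tail_kernel_measurable[OF triplet] tail_kernel_nonneg[OF triplet]
  tail_kernel_zero[OF triplet] tail_kernel_integrable[OF triplet c]

lemma phi_integrand_integrable: "bochner_integrable lborel (phi_integrand a \<nu> f t)"
  unfolding phi_integrand_kernel
proof (rule bochner_integrable_scaleR_continuous)
  show "(\<lambda>s. tail_kernel a \<nu> (t - s)) \<in> borel_measurable borel"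
    using kernel(1) by measurable
  show "integrable lborel (\<lambda>s. tail_kernel a \<nu> (t - s) * norm (f (max 0 s)))"
    using extension_continuous extension_zero extension_bound c
    by (intro convolution_integrable(2)[OF kernel, where C = C]) (auto intro!: continuous_intros)
qed (auto intro: extension_continuous)

context
  fixes l :: "'b \<Rightarrow> real"
  assumes l: "bounded_linear l"
begin

private lemma functional_extension:
  obtains B where "continuous_on UNIV (\<lambda>s. l (f (max 0 s)))" "\<And>s. s \<le> 0 \<Longrightarrow> l (f (max 0 s)) = 0"
    "\<And>s. \<bar>l (f (max 0 s))\<bar> \<le> B * exp (c * s)"
proof -
  interpret l: bounded_linear l by (rule l)
  obtain B where B: "B \<ge> 0" "\<And>v. norm (l v) \<le> norm v * B"
    using l.nonneg_bounded by blast
  have "\<bar>l (f (max 0 s))\<bar> \<le> (C * B) * exp (c * s)" for s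
  proof -
    have "\<bar>l (f (max 0 s))\<bar> \<le> norm (f (max 0 s)) * B"
      using B(2) by simp
    also have "\<dots> \<le> (C * exp (c * s)) * B"
      using extension_bound B(1) by (rule mult_right_mono)
    finally show ?thesis by (simp only: mult_ac)
  qed
  then show ?thesis
    using l.continuous_on[OF extension_continuous] extension_zero l.zero by (intro that[of "C * B"]) auto
qed

lemma functional_phi_primitive:
  "l (phi_primitive a b \<nu> f t) = b * l (f t) + (\<integral>s. tail_kernel a \<nu> (t - s) * l (f (max 0 s)) \<partial>lborel)"
proof -
  interpret l: bounded_linear l by (rule l)
  show ?thesis
    using functional_bochner_integral[OF l phi_integrand_integrable, of t]
    by (simp add: phi_primitive_def l.add l.scaleR phi_integrand_kernel)
qed

lemma exp_order_phi_primitive: "exp_order c (\<lambda>t. l (phi_primitive a b \<nu> f t))"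
proof -
  obtain B where B: "continuous_on UNIV (\<lambda>s. l (f (max 0 s)))" "\<And>s. s \<le> 0 \<Longrightarrow> l (f (max 0 s)) = 0"
    "\<And>s. \<bar>l (f (max 0 s))\<bar> \<le> B * exp (c * s)"
    using functional_extension by blast
  have "exp_order c (\<lambda>t. l (f t))"
    using l f_cont f_bound by (rule exp_order_functional)
  moreover have "exp_order c (\<lambda>t. \<integral>s. tail_kernel a \<nu> (t - s) * l (f (max 0 s)) \<partial>lborel)"
    by (rule convolution_exp_order[OF kernel B less_imp_le[OF c]])
  ultimately show ?thesis
    unfolding functional_phi_primitive by (intro exp_order_add exp_order_cmult)
qed

text \<open>This is the boundary term when the equation is transformed.\<close>

lemma functional_phi_primitive_zero: "l (phi_primitive a b \<nu> f 0) = 0"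
proof -
  interpret l: bounded_linear l by (rule l)
  obtain B where B: "continuous_on UNIV (\<lambda>s. l (f (max 0 s)))" "\<And>s. s \<le> 0 \<Longrightarrow> l (f (max 0 s)) = 0"
    "\<And>s. \<bar>l (f (max 0 s))\<bar> \<le> B * exp (c * s)"
    using functional_extension by blast
  show ?thesis
    using convolution_zero[OF kernel B, of 0]
    by (simp add: functional_phi_primitive f_zero l.zero)
qed

lemma laplace_phi_primitive:
  assumes "c < lam"
  shows "laplace (\<lambda>t. l (phi_primitive a b \<nu> f t)) lam
    = laplace_exponent a b \<nu> lam / lam * laplace (\<lambda>t. l (f t)) lam"
proof -
  obtain B where B: "continuous_on UNIV (\<lambda>s. l (f (max 0 s)))" "\<And>s. s \<le> 0 \<Longrightarrow> l (f (max 0 s)) = 0"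
    "\<And>s. \<bar>l (f (max 0 s))\<bar> \<le> B * exp (c * s)"
    using functional_extension by blast
  have f: "exp_order c (\<lambda>t. b * l (f t))"
    using exp_order_functional[OF l f_cont f_bound] by (rule exp_order_cmult)
  have conv: "exp_order c (\<lambda>t. \<integral>s. tail_kernel a \<nu> (t - s) * l (f (max 0 s)) \<partial>lborel)"
    by (rule convolution_exp_order[OF kernel B less_imp_le[OF c]])
  have ext: "laplace (\<lambda>t. l (f (max 0 t))) lam = laplace (\<lambda>t. l (f t)) lam"
    unfolding laplace_def by (rule set_lebesgue_integral_cong) auto
  have "laplace (\<lambda>t. l (phi_primitive a b \<nu> f t)) lam
      = b * laplace (\<lambda>t. l (f t)) lam
        + (\<integral>s. exp (- lam * s) * tail_kernel a \<nu> s \<partial>lborel) * laplace (\<lambda>t. l (f t)) lam"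
    unfolding functional_phi_primitive laplace_add[OF f conv assms] laplace_cmult
    using laplace_convolution[OF kernel B less_imp_le[OF c] assms] by (simp add: ext)
  also have "\<dots> = (b + (\<integral>s. exp (- lam * s) * tail_kernel a \<nu> s \<partial>lborel)) * laplace (\<lambda>t. l (f t)) lam"
    by (simp only: distrib_right)
  finally show ?thesis
    using tail_kernel_laplace[OF triplet, of lam] c assms by simp
qed

end

end

section \<open>Transforms of solutions\<close>

context
  fixes M :: "'w measure" and S :: "real \<Rightarrow> 'w \<Rightarrow> ereal"
    and a b :: real and \<nu> :: "real measure"
    and P :: "real \<Rightarrow> 'b::banach \<Rightarrow>\<^sub>L 'b" and K lam0 :: real
  assumes sub: "killed_subordinator M S a b \<nu>"
    and inf: "b > 0 \<or> emeasure \<nu> {0<..} = \<infinity>"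
    and semigroup: "C0_semigroup P" and K: "K > 0" and lam0: "lam0 \<ge> 0"
    and growth: "\<And>t u. t \<ge> 0 \<Longrightarrow> norm (blinfun_apply (P t) u) \<le> K * exp (lam0 * t) * norm u"
begin

interpretation prob_space M
  using sub by (simp add: killed_subordinator_def)

private lemma levy_triplet: "subordinator_triplet a b \<nu>"
  using sub by (simp add: killed_subordinator_def)

private lemmas sg = semigroup K lam0 growth

text \<open>From \<open>lam1\<close> on, \<phi>(lam) exceeds the growth bound of the semigroup, so
  that the resolvent at \<phi>(lam) and the moment of exp(lam0 L) are available.\<close>

lemma laplace_exponent_large:
  obtains lam1 where "lam1 > 0" "\<And>lam. lam \<ge> lam1 \<Longrightarrow> lam0 < laplace_exponent a b \<nu> lam"
proof -
  have "\<forall>\<^sub>F lam in at_top. lam0 < laplace_exponent a b \<nu> lam"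
    using laplace_exponent_at_top[OF levy_triplet inf] by (simp add: filterlim_at_top_dense)
  then obtain N where N: "\<And>lam. lam \<ge> N \<Longrightarrow> lam0 < laplace_exponent a b \<nu> lam"
    by (auto simp: eventually_at_top_linorder)
  then show ?thesis
    by (intro that[of "max 1 N"]) auto
qed

text \<open>For \<open>mu = laplace_exponent a b \<nu> lam\<close>, the functional \<open>resolvent_functional P mu l\<close> turns the equation
  into an algebraic one in which the transform of \<open>resolvent_functional P mu l \<circ> q\<close> cancels.\<close>

lemma laplace_phi_solution:
  assumes q: "phi_solution a b \<nu> P lam0 u q" and l: "bounded_linear l"
  obtains c l0 where "exp_order c (\<lambda>t. l (q t))"
    "\<And>lam. lam \<ge> l0 \<Longrightarrow> laplace (\<lambda>t. l (q t)) lam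
      = laplace_exponent a b \<nu> lam / lam * resolvent_functional P (laplace_exponent a b \<nu> lam) l u"
proof -
  let ?G = "\<lambda>t. generator P (q t)"
  have q0: "q 0 = u" and dom: "\<And>t. t \<ge> 0 \<Longrightarrow> q t \<in> generator_dom P"
    and diff: "\<And>t. t > 0 \<Longrightarrow> phi_differentiable a b \<nu> (\<lambda>s. q s - q 0) t"
    and deriv: "\<And>t. t > 0 \<Longrightarrow> phi_derivative a b \<nu> (\<lambda>s. q s - q 0) t = ?G t"
    and rq: "regular_on lam0 {0..} q" and rG: "regular_on lam0 {0..} ?G"
    using q by (auto simp: phi_solution_def)
  obtain C1 c1 where 1: "C1 > 0" "c1 > 0" "\<And>t. t \<ge> 0 \<Longrightarrow> norm (q t) \<le> C1 * exp (c1 * t)"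
    using rq unfolding regular_on_def exponentially_bounded_on_def by auto
  obtain C2 c2 where 2: "C2 > 0" "c2 > 0" "\<And>t. t \<ge> 0 \<Longrightarrow> norm (?G t) \<le> C2 * exp (c2 * t)"
    using rG unfolding regular_on_def exponentially_bounded_on_def by auto
  have cq: "continuous_on {0..} q" and cG: "continuous_on {0..} ?G"
    using rq rG by (auto simp: regular_on_def)
  define c where "c = max c1 c2"
  have c: "c > 0"
    using 1 by (simp add: c_def)
  have bound: "C' * exp (c' * t) \<le> C' * exp (c * t)" if "C' > 0" "c' \<le> c" "t \<ge> 0" for C' c' t
    using that by (intro mult_left_mono) (auto intro: mult_right_mono)
  have bq: "norm (q t) \<le> C1 * exp (c * t)" and bG: "norm (?G t) \<le> C2 * exp (c * t)" if "t \<ge> 0" for t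
    using 1(3)[OF that] 2(3)[OF that] bound[OF 1(1), of c1 t] bound[OF 2(1), of c2 t] that
    by (auto simp: c_def)
  define f where "f s = q s - q 0" for s
  have f: "continuous_on {0..} f" "f 0 = 0"
    unfolding f_def by (auto intro!: continuous_intros cq)
  have bf: "norm (f t) \<le> (2 * C1) * exp (c * t)" if "t \<ge> 0" for t
    unfolding f_def by (rule norm_diff_initial_le[OF 1(1) c bq that])
  obtain lam1 where lam1: "lam1 > 0" "\<And>lam. lam \<ge> lam1 \<Longrightarrow> lam0 < laplace_exponent a b \<nu> lam"
    using laplace_exponent_large by blast
  have lq: "exp_order c (\<lambda>t. l' (q t))" if "bounded_linear l'" for l' :: "'b \<Rightarrow> real"
    by (rule exp_order_functional[OF that cq bq])
  have lG: "exp_order c (\<lambda>t. l' (?G t))" if "bounded_linear l'" for l' :: "'b \<Rightarrow> real"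
    by (rule exp_order_functional[OF that cG bG])
  have "laplace (\<lambda>t. l (q t)) lam
      = laplace_exponent a b \<nu> lam / lam * resolvent_functional P (laplace_exponent a b \<nu> lam) l u"
    if lam: "lam \<ge> max lam1 (c + 1)" for lam
  proof -
    define mu where "mu = laplace_exponent a b \<nu> lam"
    define r where "r = resolvent_functional P mu l"
    have mu: "lam0 < mu"
      using lam lam1(2)[of lam] by (simp add: mu_def)
    have lam': "c < lam" "0 < lam"
      using lam c by auto
    have r: "bounded_linear r"
      unfolding r_def by (rule resolvent_functional_bounded_linear[OF sg l mu])
    interpret r: bounded_linear r by (rule r)
    have "laplace (\<lambda>t. r (?G t)) lam
        = lam * laplace (\<lambda>t. r (phi_primitive a b \<nu> f t)) lam - r (phi_primitive a b \<nu> f 0)"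
    proof (rule laplace_derivative[OF _ lG[OF r] lam'(1)])
      show "exp_order c (\<lambda>t. r (phi_primitive a b \<nu> f t))"
        by (rule exp_order_phi_primitive[OF levy_triplet f c bf r])
      fix t :: real assume t: "t > 0"
      have "(phi_primitive a b \<nu> f has_vector_derivative ?G t) (at t)"
        using diff[OF t] deriv[OF t] unfolding f_def[symmetric] phi_differentiable_def phi_derivative_def
        by (metis vector_derivative_works)
      from r.has_vector_derivative[OF this]
      show "((\<lambda>t. r (phi_primitive a b \<nu> f t)) has_real_derivative r (?G t)) (at t)"
        by (simp add: has_real_derivative_iff_has_vector_derivative)
    qed
    also have "\<dots> = mu * laplace (\<lambda>t. r (f t)) lam"
      using lam'(2) laplace_phi_primitive[OF levy_triplet f c bf r lam'(1)]
        functional_phi_primitive_zero[OF levy_triplet f c bf r]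
      by (simp add: mu_def)
    also have "laplace (\<lambda>t. r (f t)) lam = laplace (\<lambda>t. r (q t)) lam - r u / lam"
    proof -
      have "laplace (\<lambda>t. r (q t) + - r u) lam = laplace (\<lambda>t. r (q t)) lam + laplace (\<lambda>t. - r u) lam"
        using c by (intro laplace_add[OF lq[OF r] _ lam'(1)] exp_order_const) simp
      then show ?thesis
        using laplace_const[OF lam'(2)] by (simp add: f_def r.diff q0)
    qed
    finally have 1: "laplace (\<lambda>t. r (?G t)) lam = mu * (laplace (\<lambda>t. r (q t)) lam - r u / lam)" .
    \<comment> \<open>A second expression for the same transform, now from the resolvent identity.
      Comparing the two cancels the transform of r(q) and leaves mu / lam times r(u) for that of
      l(q).\<close>
    have "laplace (\<lambda>t. r (?G t)) lam = laplace (\<lambda>t. mu * r (q t) + (- 1) * l (q t)) lam"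
      unfolding laplace_def
    proof (rule set_lebesgue_integral_cong)
      show "\<forall>t. t \<in> {0<..} \<longrightarrow> exp (- lam * t) * r (?G t) = exp (- lam * t) * (mu * r (q t) + (- 1) * l (q t))"
        using resolvent_functional_generator[OF sg l mu dom] by (auto simp: r_def)
    qed simp
    also have "\<dots> = mu * laplace (\<lambda>t. r (q t)) lam + (- 1) * laplace (\<lambda>t. l (q t)) lam"
      by (subst laplace_add[OF exp_order_cmult[OF lq[OF r]] exp_order_cmult[OF lq[OF l]] lam'(1)])
        (simp only: laplace_cmult)
    finally show ?thesis
      using 1 by (simp add: r_def mu_def algebra_simps)
  qed
  with lq[OF l] show ?thesis
    by (rule that)
qed

section \<open>The time-changed orbit as a solution\<close>

context
  fixes L :: "real \<Rightarrow> 'w \<Rightarrow> real"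
  assumes L_cont: "\<And>\<omega>. continuous_on UNIV (\<lambda>t. L t \<omega>)"
    and L_mono: "\<And>t t' \<omega>. t \<le> t' \<Longrightarrow> L t \<omega> \<le> L t' \<omega>"
    and L_nonneg: "\<And>t \<omega>. 0 \<le> L t \<omega>"
    and L_zero: "\<And>\<omega>. L 0 \<omega> = 0"
    and L_joint: "(\<lambda>(t, \<omega>). L t \<omega>) \<in> borel_measurable (borel \<Otimes>\<^sub>M M)"
    and L_law: "\<And>t. t \<ge> 0 \<Longrightarrow> inverse_law M S t = distr M borel (L t)"
    and L_tail: "\<And>r lam. 0 \<le> r \<Longrightarrow> 0 < lam \<Longrightarrow>
      (\<integral>\<^sup>+\<omega>. \<integral>\<^sup>+t. ennreal (exponential_density lam t) * indicator {r<..} (L t \<omega>) \<partial>lborel \<partial>M)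
        = ennreal (exp (- r * laplace_exponent a b \<nu> lam))"
begin

private abbreviation (input) "Q \<equiv> time_changed M S P"

private lemma L_measurable: "L t \<in> borel_measurable M"
proof -
  have "(\<lambda>\<omega>. case (t, \<omega>) of (t, \<omega>) \<Rightarrow> L t \<omega>) \<in> borel_measurable M"
    by (rule measurable_compose[OF measurable_Pair1' L_joint]) simp
  then show ?thesis by (simp only: prod.case)
qed

private lemma exp_moment:
  obtains B lam1 where "B > 0" "lam1 > 0"
    "\<And>t. t \<ge> 0 \<Longrightarrow> integrable M (\<lambda>\<omega>. exp (lam0 * L t \<omega>))"
    "\<And>t. t \<ge> 0 \<Longrightarrow> (\<integral>\<omega>. exp (lam0 * L t \<omega>) \<partial>M) \<le> B * exp (lam1 * t)"
proof -
  obtain lam1 where lam1: "lam1 > 0" "\<And>lam. lam \<ge> lam1 \<Longrightarrow> lam0 < laplace_exponent a b \<nu> lam"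
    using laplace_exponent_large by blast
  let ?phi = "laplace_exponent a b \<nu> lam1"
  have phi: "lam0 < ?phi"
    using lam1 by simp
  \<comment> \<open>The maximum with 1 makes the constant positive.\<close>
  define B where "B = max 1 (?phi * laplace (\<lambda>x. exp (lam0 * x)) ?phi)"
  have le: "(\<integral>\<^sup>+\<omega>. ennreal (exp (lam0 * L t \<omega>)) \<partial>M) \<le> ennreal (B * exp (lam1 * t))" if "t \<ge> 0" for t
  proof -
    have "(\<integral>\<^sup>+\<omega>. ennreal (exp (lam0 * L t \<omega>)) \<partial>M)
        \<le> ennreal (exp (lam1 * t) * (?phi * laplace (\<lambda>x. exp (lam0 * x)) ?phi))"
      using phi lam0 lam1(1) that
      by (intro exp_moment_bound[OF prob_space_axioms L_joint L_nonneg L_mono _ _ L_tail]) auto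
    also have "\<dots> \<le> ennreal (exp (lam1 * t) * B)"
      by (intro ennreal_leI mult_left_mono) (auto simp: B_def)
    finally show ?thesis
      by (simp only: mult.commute)
  qed
  have int: "integrable M (\<lambda>\<omega>. exp (lam0 * L t \<omega>))" if "t \<ge> 0" for t
  proof (rule integrableI_bounded)
    show "(\<integral>\<^sup>+\<omega>. ennreal (norm (exp (lam0 * L t \<omega>))) \<partial>M) < \<infinity>"
      using le_less_trans[OF le[OF that] ennreal_less_top] by simp
    show "(\<lambda>\<omega>. exp (lam0 * L t \<omega>)) \<in> borel_measurable M"
      by (rule measurable_compose[OF L_measurable, of "\<lambda>x. exp (lam0 * x)"])
        (intro borel_measurable_continuous_onI continuous_intros)
  qed
  have "(\<integral>\<omega>. exp (lam0 * L t \<omega>) \<partial>M) \<le> B * exp (lam1 * t)" if "t \<ge> 0" for t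
  proof -
    have eq: "(\<integral>\<^sup>+\<omega>. ennreal (exp (lam0 * L t \<omega>)) \<partial>M) = ennreal (\<integral>\<omega>. exp (lam0 * L t \<omega>) \<partial>M)"
      by (rule nn_integral_eq_integral[OF int[OF that]]) simp
    have "0 \<le> B * exp (lam1 * t)"
      unfolding B_def by (intro mult_nonneg_nonneg) auto
    then show ?thesis
      using le[OF that] unfolding eq by (simp only: ennreal_le_iff)
  qed
  then show ?thesis
    using int lam1(1) by (intro that[of B lam1]) (auto simp only: B_def less_max_iff_disj zero_less_one simp_thms)
qed

private lemma exp_moment_integrable: "t \<ge> 0 \<Longrightarrow> integrable M (\<lambda>\<omega>. exp (lam0 * L t \<omega>))"
  using exp_moment by blast

private lemma orbit_extension_continuous: "continuous_on UNIV (\<lambda>s. blinfun_apply (P (max 0 s)) u)"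
  by (rule continuous_on_compose2[OF orbit_continuous[OF sg]]) (auto intro!: continuous_intros)

private lemma orbit_L: "blinfun_apply (P (max 0 (L t \<omega>))) u = blinfun_apply (P (L t \<omega>)) u"
  using L_nonneg[of t \<omega>] by (simp add: max_def)

private lemma integrand_eq:
  "subordinate_integrand P u = (\<lambda>s. indicator {0..} s *\<^sub>R blinfun_apply (P (max 0 s)) u)"
  by (auto simp: subordinate_integrand_def indicator_def fun_eq_iff)

private lemma orbit_norm_meas:
  "(\<lambda>\<omega>. norm (blinfun_apply (P (L t \<omega>)) u)) \<in> borel_measurable M"
proof -
  have "(\<lambda>s. norm (blinfun_apply (P (max 0 s)) u)) \<in> borel_measurable borel"
    by (intro borel_measurable_continuous_onI continuous_on_norm orbit_extension_continuous)
  from measurable_compose[OF L_measurable[of t] this] show ?thesis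
    by (simp only: orbit_L)
qed

private lemma orbit_norm_integrable:
  assumes "t \<ge> 0"
  shows "integrable M (\<lambda>\<omega>. norm (blinfun_apply (P (L t \<omega>)) u))"
proof (rule Bochner_Integration.integrable_bound)
  show "integrable M (\<lambda>\<omega>. K * norm u * exp (lam0 * L t \<omega>))"
    using exp_moment_integrable[OF assms] by simp
  show "AE \<omega> in M. norm (norm (blinfun_apply (P (L t \<omega>)) u)) \<le> norm (K * norm u * exp (lam0 * L t \<omega>))"
    using growth[OF L_nonneg] K by (simp add: abs_mult mult_ac)
qed (rule orbit_norm_meas)

text \<open>Under the law of \<open>L t\<close> the norm is majorized by K exp(lam0 s) times that of
  u, which has finite mean by \<open>exp_moment\<close>.\<close>

lemma time_changed_integrable:
  assumes t: "t \<ge> 0"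
  shows "bochner_integrable (inverse_law M S t) (subordinate_integrand P u)"
  unfolding L_law[OF t] integrand_eq
proof (rule bochner_integrable_scaleR_continuous)
  have "(\<lambda>s. norm (blinfun_apply (P (max 0 s)) u)) \<in> borel_measurable borel"
    by (intro borel_measurable_continuous_onI continuous_on_norm orbit_extension_continuous)
  then have meas: "(\<lambda>s. indicator {0..} s * norm (blinfun_apply (P (max 0 s)) u)) \<in> borel_measurable borel"
    by (rule borel_measurable_times[OF borel_measurable_indicator[OF atLeast_borel]])
  have "integrable M (\<lambda>\<omega>. indicator {0..} (L t \<omega>) * norm (blinfun_apply (P (max 0 (L t \<omega>))) u))"
    using orbit_norm_integrable[OF t] L_nonneg by (simp add: orbit_L)
  then show "integrable (distr M borel (L t)) (\<lambda>s. indicator {0..} s * norm (blinfun_apply (P (max 0 s)) u))"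
    by (rule iffD2[OF integrable_distr_eq[OF L_measurable meas]])
qed (auto intro: orbit_extension_continuous)

lemma
  fixes l :: "'b \<Rightarrow> real"
  assumes t: "t \<ge> 0" and l: "bounded_linear l"
  shows functional_time_changed: "l (Q t u) = (\<integral>\<omega>. l (blinfun_apply (P (L t \<omega>)) u) \<partial>M)"
    and functional_time_changed_integrable: "integrable M (\<lambda>\<omega>. l (blinfun_apply (P (L t \<omega>)) u))"
proof -
  interpret l: bounded_linear l by (rule l)
  have eq: "l (subordinate_integrand P u s) = indicator {0..} s * l (blinfun_apply (P (max 0 s)) u)" for s
    by (simp add: integrand_eq l.scaleR)
  have "(\<lambda>s. l (blinfun_apply (P (max 0 s)) u)) \<in> borel_measurable borel"
    by (intro borel_measurable_continuous_onI l.continuous_on orbit_extension_continuous)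
  then have meas: "(\<lambda>s. l (subordinate_integrand P u s)) \<in> borel_measurable borel"
    unfolding eq by (rule borel_measurable_times[OF borel_measurable_indicator[OF atLeast_borel]])
  have L: "l (subordinate_integrand P u (L t \<omega>)) = l (blinfun_apply (P (L t \<omega>)) u)" for \<omega>
    using L_nonneg[of t \<omega>] by (simp add: subordinate_integrand_def)
  note int = time_changed_integrable[OF t, of u, unfolded L_law[OF t]]
  show "l (Q t u) = (\<integral>\<omega>. l (blinfun_apply (P (L t \<omega>)) u) \<partial>M)"
    unfolding time_changed_def L_law[OF t] functional_bochner_integral[OF l int]
    by (subst integral_distr[OF L_measurable meas]) (simp only: L)
  show "integrable M (\<lambda>\<omega>. l (blinfun_apply (P (L t \<omega>)) u))"
    using iffD1[OF integrable_distr_eq[OF L_measurable meas] integrable_functional[OF l int]] by (simp only: L)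
qed

text \<open>Keeping the moment explicit gives the constant bound for lam0 = 0, where the moment
  equals 1.\<close>

lemma norm_time_changed:
  assumes t: "t \<ge> 0"
  shows "norm (Q t u) \<le> K * norm u * (\<integral>\<omega>. exp (lam0 * L t \<omega>) \<partial>M)"
proof (rule norm_le_by_functionals)
  fix l :: "'b \<Rightarrow> real" assume l: "bounded_linear l" "\<And>y. \<bar>l y\<bar> \<le> norm y"
  have "l (Q t u) \<le> (\<integral>\<omega>. K * norm u * exp (lam0 * L t \<omega>) \<partial>M)"
    unfolding functional_time_changed[OF t l(1)]
  proof (rule integral_mono)
    show "integrable M (\<lambda>\<omega>. l (blinfun_apply (P (L t \<omega>)) u))"
      by (rule functional_time_changed_integrable[OF t l(1)])
    show "integrable M (\<lambda>\<omega>. K * norm u * exp (lam0 * L t \<omega>))"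
      using exp_moment_integrable[OF t] by simp
    fix \<omega>
    have "l (blinfun_apply (P (L t \<omega>)) u) \<le> norm (blinfun_apply (P (L t \<omega>)) u)"
      using l(2) abs_ge_self order_trans by blast
    also have "\<dots> \<le> K * exp (lam0 * L t \<omega>) * norm u"
      by (rule growth[OF L_nonneg])
    finally show "l (blinfun_apply (P (L t \<omega>)) u) \<le> K * norm u * exp (lam0 * L t \<omega>)"
      by (simp only: mult_ac)
  qed
  then show "l (Q t u) \<le> K * norm u * (\<integral>\<omega>. exp (lam0 * L t \<omega>) \<partial>M)"
    by simp
qed

lemma bounded_linear_time_changed:
  assumes t: "t \<ge> 0"
  shows "bounded_linear (Q t)"
proof (rule bounded_linear_intro)
  show "Q t (u + v) = Q t u + Q t v" for u v
  proof (rule eq_by_functionals)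
    fix l :: "'b \<Rightarrow> real" assume l: "bounded_linear l"
    interpret l: bounded_linear l by (rule l)
    show "l (Q t (u + v)) = l (Q t u + Q t v)"
      using functional_time_changed_integrable[OF t l]
      by (simp add: functional_time_changed[OF t l] blinfun.add_right l.add)
  qed
  show "Q t (r *\<^sub>R u) = r *\<^sub>R Q t u" for r u
  proof (rule eq_by_functionals)
    fix l :: "'b \<Rightarrow> real" assume l: "bounded_linear l"
    interpret l: bounded_linear l by (rule l)
    show "l (Q t (r *\<^sub>R u)) = l (r *\<^sub>R Q t u)"
      by (simp add: functional_time_changed[OF t l] blinfun.scaleR_right l.scaleR)
  qed
  show "norm (Q t u) \<le> norm u * (K * (\<integral>\<omega>. exp (lam0 * L t \<omega>) \<partial>M))" for u
    using norm_time_changed[OF t] by (simp only: mult_ac)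
qed

lemma time_changed_zero: "Q 0 u = u"
proof (rule eq_by_functionals)
  fix l :: "'b \<Rightarrow> real" assume l: "bounded_linear l"
  show "l (Q 0 u) = l u"
    using functional_time_changed[OF order_refl l] by (simp add: L_zero semigroup_zero[OF sg] prob_space)
qed

text \<open>\<open>l\<close> composed with \<open>P h\<close> is again a bounded functional, and
  \<open>P h\<close> commutes with each \<open>P (L t \<omega>)\<close> under the
  expectation.\<close>

lemma time_changed_commute:
  assumes t: "t \<ge> 0" and h: "h \<ge> 0"
  shows "blinfun_apply (P h) (Q t u) = Q t (blinfun_apply (P h) u)"
proof (rule eq_by_functionals)
  fix l :: "'b \<Rightarrow> real" assume l: "bounded_linear l"
  have l': "bounded_linear (\<lambda>v. l (blinfun_apply (P h) v))"
    using bounded_linear_compose[OF l blinfun.bounded_linear_right] .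
  have "blinfun_apply (P h) (blinfun_apply (P (L t \<omega>)) u) = blinfun_apply (P (L t \<omega>)) (blinfun_apply (P h) u)" for \<omega>
    using semigroup_add[OF sg h L_nonneg] semigroup_add[OF sg L_nonneg h] by (metis add.commute)
  then show "l (blinfun_apply (P h) (Q t u)) = l (Q t (blinfun_apply (P h) u))"
    using functional_time_changed[OF t l'] functional_time_changed[OF t l] by simp
qed

text \<open>A bounded operator commuting with the semigroup can be moved through the difference
  quotients defining the generator.\<close>

lemma
  assumes t: "t \<ge> 0" and u: "u \<in> generator_dom P"
  shows time_changed_generator_dom: "Q t u \<in> generator_dom P"
    and generator_time_changed: "generator P (Q t u) = Q t (generator P u)"
proof -
  interpret Q: bounded_linear "Q t"
    by (rule bounded_linear_time_changed[OF t])
  have "((\<lambda>h. (blinfun_apply (P h) (Q t u) - Q t u) /\<^sub>R h) \<longlongrightarrow> Q t (generator P u)) (at_right 0)"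
  proof (rule Lim_transform_eventually)
    show "((\<lambda>h. Q t ((blinfun_apply (P h) u - u) /\<^sub>R h)) \<longlongrightarrow> Q t (generator P u)) (at_right 0)"
      by (intro Q.tendsto generator_tendsto u)
    show "\<forall>\<^sub>F h in at_right 0. Q t ((blinfun_apply (P h) u - u) /\<^sub>R h) = (blinfun_apply (P h) (Q t u) - Q t u) /\<^sub>R h"
      using eventually_at_right_less[of 0]
      by eventually_elim (simp add: time_changed_commute[OF t] Q.scaleR Q.diff)
  qed
  then show "Q t u \<in> generator_dom P" "generator P (Q t u) = Q t (generator P u)"
    by (rule generatorI)+
qed

text \<open>Norm convergence needs an estimate uniform in the functional: for all of norm at most 1
  the difference is below the mean of the norm of the orbit difference. That mean tends to 0 by path
  continuity, with a majorant taken at a time T beyond all times of the sequence.\<close>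

lemma time_changed_continuous: "continuous_on {0..} (\<lambda>t. Q t u)"
  unfolding continuous_on_sequentially comp_def
proof (intro allI ballI impI)
  fix x :: "nat \<Rightarrow> real" and r assume r: "r \<in> {0..}" and x: "(\<forall>n. x n \<in> {0..}) \<and> x \<longlonglongrightarrow> r"
  then obtain T where T: "\<And>n. x n \<le> T"
    using convergent_imp_bounded[of x r] by (auto simp: bounded_real abs_le_iff)
  have rT: "r \<le> T"
    using x T by (intro LIMSEQ_le_const2[of x]) auto
  have T0: "0 \<le> T"
    using rT r by simp
  let ?d = "\<lambda>n \<omega>. norm (blinfun_apply (P (L (x n) \<omega>)) u - blinfun_apply (P (L r \<omega>)) u)"
  \<comment> \<open>The norm is a continuous function of the two real numbers L(x n) and L(r), which
    avoids subtracting random vectors.\<close>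
  have meas: "?d n \<in> borel_measurable M" for n
  proof -
    have "continuous_on UNIV (\<lambda>p :: real \<times> real. norm (blinfun_apply (P (max 0 (fst p))) u - blinfun_apply (P (max 0 (snd p))) u))"
      by (intro continuous_intros continuous_on_compose2[OF orbit_extension_continuous]) auto
    then have "(\<lambda>p :: real \<times> real. norm (blinfun_apply (P (max 0 (fst p))) u - blinfun_apply (P (max 0 (snd p))) u))
        \<in> borel_measurable (borel \<Otimes>\<^sub>M borel)"
      unfolding borel_prod by (rule borel_measurable_continuous_onI)
    from measurable_compose[OF measurable_Pair[OF L_measurable L_measurable] this, of "x n" r]
    show ?thesis by (simp only: orbit_L fst_conv snd_conv)
  qed
  have dom: "?d n \<omega> \<le> 2 * (K * norm u * exp (lam0 * L T \<omega>))" for n \<omega>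
  proof -
    have "norm (blinfun_apply (P (L s \<omega>)) u) \<le> K * norm u * exp (lam0 * L T \<omega>)" if "s \<le> T" for s
    proof -
      have "norm (blinfun_apply (P (L s \<omega>)) u) \<le> K * exp (lam0 * L s \<omega>) * norm u"
        by (rule growth[OF L_nonneg])
      also have "\<dots> \<le> K * exp (lam0 * L T \<omega>) * norm u"
        using K lam0 L_mono[OF that, of \<omega>] by (intro mult_right_mono mult_left_mono) (auto intro: mult_left_mono)
      finally show ?thesis by (simp only: mult_ac)
    qed
    from this[OF T[of n]] this[OF rT] show ?thesis
      using norm_triangle_ineq4[of "blinfun_apply (P (L (x n) \<omega>)) u" "blinfun_apply (P (L r \<omega>)) u"]
      by linarith
  qed
  have dom_int: "integrable M (\<lambda>\<omega>. 2 * (K * norm u * exp (lam0 * L T \<omega>)))"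
    using exp_moment_integrable[OF T0] by simp
  have d_int: "integrable M (?d n)" for n
  proof (rule Bochner_Integration.integrable_bound[OF dom_int meas])
    have "norm (?d n \<omega>) \<le> norm (2 * (K * norm u * exp (lam0 * L T \<omega>)))" for \<omega>
      using order_trans[OF dom[of n \<omega>] abs_ge_self] by (simp only: real_norm_def abs_norm_cancel)
    then show "AE \<omega> in M. norm (?d n \<omega>) \<le> norm (2 * (K * norm u * exp (lam0 * L T \<omega>)))"
      by (intro always_eventually allI)
  qed
  have lim: "(\<lambda>n. \<integral>\<omega>. ?d n \<omega> \<partial>M) \<longlonglongrightarrow> (\<integral>\<omega>. 0 \<partial>M)"
  proof (rule integral_dominated_convergence[OF _ meas dom_int])
    show "AE \<omega> in M. (\<lambda>n. ?d n \<omega>) \<longlonglongrightarrow> 0"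
    proof (rule AE_I2)
      fix \<omega>
      have "continuous_on UNIV (\<lambda>t. blinfun_apply (P (max 0 (L t \<omega>))) u)"
        by (rule continuous_on_compose2[OF orbit_extension_continuous L_cont]) simp
      then have "isCont (\<lambda>t. blinfun_apply (P (max 0 (L t \<omega>))) u) r"
        by (simp add: continuous_on_eq_continuous_at)
      from isCont_tendsto_compose[OF this conjunct2[OF x]]
      have "(\<lambda>n. blinfun_apply (P (L (x n) \<omega>)) u) \<longlonglongrightarrow> blinfun_apply (P (L r \<omega>)) u"
        by (simp only: orbit_L)
      then show "(\<lambda>n. ?d n \<omega>) \<longlonglongrightarrow> 0"
        by (rule tendsto_norm_zero[OF LIM_zero])
    qed
    show "AE \<omega> in M. norm (?d n \<omega>) \<le> 2 * (K * norm u * exp (lam0 * L T \<omega>))" for n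
      by (intro always_eventually allI) (simp only: real_norm_def abs_norm_cancel dom)
  qed simp
  have bound: "norm (Q (x n) u - Q r u) \<le> (\<integral>\<omega>. ?d n \<omega> \<partial>M)" for n
  proof (rule norm_le_by_functionals)
    fix l :: "'b \<Rightarrow> real" assume l: "bounded_linear l" "\<And>y. \<bar>l y\<bar> \<le> norm y"
    interpret l: bounded_linear l by (rule l(1))
    have xn: "x n \<ge> 0" and r0: "r \<ge> 0"
      using x r by auto
    note ints = functional_time_changed_integrable[OF xn l(1), of u] functional_time_changed_integrable[OF r0 l(1), of u]
    have "l (Q (x n) u - Q r u)
        = (\<integral>\<omega>. l (blinfun_apply (P (L (x n) \<omega>)) u) - l (blinfun_apply (P (L r \<omega>)) u) \<partial>M)"
      unfolding l.diff functional_time_changed[OF xn l(1)] functional_time_changed[OF r0 l(1)]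
      by (rule Bochner_Integration.integral_diff[OF ints, symmetric])
    also have "\<dots> \<le> (\<integral>\<omega>. ?d n \<omega> \<partial>M)"
    proof (rule integral_mono)
      show "integrable M (\<lambda>\<omega>. l (blinfun_apply (P (L (x n) \<omega>)) u) - l (blinfun_apply (P (L r \<omega>)) u))"
        using ints by (rule Bochner_Integration.integrable_diff)
      show "l (blinfun_apply (P (L (x n) \<omega>)) u) - l (blinfun_apply (P (L r \<omega>)) u) \<le> ?d n \<omega>" for \<omega>
        unfolding l.diff[symmetric] using l(2) by (rule order_trans[OF abs_ge_self])
    qed (rule d_int)
    finally show "l (Q (x n) u - Q r u) \<le> (\<integral>\<omega>. ?d n \<omega> \<partial>M)" .
  qed
  have "(\<lambda>n. Q (x n) u - Q r u) \<longlonglongrightarrow> 0"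
    using lim by (intro Lim_null_comparison[OF always_eventually[OF allI[OF bound]]]) (simp only: integral_zero)
  then show "(\<lambda>n. Q (x n) u) \<longlonglongrightarrow> Q r u"
    by (rule LIM_zero_cancel)
qed

lemma time_changed_bound:
  obtains C c where "C > 0" "c > 0" "\<And>t. t \<ge> 0 \<Longrightarrow> norm (Q t u) \<le> C * exp (c * t)"
proof -
  obtain B lam1 where B: "B > 0" "lam1 > 0"
    "\<And>t. t \<ge> 0 \<Longrightarrow> (\<integral>\<omega>. exp (lam0 * L t \<omega>) \<partial>M) \<le> B * exp (lam1 * t)"
    by (rule exp_moment, rule that)
  \<comment> \<open>Adding 1 to the norm keeps the constant positive for u = 0.\<close>
  have "norm (Q t u) \<le> (K * (norm u + 1) * B) * exp (lam1 * t)" if t: "t \<ge> 0" for t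
  proof -
    have "norm (Q t u) \<le> K * norm u * (\<integral>\<omega>. exp (lam0 * L t \<omega>) \<partial>M)"
      by (rule norm_time_changed[OF t])
    also have "\<dots> \<le> (K * (norm u + 1)) * (B * exp (lam1 * t))"
    proof (rule mult_mono[OF _ B(3)[OF t]])
      show "K * norm u \<le> K * (norm u + 1)"
        using K by (intro mult_left_mono) simp_all
      show "0 \<le> K * (norm u + 1)"
        using K by (intro mult_nonneg_nonneg) simp_all
      show "0 \<le> (\<integral>\<omega>. exp (lam0 * L t \<omega>) \<partial>M)"
        by (rule Bochner_Integration.integral_nonneg) simp
    qed
    finally show ?thesis by (simp only: mult_ac)
  qed
  moreover have "K * (norm u + 1) * B > 0"
    using K B(1) by (intro mult_pos_pos) (auto intro: add_nonneg_pos)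
  ultimately show ?thesis
    using B(2) by (intro that)
qed

lemma time_changed_regular: "regular_on lam0 {0..} (\<lambda>t. Q t u)"
proof -
  have "bounded ((\<lambda>t. Q t u) ` {0..})" if "lam0 = 0"
  proof (rule boundedI)
    fix y assume "y \<in> (\<lambda>t. Q t u) ` {0..}"
    then obtain t where "t \<ge> 0" "y = Q t u" by auto
    then show "norm y \<le> K * norm u"
      using norm_time_changed[of t u] \<open>lam0 = 0\<close> by (simp add: prob_space)
  qed
  then show ?thesis
    using time_changed_continuous time_changed_bound[of u]
    unfolding regular_on_def exponentially_bounded_on_def by (metis atLeast_iff)
qed

lemma laplace_time_changed:
  assumes l: "bounded_linear l" and lam: "0 < lam" and phi: "lam0 < laplace_exponent a b \<nu> lam"
  shows "laplace (\<lambda>t. l (Q t u)) lam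
    = laplace_exponent a b \<nu> lam / lam * resolvent_functional P (laplace_exponent a b \<nu> lam) l u"
proof -
  have "laplace (\<lambda>t. l (Q t u)) lam = laplace (\<lambda>t. \<integral>\<omega>. l (blinfun_apply (P (L t \<omega>)) u) \<partial>M) lam"
    unfolding laplace_def by (rule set_lebesgue_integral_cong) (auto simp: functional_time_changed[OF _ l])
  also have "\<dots> = laplace_exponent a b \<nu> lam / lam * laplace (\<lambda>s. l (blinfun_apply (P s) u)) (laplace_exponent a b \<nu> lam)"
    using lam phi lam0
    by (intro laplace_time_change[OF prob_space_axioms L_joint L_nonneg L_mono _ _ L_tail
          orbit_functional_exp_order[OF sg l]]) auto
  finally show ?thesis
    by (simp add: resolvent_functional_def)
qed

text \<open>Integrated form of the equation. With mu = \<phi>(lam) and the resolvent R, both sides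
  tested by \<open>l\<close> have the transform mu / lam^2 times l(mu R u - u).\<close>

lemma phi_primitive_time_changed:
  assumes u: "u \<in> generator_dom P" and t: "t \<ge> 0"
  shows "phi_primitive a b \<nu> (\<lambda>s. Q s u - Q 0 u) t = integral {0..t} (\<lambda>s. Q s (generator P u))"
proof (rule eq_by_functionals)
  fix l :: "'b \<Rightarrow> real" assume l: "bounded_linear l"
  interpret l: bounded_linear l by (rule l)
  let ?G = "generator P u"
  obtain C1 c1 where 1: "C1 > 0" "c1 > 0" "\<And>t. t \<ge> 0 \<Longrightarrow> norm (Q t u) \<le> C1 * exp (c1 * t)"
    using time_changed_bound by blast
  obtain C2 c2 where 2: "C2 > 0" "c2 > 0" "\<And>t. t \<ge> 0 \<Longrightarrow> norm (Q t ?G) \<le> C2 * exp (c2 * t)"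
    using time_changed_bound by blast
  obtain lam1 where lam1: "lam1 > 0" "\<And>lam. lam \<ge> lam1 \<Longrightarrow> lam0 < laplace_exponent a b \<nu> lam"
    using laplace_exponent_large by blast
  define f where "f s = Q s u - Q 0 u" for s
  have f: "continuous_on {0..} f" "f 0 = 0"
    unfolding f_def by (auto intro!: continuous_intros time_changed_continuous)
  have bf: "norm (f t) \<le> (2 * C1) * exp (c1 * t)" if "t \<ge> 0" for t
    unfolding f_def by (rule norm_diff_initial_le[OF 1 that])
  define A where "A t = l (phi_primitive a b \<nu> f t)" for t
  define g where "g t = l (Q t ?G)" for t
  have A: "exp_order c1 A"
    unfolding A_def by (rule exp_order_phi_primitive[OF levy_triplet f 1(2) bf l])
  have g: "exp_order c2 g"
    unfolding g_def by (rule exp_order_functional[OF l time_changed_continuous 2(3)])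
  have lq: "exp_order c1 (\<lambda>t. l (Q t u))"
    by (rule exp_order_functional[OF l time_changed_continuous 1(3)])
  \<comment> \<open>A common rate; the second entry is raised by 1 because of the primitive.\<close>
  define c where "c = max c1 (c2 + 1)"
  have "exp_order c A"
    using A by (rule exp_order_mono) (simp add: c_def)
  moreover have "exp_order c (\<lambda>t. - 1 * integral {0..t} g)"
    by (rule exp_order_mono[OF exp_order_cmult[OF exp_order_primitive[OF g less_imp_le[OF 2(2)]]]])
      (simp add: c_def)
  ultimately have AB: "exp_order c A" "exp_order c (\<lambda>t. - 1 * integral {0..t} g)"
    by blast+
  have "A t + - 1 * integral {0..t} g = 0"
  proof (rule laplace_eq_0_imp_eq_0[OF exp_order_add[OF AB] _ t])
    fix lam assume lam: "lam \<ge> max lam1 (c + 1)"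
    define mu where "mu = laplace_exponent a b \<nu> lam"
    define R where "R = resolvent_functional P mu l u"
    have lam': "0 < lam" "c1 < lam" "c2 + 1 < lam" "c < lam" and mu: "lam0 < mu"
      using lam lam1 1(2) by (auto simp: c_def mu_def)
    have "laplace A lam = mu / lam * laplace (\<lambda>t. l (f t)) lam"
      unfolding A_def mu_def by (rule laplace_phi_primitive[OF levy_triplet f 1(2) bf l lam'(2)])
    also have "laplace (\<lambda>t. l (f t)) lam = mu / lam * R - l u / lam"
    proof -
      have "laplace (\<lambda>t. l (Q t u) + - l u) lam = laplace (\<lambda>t. l (Q t u)) lam + laplace (\<lambda>t. - l u) lam"
        using 1(2) by (intro laplace_add[OF lq _ lam'(2)] exp_order_const) simp
      then show ?thesis
        using laplace_const[OF lam'(1)] laplace_time_changed[OF l lam'(1), of u] mu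
        by (simp add: f_def l.diff time_changed_zero mu_def R_def)
    qed
    finally have LA: "laplace A lam = mu / lam * (mu / lam * R - l u / lam)" .
    have "lam * laplace (\<lambda>t. integral {0..t} g) lam = laplace g lam"
      using laplace_primitive[OF g _ lam'(3)] 2(2) by simp
    also have "\<dots> = mu / lam * (mu * R - l u)"
      using laplace_time_changed[OF l lam'(1), of ?G] mu resolvent_functional_generator[OF sg l mu u]
      by (simp add: g_def[abs_def] mu_def R_def)
    finally have LB: "laplace (\<lambda>t. integral {0..t} g) lam = mu / lam * (mu * R - l u) / lam"
      using lam'(1) by (simp add: field_simps)
    have "laplace (\<lambda>t. A t + - 1 * integral {0..t} g) lam
        = laplace A lam + - 1 * laplace (\<lambda>t. integral {0..t} g) lam"
      unfolding laplace_add[OF AB lam'(4)] laplace_cmult ..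
    then show "laplace (\<lambda>t. A t + - 1 * integral {0..t} g) lam = 0"
      unfolding LA LB using lam'(1) by (simp add: field_simps)
  qed
  moreover have "integral {0..t} g = l (integral {0..t} (\<lambda>s. Q s ?G))"
    unfolding g_def
    using integral_linear[OF integrable_continuous_interval l, of 0 t "\<lambda>s. Q s ?G"]
      continuous_on_subset[OF time_changed_continuous]
    by (auto simp: comp_def)
  ultimately show "l (phi_primitive a b \<nu> (\<lambda>s. Q s u - Q 0 u) t) = l (integral {0..t} (\<lambda>s. Q s ?G))"
    by (simp add: A_def f_def[abs_def])
qed

text \<open>On the open half-line the primitive is the integral of a continuous function, so it is
  differentiable there with derivative \<open>Q t\<close> applied to the generator at u, which is
  the generator at \<open>Q t u\<close>.\<close>

lemma time_changed_phi_solution: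
  assumes u: "u \<in> generator_dom P"
  shows "phi_solution a b \<nu> P lam0 u (\<lambda>t. Q t u)"
proof -
  let ?G = "generator P u" and ?f = "\<lambda>s. Q s u - Q 0 u"
  have vd: "(phi_primitive a b \<nu> ?f has_vector_derivative Q t ?G) (at t)" if t: "t > 0" for t
  proof (rule has_vector_derivative_transform_within_open)
    show "((\<lambda>t. integral {0..t} (\<lambda>s. Q s ?G)) has_vector_derivative Q t ?G) (at t)"
      using time_changed_continuous t by (rule integral_has_vector_derivative_at)
    show "integral {0..x} (\<lambda>s. Q s ?G) = phi_primitive a b \<nu> ?f x" if "x \<in> {0<..}" for x
      using phi_primitive_time_changed[OF u, of x] that by simp
  qed (use t in auto)
  then have deriv: "phi_derivative a b \<nu> ?f t = Q t ?G" if "t > 0" for t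
    using that by (simp add: phi_derivative_def vector_derivative_at)
  obtain C c where C: "C > 0" "c > 0" "\<And>t. t \<ge> 0 \<Longrightarrow> norm (Q t u) \<le> C * exp (c * t)"
    using time_changed_bound by blast
  have bf: "norm (?f t) \<le> (2 * C) * exp (c * t)" if "t \<ge> 0" for t
    by (rule norm_diff_initial_le[OF C that])
  have diff: "phi_differentiable a b \<nu> ?f t" if "t > 0" for t
    unfolding phi_differentiable_def
  proof (intro conjI always_eventually allI)
    have "continuous_on {0..} ?f"
      by (intro continuous_intros time_changed_continuous)
    then show "bochner_integrable lborel (phi_integrand a \<nu> ?f r)" for r
      by (rule phi_integrand_integrable[OF levy_triplet _ _ C(2) bf]) simp
    show "phi_primitive a b \<nu> ?f differentiable at t"
      using vd[OF that] by (rule differentiableI_vector)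
  qed
  have rG: "regular_on lam0 {0..} (\<lambda>t. Q t ?G)"
    by (rule time_changed_regular)
  show ?thesis
    unfolding phi_solution_def
  proof (intro conjI allI impI)
    show "Q 0 u = u" by (rule time_changed_zero)
    show "regular_on lam0 {0..} (\<lambda>t. Q t u)" by (rule time_changed_regular)
    show "regular_on lam0 {0..} (\<lambda>t. generator P (Q t u))"
      using rG by (rule regular_on_cong_subset) (auto simp: generator_time_changed[OF _ u])
    show "regular_on lam0 {0<..} (phi_derivative a b \<nu> ?f)"
      using rG by (rule regular_on_cong_subset) (auto simp: deriv)
    show "Q t u \<in> generator_dom P" if "0 \<le> t" for t
      using that u by (rule time_changed_generator_dom)
    show "phi_derivative a b \<nu> ?f t = generator P (Q t u)" if "0 < t" for t
      using that by (simp add: deriv generator_time_changed[OF _ u])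
  qed (rule diff)
qed

end

text \<open>The transform of a functional of a solution is determined by u for large lam. Two
  solutions may come with different rates and thresholds, hence the maxima.\<close>

lemma phi_solution_unique:
  assumes q: "phi_solution a b \<nu> P lam0 u q" and q': "phi_solution a b \<nu> P lam0 u q'" and t: "t \<ge> 0"
  shows "q t = q' t"
proof (rule eq_by_functionals)
  fix l :: "'b \<Rightarrow> real" assume l: "bounded_linear l"
  let ?R = "\<lambda>lam. laplace_exponent a b \<nu> lam / lam * resolvent_functional P (laplace_exponent a b \<nu> lam) l u"
  obtain c l0 where 1: "exp_order c (\<lambda>t. l (q t))" "\<And>lam. lam \<ge> l0 \<Longrightarrow> laplace (\<lambda>t. l (q t)) lam = ?R lam"
    using laplace_phi_solution[OF q l] by blast
  obtain c' l0' where 2: "exp_order c' (\<lambda>t. l (q' t))" "\<And>lam. lam \<ge> l0' \<Longrightarrow> laplace (\<lambda>t. l (q' t)) lam = ?R lam"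
    using laplace_phi_solution[OF q' l] by blast
  define d where "d = max c c'"
  have "exp_order d (\<lambda>t. l (q t))"
    by (rule exp_order_mono[OF 1(1)]) (simp add: d_def)
  moreover have "exp_order d (\<lambda>t. - 1 * l (q' t))"
    by (rule exp_order_mono[OF exp_order_cmult[OF 2(1)]]) (simp add: d_def)
  ultimately have d: "exp_order d (\<lambda>t. l (q t))" "exp_order d (\<lambda>t. - 1 * l (q' t))"
    by blast+
  have "l (q t) + - 1 * l (q' t) = 0"
  proof (rule laplace_eq_0_imp_eq_0[OF exp_order_add[OF d] _ t])
    fix lam assume lam: "lam \<ge> max (d + 1) (max l0 l0')"
    then have "d < lam" by simp
    from laplace_add[OF d this]
    have "laplace (\<lambda>t. l (q t) + - 1 * l (q' t)) lam = laplace (\<lambda>t. l (q t)) lam + - 1 * laplace (\<lambda>t. l (q' t)) lam"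
      by (simp only: laplace_cmult)
    then show "laplace (\<lambda>t. l (q t) + - 1 * l (q' t)) lam = 0"
      using 1(2)[of lam] 2(2)[of lam] lam by simp
  qed
  then show "l (q t) = l (q' t)" by simp
qed

end

theorem theorem4p3:
  fixes M :: "'w measure" and S :: "real \<Rightarrow> 'w \<Rightarrow> ereal"
    and a b :: real and \<nu> :: "real measure"
    and P :: "real \<Rightarrow> 'b::banach \<Rightarrow>\<^sub>L 'b" and K lam0 :: real
  assumes "killed_subordinator M S a b \<nu>"
    and "b > 0 \<or> emeasure \<nu> {0<..} = \<infinity>"
    and "C0_semigroup P"
    and "K > 0" and "lam0 \<ge> 0"
    and "\<And>t u. t \<ge> 0 \<Longrightarrow> norm (blinfun_apply (P t) u) \<le> K * exp (lam0 * t) * norm u"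
  shows "(\<forall>t\<ge>0. \<forall>u. bochner_integrable (inverse_law M S t) (subordinate_integrand P u)) \<and>
    (\<forall>u. regular_on lam0 {0..} (\<lambda>t. time_changed M S P t u)) \<and>
    (\<forall>u\<in>generator_dom P.
       phi_solution a b \<nu> P lam0 u (\<lambda>t. time_changed M S P t u) \<and>
       (\<forall>q. phi_solution a b \<nu> P lam0 u q \<longrightarrow> (\<forall>t\<ge>0. q t = time_changed M S P t u)))"
proof -
  \<comment> \<open>This version of the inverse is auxiliary: the conclusion refers to the
    subordinator through \<open>inverse_law\<close> alone.\<close>
  obtain L where L:
    "\<And>\<omega>. continuous_on UNIV (\<lambda>t. L t \<omega>)"
    "\<And>t t' \<omega>. t \<le> t' \<Longrightarrow> L t \<omega> \<le> L t' \<omega>"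
    "\<And>t \<omega>. 0 \<le> L t \<omega>"
    "\<And>\<omega>. L 0 \<omega> = 0"
    "(\<lambda>(t, \<omega>). L t \<omega>) \<in> borel_measurable (borel \<Otimes>\<^sub>M M)"
    "\<And>t. t \<ge> 0 \<Longrightarrow> inverse_law M S t = distr M borel (L t)"
    "\<And>r lam. 0 \<le> r \<Longrightarrow> 0 < lam \<Longrightarrow>
      (\<integral>\<^sup>+\<omega>. \<integral>\<^sup>+t. ennreal (exponential_density lam t) * indicator {r<..} (L t \<omega>) \<partial>lborel \<partial>M)
        = ennreal (exp (- r * laplace_exponent a b \<nu> lam))"
    using subordinator_inverse[OF assms(1,2)] by blast
  note facts = assms L
  show ?thesis
    using time_changed_integrable[OF facts] time_changed_regular[OF facts]
      time_changed_phi_solution[OF facts] phi_solution_unique[OF assms]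
    by blast
qed

end
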